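(* Let $\hat\Gamma$ be a germ of singular curve at $0\in\mathbb{C}^2$ that is weakly isolated for a germ of holomorphic foliation $\mathcal{F}$ at $0$, and let $\pi_1$ be the blow-up of the origin. Let $P\in\pi_1^{-1}(0)$ and let $\hat\Gamma_P$ be the germ at $P$ of the union of the $\pi_1^*\mathcal{F}$-invariant irreducible components of the total transform $\pi_1^{-1}(\hat\Gamma)$ containing $P$. If $\hat\Gamma_P$ is singular, then $\hat\Gamma_P$ is a weakly isolated curve for $\pi_1^*\mathcal{F}$ (at the point $P$).
   Context: A germ of holomorphic foliation $\mathcal{F}$ at a point $P$ of a smooth complex surface is induced, in local coordinates centered at $P$, by a holomorphic vector field $X=a\,\partial_x+b\,\partial_y$ with $\mathrm{Sing}(X)\subset\{P\}$. Germs of curves are reduced. A curve germ is singular if its multiplicity (the vanishing order of a reduced equation) is at least $2$. Pull-backs of foliations by blow-ups are taken saturated (common factors of the coefficients divided out). For an irreducible $\mathcal{F}$-invariant germ $\gamma$ with Puiseux parametrization $\alpha$, $Z_P(\mathcal{F},\gamma)$ is the vanishing order at the origin of the one-variable vector field $\alpha^*X$ (defined by $d\alpha(\alpha^*X)=X\circ\alpha$). For an irreducible germ $\gamma$ with irreducible equation $g=0$, $\mathrm{tang}_P(\mathcal{F},\gamma)=\dim_{\mathbb{C}}\mathbb{C}\{x,y\}/(g,X(g))$. Weak isolation. Let $\hat\Gamma$ be a singular $\mathcal{F}$-invariant curve germ at a point $P_0$ of a smooth surface and $\pi$ its minimal desingularization, i.e. the minimal sequence of point blow-ups over $P_0$ such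 that the strict transforms of the irreducible components of $\hat\Gamma$ are smooth, pairwise disjoint and transverse to $E=\pi^{-1}(P_0)$ at nonsingular points of $E$. For an irreducible component $\gamma$ of $\hat\Gamma$, let $P_\gamma$ be the point where its strict transform meets $E$ and $D_\gamma$ the irreducible component of $E$ containing $P_\gamma$. Put $\kappa_{P_\gamma}(\pi^*\mathcal{F},D_\gamma)=\mathrm{tang}_{P_\gamma}(\pi^*\mathcal{F},D_\gamma)$ if $D_\gamma$ is not invariant by $\pi^*\mathcal{F}$, and $\kappa_{P_\gamma}(\pi^*\mathcal{F},D_\gamma)=Z_{P_\gamma}(\pi^*\mathcal{F},D_\gamma)$ if $D_\gamma$ is invariant. A normal-crossings divisor at a point is a union of zero, one or two nonsingular irreducible curve germs through that point, mutually transverse if there are two. $\hat\Gamma$ is weakly isolated for $\mathcal{F}$ if one can write $\hat\Gamma=\Gamma\cup\overline{\Gamma}$ with $\overline\Gamma$ a normal-crossings divisor at $P_0$, $\Gamma\cap\overline\Gamma\subset\{P_0\}$, and $\kappa_{P_\gamma}(\pi^*\mathcal{F},D_\gamma)\ge1$ for every irreducible component $\gamma$ of $\Gamma$. *)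

theory Defs
  imports
    "HOL-Analysis.Analysis"
    "HOL-Computational_Algebra.Squarefree"
begin

unbundle no vec_syntax
unbundle fps_syntax

section \<open>The ring of germs of holomorphic functions in two variables\<close>

text \<open>
  A double series is an element \<open>f\<close> of \<open>complex fps fps\<close>; the coefficient of \<open>x\<^sup>i y\<^sup>j\<close> is
  \<open>f $ j $ i\<close> (the outer variable is \<open>y\<close>).
\<close>

definition convergent2 :: "complex fps fps \<Rightarrow> bool" where
  "convergent2 f \<longleftrightarrow> (\<exists>C R. \<forall>i j. norm (f $ j $ i) \<le> C * R ^ (i + j))"

lemma convergent2I: "(\<And>i j. norm (f $ j $ i) \<le> C * R ^ (i + j)) \<Longrightarrow> convergent2 f"
  by (auto simp: convergent2_def)

lemma convergent2E:
  assumes "convergent2 f"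
  obtains C R where "C \<ge> 1" "R \<ge> 1" "\<And>i j. norm (f $ j $ i) \<le> C * R ^ (i + j)"
proof -
  obtain C R where *: "\<And>i j. norm (f $ j $ i) \<le> C * R ^ (i + j)"
    using assms by (auto simp: convergent2_def)
  show ?thesis
  proof (rule that[of "max 1 \<bar>C\<bar>" "max 1 \<bar>R\<bar>"])
    fix i j
    have "norm (f $ j $ i) \<le> \<bar>C * R ^ (i + j)\<bar>" using *[of j i] by linarith
    also have "\<dots> = \<bar>C\<bar> * \<bar>R\<bar> ^ (i + j)" by (simp add: abs_mult power_abs)
    also have "\<dots> \<le> max 1 \<bar>C\<bar> * (max 1 \<bar>R\<bar>) ^ (i + j)"
      by (intro mult_mono power_mono) auto
    finally show "norm (f $ j $ i) \<le> max 1 \<bar>C\<bar> * (max 1 \<bar>R\<bar>) ^ (i + j)" .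
  qed auto
qed

lemma mult_nth2:
  "(f * g) $ n $ m = (\<Sum>l\<le>n. \<Sum>k\<le>m. f $ l $ k * g $ (n - l) $ (m - k))"
  for f g :: "complex fps fps"
  by (simp add: fps_mult_nth fps_sum_nth atLeast0AtMost)

lemma sum_half_power_le: "(\<Sum>k\<le>m. (1/2 :: real) ^ (m - k)) \<le> 2"
proof -
  have "(\<Sum>k\<le>m. (1/2 :: real) ^ (m - k)) = (\<Sum>k\<le>m. (1/2) ^ k)"
    by (rule sum.reindex_bij_witness[of _ "\<lambda>k. m - k" "\<lambda>k. m - k"]) auto
  also have "\<dots> = 2 - (1/2) ^ m" by (induction m) (auto simp: field_simps)
  also have "\<dots> \<le> 2" by simp
  finally show ?thesis .
qed

lemma mult_bound2:
  fixes f g :: "complex fps fps"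
  assumes f: "\<And>i j. norm (f $ j $ i) \<le> B * (2 * R) ^ (i + j)"
    and g: "\<And>i j. norm (g $ j $ i) \<le> A * R ^ (i + j)"
    and R: "R \<ge> 1" and A: "A \<ge> 0" and B: "B \<ge> 0"
  shows "norm ((f * g) $ j $ i) \<le> (B * (4 * A)) * (2 * R) ^ (i + j)"
proof -
  have term_le: "norm (f $ l $ k * g $ (j - l) $ (i - k))
      \<le> (B * A * (2 * R) ^ (i + j)) * ((1/2) ^ (j - l) * (1/2) ^ (i - k))"
    if "l \<le> j" "k \<le> i" for l k
  proof -
    have "norm (f $ l $ k * g $ (j - l) $ (i - k))
        \<le> (B * (2 * R) ^ (k + l)) * (A * R ^ ((i - k) + (j - l)))"
      unfolding norm_mult using R B by (intro mult_mono f g) auto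
    also have "R ^ ((i - k) + (j - l)) = (2 * R) ^ ((i - k) + (j - l)) * (1/2) ^ ((i - k) + (j - l))"
      using power_mult_distrib[of "2 * R" "1/2" "(i - k) + (j - l)"] by simp
    also have "(B * (2 * R) ^ (k + l)) * (A * ((2 * R) ^ ((i - k) + (j - l)) * (1/2) ^ ((i - k) + (j - l))))
        = (B * A * (2 * R) ^ ((k + l) + ((i - k) + (j - l)))) * ((1/2) ^ (j - l) * (1/2) ^ (i - k))"
      by (simp only: power_add ac_simps)
    also have "(k + l) + ((i - k) + (j - l)) = i + j" using that by simp
    finally show ?thesis .
  qed
  have "norm ((f * g) $ j $ i) \<le> (\<Sum>l\<le>j. \<Sum>k\<le>i. norm (f $ l $ k * g $ (j - l) $ (i - k)))"
    unfolding mult_nth2 by (intro order.trans[OF norm_sum] sum_mono)  auto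
  also have "\<dots> \<le> (\<Sum>l\<le>j. \<Sum>k\<le>i. (B * A * (2 * R) ^ (i + j)) * ((1/2) ^ (j - l) * (1/2) ^ (i - k)))"
    by (intro sum_mono term_le) auto
  also have "\<dots> = (B * A * (2 * R) ^ (i + j)) * ((\<Sum>l\<le>j. (1/2) ^ (j - l)) * (\<Sum>k\<le>i. (1/2) ^ (i - k)))"
    by (simp only: sum_product sum_distrib_left[symmetric])
  also have "\<dots> \<le> (B * A * (2 * R) ^ (i + j)) * (2 * 2)"
    using R A B by (intro mult_left_mono mult_mono sum_half_power_le) (auto intro!: sum_nonneg)
  finally show ?thesis by (simp add: ac_simps)
qed

lemma bound2_mono:
  assumes "norm (z :: complex) \<le> C * R ^ n" "0 \<le> C" "C \<le> D" "0 \<le> R" "R \<le> S"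
  shows "norm z \<le> D * S ^ n"
proof -
  have "C * R ^ n \<le> D * S ^ n"
    using assms(2-5) by (intro mult_mono power_mono) auto
  with assms(1) show ?thesis by linarith
qed

lemma convergent2E2:
  assumes "convergent2 f" "convergent2 g"
  obtains C R where "C \<ge> 1" "R \<ge> 1"
    "\<And>i j. norm (f $ j $ i) \<le> C * R ^ (i + j)" "\<And>i j. norm (g $ j $ i) \<le> C * R ^ (i + j)"
proof -
  obtain C R where f: "C \<ge> 1" "R \<ge> 1" "\<And>i j. norm (f $ j $ i) \<le> C * R ^ (i + j)"
    by (rule convergent2E[OF assms(1)], rule that)
  obtain D S where g: "D \<ge> 1" "S \<ge> 1" "\<And>i j. norm (g $ j $ i) \<le> D * S ^ (i + j)"
    by (rule convergent2E[OF assms(2)], rule that)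
  show ?thesis
  proof (rule that[of "max C D" "max R S"])
    show "norm (f $ j $ i) \<le> max C D * max R S ^ (i + j)" for i j
      by (rule bound2_mono[OF f(3)]) (use f(1,2) in auto)
    show "norm (g $ j $ i) \<le> max C D * max R S ^ (i + j)" for i j
      by (rule bound2_mono[OF g(3)]) (use g(1,2) in auto)
  qed (use f(1,2) in auto)
qed

lemma convergent2_mult:
  assumes "convergent2 f" "convergent2 g" shows "convergent2 (f * g)"
proof -
  obtain C R where fg: "C \<ge> 1" "R \<ge> 1" "\<And>i j. norm (f $ j $ i) \<le> C * R ^ (i + j)"
      "\<And>i j. norm (g $ j $ i) \<le> C * R ^ (i + j)"
    by (rule convergent2E2[OF assms], rule that)
  have f: "norm (f $ j $ i) \<le> C * (2 * R) ^ (i + j)" for i j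
    by (rule bound2_mono[OF fg(3)]) (use fg(1,2) in auto)
  have "norm ((f * g) $ j $ i) \<le> (C * (4 * C)) * (2 * R) ^ (i + j)" for i j
    by (rule mult_bound2[OF f fg(4)]) (use fg(1,2) in auto)
  thus ?thesis by (rule convergent2I)
qed

lemma convergent2_add:
  assumes "convergent2 f" "convergent2 g" shows "convergent2 (f + g)"
proof -
  obtain C R where fg: "C \<ge> 1" "R \<ge> 1" "\<And>i j. norm (f $ j $ i) \<le> C * R ^ (i + j)"
      "\<And>i j. norm (g $ j $ i) \<le> C * R ^ (i + j)"
    by (rule convergent2E2[OF assms], rule that)
  have "norm ((f + g) $ j $ i) \<le> (2 * C) * R ^ (i + j)" for i j
  proof -
    have "norm ((f + g) $ j $ i) \<le> norm (f $ j $ i) + norm (g $ j $ i)"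
      by (simp add: norm_triangle_ineq)
    with fg(3)[of j i] fg(4)[of j i] show ?thesis by (simp add: mult.assoc)
  qed
  thus ?thesis by (rule convergent2I)
qed

lemma convergent2_uminus: "convergent2 f \<Longrightarrow> convergent2 (- f)"
  by (simp add: convergent2_def)

lemma convergent2_diff: "convergent2 f \<Longrightarrow> convergent2 g \<Longrightarrow> convergent2 (f - g)"
  using convergent2_add[of f "- g"] by (simp add: convergent2_uminus)

lemma convergent2_const: "convergent2 (fps_const (fps_const c))"
  unfolding convergent2_def
  by (rule exI[of _ "norm c"], rule exI[of _ 1]) (auto simp: fps_const_def)

lemma convergent2_0: "convergent2 0"
  using convergent2_const[of 0] by simp

lemma convergent2_1: "convergent2 1"
  using convergent2_const[of 1] by simp

lemma convergent2_X: "convergent2 (fps_const fps_X)"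
  unfolding convergent2_def
  by (rule exI[of _ 1], rule exI[of _ 1]) (auto simp: fps_const_def fps_X_def)

lemma convergent2_Y: "convergent2 fps_X"
  unfolding convergent2_def
  by (rule exI[of _ 1], rule exI[of _ 1]) (auto simp: fps_X_def)

typedef hgerm = "{f :: complex fps fps. convergent2 f}"
  using convergent2_0 by blast

setup_lifting type_definition_hgerm

instantiation hgerm :: idom
begin
lift_definition zero_hgerm :: hgerm is 0 by (rule convergent2_0)
lift_definition one_hgerm :: hgerm is 1 by (rule convergent2_1)
lift_definition plus_hgerm :: "hgerm \<Rightarrow> hgerm \<Rightarrow> hgerm" is "(+)" by (rule convergent2_add)
lift_definition minus_hgerm :: "hgerm \<Rightarrow> hgerm \<Rightarrow> hgerm" is "(-)" by (rule convergent2_diff)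
lift_definition uminus_hgerm :: "hgerm \<Rightarrow> hgerm" is uminus by (rule convergent2_uminus)
lift_definition times_hgerm :: "hgerm \<Rightarrow> hgerm \<Rightarrow> hgerm" is "(*)" by (rule convergent2_mult)
instance
  by standard (transfer; simp add: algebra_simps)+
end

lift_definition const :: "complex \<Rightarrow> hgerm" is "\<lambda>c. fps_const (fps_const c)"
  by (rule convergent2_const)

lift_definition Xc :: hgerm is "fps_const fps_X" by (rule convergent2_X)

lift_definition Yc :: hgerm is "fps_X" by (rule convergent2_Y)

text \<open>\<open>cf f i j\<close> is the coefficient of \<open>x\<^sup>i y\<^sup>j\<close>.\<close>

lift_definition cf :: "hgerm \<Rightarrow> nat \<Rightarrow> nat \<Rightarrow> complex" is "\<lambda>f i j. f $ j $ i" .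

abbreviation at0 :: "hgerm \<Rightarrow> complex" where
  "at0 f \<equiv> cf f 0 0"

definition ev :: "hgerm \<Rightarrow> complex \<times> complex \<Rightarrow> complex" where
  "ev f z = (\<Sum>\<^sub>\<infinity>(i, j)\<in>UNIV. cf f i j * fst z ^ i * snd z ^ j)"

lemma Suc_le_two_power: "real (Suc n) \<le> 2 ^ n"
  by (induction n) auto

lemma two_power_ge: "real (Suc i) \<le> 2 ^ (i + j)" "real (Suc j) \<le> 2 ^ (i + j)"
proof -
  have "(2::real) ^ i \<le> 2 ^ (i + j)" "(2::real) ^ j \<le> 2 ^ (i + j)"
    by (intro power_increasing; simp)+
  with Suc_le_two_power[of i] Suc_le_two_power[of j]
  show "real (Suc i) \<le> 2 ^ (i + j)" "real (Suc j) \<le> 2 ^ (i + j)" by linarith+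
qed

lift_definition dx :: "hgerm \<Rightarrow> hgerm" is "\<lambda>f. Abs_fps (\<lambda>j. fps_deriv (f $ j))"
proof -
  fix f :: "complex fps fps" assume "convergent2 f"
  then obtain C R where f: "C \<ge> 1" "R \<ge> 1" "\<And>i j. norm (f $ j $ i) \<le> C * R ^ (i + j)"
    by (rule convergent2E) (rule that)
  have "norm (Abs_fps (\<lambda>j. fps_deriv (f $ j)) $ j $ i) \<le> (C * R) * (2 * R) ^ (i + j)" for i j
  proof -
    have "norm (Abs_fps (\<lambda>j. fps_deriv (f $ j)) $ j $ i) = real (Suc i) * norm (f $ j $ Suc i)"
      by (simp add: norm_mult del: of_nat_Suc)
    also have "\<dots> \<le> 2 ^ (i + j) * (C * R ^ (Suc i + j))"
      by (intro mult_mono f(3)[of j "Suc i"] two_power_ge) auto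
    also have "\<dots> = (C * R) * (2 * R) ^ (i + j)" by (simp add: power_mult_distrib)
    finally show ?thesis .
  qed
  thus "convergent2 (Abs_fps (\<lambda>j. fps_deriv (f $ j)))" by (rule convergent2I)
qed

lift_definition dy :: "hgerm \<Rightarrow> hgerm" is "fps_deriv"
proof -
  fix f :: "complex fps fps" assume "convergent2 f"
  then obtain C R where f: "C \<ge> 1" "R \<ge> 1" "\<And>i j. norm (f $ j $ i) \<le> C * R ^ (i + j)"
    by (rule convergent2E) (rule that)
  have "norm (fps_deriv f $ j $ i) \<le> (C * R) * (2 * R) ^ (i + j)" for i j
  proof -
    have "norm (fps_deriv f $ j $ i) = real (Suc j) * norm (f $ Suc j $ i)"
    proof -
      have "fps_deriv f $ j $ i = of_nat (Suc j) * f $ Suc j $ i"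
        by (simp add: fps_of_nat[symmetric] del: of_nat_Suc fps_of_nat)
      thus ?thesis by (simp add: norm_mult del: of_nat_Suc)
    qed
    also have "\<dots> \<le> 2 ^ (i + j) * (C * R ^ (i + Suc j))"
      by (intro mult_mono f(3)[of "Suc j" i] two_power_ge) auto
    also have "\<dots> = (C * R) * (2 * R) ^ (i + j)" by (simp add: power_mult_distrib)
    finally show ?thesis .
  qed
  thus "convergent2 (fps_deriv f)" by (rule convergent2I)
qed

text \<open>
  The composite \<open>f(u,v) = \<Sum> f\<^sub>i\<^sub>j u\<^sup>i v\<^sup>j\<close>, for \<open>u\<close> and \<open>v\<close> vanishing at the origin. Since \<open>u\<^sup>i v\<^sup>j\<close> has
  no term of degree below \<open>i + j\<close>, the truncation of the sum does not affect the coefficient of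
  \<open>x\<^sup>m y\<^sup>n\<close>. If \<open>u\<close> or \<open>v\<close> does not vanish at the origin, the value is meaningless.
\<close>

definition fps_subst2 :: "complex fps fps \<Rightarrow> complex fps fps \<Rightarrow> complex fps fps \<Rightarrow> complex fps fps" where
  "fps_subst2 f u v = Abs_fps (\<lambda>n. Abs_fps (\<lambda>m.
     \<Sum>i\<le>m+n. \<Sum>j\<le>m+n. f $ j $ i * (u ^ i * v ^ j) $ n $ m))"

lemma convergent2_subst:
  assumes "convergent2 f" "convergent2 u" "convergent2 v"
  shows "convergent2 (fps_subst2 f u v)"
proof -
  obtain C R where f: "C \<ge> 1" "R \<ge> 1" "\<And>i j. norm (f $ j $ i) \<le> C * R ^ (i + j)"
    by (rule convergent2E[OF assms(1)], rule that)
  obtain A S where A: "A \<ge> 1" and S: "S \<ge> 1"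
    and u': "\<And>i j. norm (u $ j $ i) \<le> A * S ^ (i + j)"
    and v': "\<And>i j. norm (v $ j $ i) \<le> A * S ^ (i + j)"
    by (rule convergent2E2[OF assms(2,3)], rule that)
  have up: "norm ((u ^ k) $ j $ i) \<le> (4 * A) ^ k * (2 * S) ^ (i + j)" for i j k
  proof (induction k arbitrary: i j)
    case 0
    have "norm ((1 :: complex fps fps) $ j $ i) \<le> 1" by (simp add: fps_one_nth)
    also have "1 \<le> (2 * S) ^ (i + j)" using S by (intro one_le_power) auto
    finally show ?case by simp
  next
    case (Suc k)
    have "norm ((u ^ k * u) $ j $ i) \<le> ((4 * A) ^ k * (4 * A)) * (2 * S) ^ (i + j)"
      using A S by (intro mult_bound2 Suc u') auto
    thus ?case by (simp add: ac_simps)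
  qed
  have uv: "norm ((u ^ k * v ^ l) $ j $ i) \<le> (4 * A) ^ (k + l) * (2 * S) ^ (i + j)" for i j k l
  proof (induction l arbitrary: i j)
    case 0 thus ?case using up by simp
  next
    case (Suc l)
    have "norm (((u ^ k * v ^ l) * v) $ j $ i) \<le> ((4 * A) ^ (k + l) * (4 * A)) * (2 * S) ^ (i + j)"
      using A S by (intro mult_bound2 Suc v') auto
    thus ?case by (simp add: ac_simps)
  qed
  define M where "M = 4 * A * R"
  have M: "M \<ge> 1"
    unfolding M_def using mult_mono[of 1 "4 * A" 1 R] A f(2) by simp
  have "norm (fps_subst2 f u v $ n $ m) \<le> C * (4 * M\<^sup>2 * (2 * S)) ^ (m + n)" for m n
  proof -
    define K where "K = m + n"
    have "norm (fps_subst2 f u v $ n $ m)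
        \<le> (\<Sum>i\<le>K. \<Sum>j\<le>K. norm (f $ j $ i * (u ^ i * v ^ j) $ n $ m))"
      unfolding fps_subst2_def K_def fps_nth_Abs_fps
      by (intro order.trans[OF norm_sum] sum_mono) auto
    also have "\<dots> \<le> (\<Sum>i\<le>K. \<Sum>j\<le>K. C * M ^ (2 * K) * (2 * S) ^ K)"
    proof (intro sum_mono)
      fix i j assume ij: "i \<in> {..K}" "j \<in> {..K}"
      have "norm (f $ j $ i * (u ^ i * v ^ j) $ n $ m)
          \<le> (C * R ^ (i + j)) * ((4 * A) ^ (i + j) * (2 * S) ^ (m + n))"
        unfolding norm_mult using f A S by (intro mult_mono f(3) uv) auto
      also have "\<dots> = C * M ^ (i + j) * (2 * S) ^ K"
        by (simp add: M_def K_def power_mult_distrib)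
      also have "\<dots> \<le> C * M ^ (2 * K) * (2 * S) ^ K"
        using ij M f S by (intro mult_right_mono mult_left_mono power_increasing) auto
      finally show "norm (f $ j $ i * (u ^ i * v ^ j) $ n $ m) \<le> C * M ^ (2 * K) * (2 * S) ^ K" .
    qed
    also have "\<dots> = (real (Suc K) * real (Suc K)) * (C * M ^ (2 * K) * (2 * S) ^ K)"
      by (simp add: algebra_simps)
    also have "\<dots> \<le> (2 ^ K * 2 ^ K) * (C * M ^ (2 * K) * (2 * S) ^ K)"
      using f M S by (intro mult_right_mono mult_mono Suc_le_two_power) auto
    also have "(2 ^ K * 2 ^ K :: real) = 4 ^ K"
      using power_mult_distrib[of "2::real" 2 K] by simp
    also have "4 ^ K * (C * M ^ (2 * K) * (2 * S) ^ K) = C * (4 * M\<^sup>2 * (2 * S)) ^ K"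
      by (simp only: power_mult_distrib power_mult mult.assoc mult.left_commute)
    finally show ?thesis by (simp add: K_def)
  qed
  thus ?thesis by (rule convergent2I)
qed

lift_definition subst :: "hgerm \<Rightarrow> hgerm \<Rightarrow> hgerm \<Rightarrow> hgerm" is fps_subst2
  by (rule convergent2_subst)


section \<open>Germs of curves and of foliations at the origin\<close>

text \<open>
  All germs are taken at the origin of a coordinate chart. A curve germ is given by a reduced
  equation, a unit being an equation of the empty germ; its irreducible components are the
  irreducible divisors of the equation, up to units.
\<close>

definition reduced_germ :: "hgerm \<Rightarrow> bool" where
  "reduced_germ f \<longleftrightarrow> f \<noteq> 0 \<and> squarefree f"

definition component :: "hgerm \<Rightarrow> hgerm \<Rightarrow> bool" where
  "component g f \<longleftrightarrow> irreducible g \<and> g dvd f"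

definition same_germ :: "hgerm \<Rightarrow> hgerm \<Rightarrow> bool" where
  "same_germ f g \<longleftrightarrow> f dvd g \<and> g dvd f"

text \<open>Vanishing order at the origin (of a nonzero germ).\<close>

definition mult :: "hgerm \<Rightarrow> nat" where
  "mult f = (LEAST n. \<exists>i j. i + j = n \<and> cf f i j \<noteq> 0)"

definition singular :: "hgerm \<Rightarrow> bool" where
  "singular f \<longleftrightarrow> mult f \<ge> 2"

definition nonsingular :: "hgerm \<Rightarrow> bool" where
  "nonsingular f \<longleftrightarrow> mult f = 1"

text \<open>Transversality of nonsingular germs: the differentials at the origin are independent.\<close>

definition transverse :: "hgerm \<Rightarrow> hgerm \<Rightarrow> bool" where
  "transverse f g \<longleftrightarrow> at0 (dx f) * at0 (dy g) - at0 (dy f) * at0 (dx g) \<noteq> 0"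

text \<open>The common zeros of \<open>f\<close> and \<open>g\<close> are contained in the origin.\<close>

definition meet_in_origin :: "hgerm \<Rightarrow> hgerm \<Rightarrow> bool" where
  "meet_in_origin f g \<longleftrightarrow> (\<forall>\<^sub>F z in nhds 0. ev f z = 0 \<and> ev g z = 0 \<longrightarrow> z = 0)"

definition normal_crossings :: "hgerm \<Rightarrow> bool" where
  "normal_crossings h \<longleftrightarrow>
     h dvd 1 \<or>
     irreducible h \<and> nonsingular h \<or>
     (\<exists>u v. h = u * v \<and> irreducible u \<and> nonsingular u \<and> irreducible v \<and> nonsingular v
        \<and> transverse u v)"

text \<open>The pair \<open>(a, b)\<close> stands for \<open>a \<partial>\<^sub>x + b \<partial>\<^sub>y\<close>.\<close>

type_synonym vfield = "hgerm \<times> hgerm"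

definition der :: "vfield \<Rightarrow> hgerm \<Rightarrow> hgerm" where
  "der X g = fst X * dx g + snd X * dy g"

definition foliation :: "vfield \<Rightarrow> bool" where
  "foliation X \<longleftrightarrow> meet_in_origin (fst X) (snd X)"

definition invariant :: "vfield \<Rightarrow> hgerm \<Rightarrow> bool" where
  "invariant X g \<longleftrightarrow> g dvd der X g"


section \<open>The indices \<open>Z\<close>, \<open>tang\<close> and \<open>\<kappa>\<close>\<close>

text \<open>
  \<open>f(p(t), q(t))\<close> for one-variable series \<open>p\<close>, \<open>q\<close> without constant term; the truncation is
  harmless as in the definition of the substitution above.
\<close>

definition along :: "hgerm \<Rightarrow> complex fps \<Rightarrow> complex fps \<Rightarrow> complex fps" where
  "along f p q = Abs_fps (\<lambda>n. \<Sum>i\<le>n. \<Sum>j\<le>n. cf f i j * (p ^ i * q ^ j) $ n)"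

definition puiseux :: "hgerm \<Rightarrow> complex fps \<Rightarrow> complex fps \<Rightarrow> bool" where
  "puiseux g p q \<longleftrightarrow>
     fps_conv_radius p > 0 \<and> fps_conv_radius q > 0 \<and> p $ 0 = 0 \<and> q $ 0 = 0 \<and>
     (\<exists>r>0. inj_on (\<lambda>t. (eval_fps p t, eval_fps q t)) (ball 0 r)) \<and>
     along g p q = 0"

text \<open>The series \<open>\<theta>\<close> below is the coefficient of the one-variable vector field \<open>\<alpha>\<^sup>*X\<close>.\<close>

definition Z_index :: "vfield \<Rightarrow> hgerm \<Rightarrow> nat" where
  "Z_index X g = (THE n. \<exists>p q \<theta>. puiseux g p q \<and>
      fps_deriv p * \<theta> = along (fst X) p q \<and> fps_deriv q * \<theta> = along (snd X) p q \<and>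
      n = subdegree \<theta>)"

definition ideal2 :: "hgerm \<Rightarrow> hgerm \<Rightarrow> hgerm set" where
  "ideal2 f g = {r * f + s * g | r s. True}"

text \<open>The classes of the elements of \<open>B\<close> form a basis of the complex vector space \<open>\<complex>{x,y}/I\<close>.\<close>

definition quotient_basis :: "hgerm set \<Rightarrow> hgerm set \<Rightarrow> bool" where
  "quotient_basis I B \<longleftrightarrow> finite B \<and>
     (\<forall>f. \<exists>c. f - (\<Sum>b\<in>B. const (c b) * b) \<in> I) \<and>
     (\<forall>c. (\<Sum>b\<in>B. const (c b) * b) \<in> I \<longrightarrow> (\<forall>b\<in>B. c b = 0))"

definition quotient_dim :: "hgerm set \<Rightarrow> enat" where
  "quotient_dim I =
     (if \<exists>B. quotient_basis I B then enat (card (SOME B. quotient_basis I B)) else \<infinity>)"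

definition tang :: "vfield \<Rightarrow> hgerm \<Rightarrow> enat" where
  "tang X g = quotient_dim (ideal2 g (der X g))"

definition kappa :: "vfield \<Rightarrow> hgerm \<Rightarrow> enat" where
  "kappa X d = (if invariant X d then enat (Z_index X d) else tang X d)"


section \<open>Blow-ups and infinitely near points\<close>

text \<open>
  The points of the exceptional divisor of the blow-up of the origin: \<open>Slope t\<close> is the tangent
  direction \<open>y = t x\<close>, with the chart \<open>(x, y) \<mapsto> (x, x (y + t))\<close> centred at it; \<open>Vertical\<close> is
  the direction \<open>x = 0\<close>, with the chart \<open>(x, y) \<mapsto> (x y, y)\<close>.
\<close>

datatype direction = Slope complex | Vertical

fun chart :: "direction \<Rightarrow> hgerm \<times> hgerm" where
  "chart (Slope t) = (Xc, Xc * (Yc + const t))"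
| "chart Vertical = (Xc * Yc, Yc)"

text \<open>Local equation of the exceptional divisor in the above charts.\<close>

fun exc :: "direction \<Rightarrow> hgerm" where
  "exc (Slope t) = Xc"
| "exc Vertical = Yc"

definition total_transform :: "direction \<Rightarrow> hgerm \<Rightarrow> hgerm" where
  "total_transform t f = subst f (fst (chart t)) (snd (chart t))"

definition strict1 :: "direction \<Rightarrow> hgerm \<Rightarrow> hgerm" where
  "strict1 t f = (THE h. \<exists>m. total_transform t f = exc t ^ m * h \<and> \<not> exc t dvd h)"

text \<open>
  \<open>Y\<close> generates the saturated pull-back of the foliation generated by \<open>X\<close>. With \<open>\<phi>\<close> the chart
  and \<open>e\<close> the equation of the exceptional divisor, the two equations say
  \<open>d\<phi> (c Y) = e (X \<circ> \<phi>)\<close>, i.e. \<open>(c/e) Y\<close> is the (possibly meromorphic) pull-back of \<open>X\<close>;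
  saturation is the requirement that the singularity of \<open>Y\<close> be isolated. \<open>Y\<close> is unique up to a
  unit factor.
\<close>

definition pullback1 :: "direction \<Rightarrow> vfield \<Rightarrow> vfield \<Rightarrow> bool" where
  "pullback1 t X Y \<longleftrightarrow> foliation Y \<and>
     (\<exists>c. c \<noteq> 0 \<and>
        c * der Y (fst (chart t)) = exc t * total_transform t (fst X) \<and>
        c * der Y (snd (chart t)) = exc t * total_transform t (snd X))"

text \<open>
  A point infinitely near to the origin is a list of directions: \<open>t # q\<close> is the point \<open>q\<close>
  infinitely near to the point \<open>t\<close> of the first exceptional divisor. The following are taken in
  the chart centred at the infinitely near point.
\<close>

fun strict :: "direction list \<Rightarrow> hgerm \<Rightarrow> hgerm" where
  "strict [] f = f"
| "strict (t # q) f = strict q (strict1 t f)"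

fun pullback :: "direction list \<Rightarrow> vfield \<Rightarrow> vfield \<Rightarrow> bool" where
  "pullback [] X Y \<longleftrightarrow> Y = X"
| "pullback (t # q) X Y \<longleftrightarrow> (\<exists>X1. pullback1 t X X1 \<and> pullback q X1 Y)"

text \<open>
  \<open>exc_divisor q\<close> is the reduced local equation at \<open>q\<close> of the whole exceptional divisor, i.e. the
  inverse image of the origin: at each blow-up, the new component together with the strict
  transforms of the previous ones.
\<close>

fun exc_divisor_from :: "hgerm \<Rightarrow> direction list \<Rightarrow> hgerm" where
  "exc_divisor_from e [] = e"
| "exc_divisor_from e (t # q) = exc_divisor_from (exc t * strict1 t e) q"

definition exc_divisor :: "direction list \<Rightarrow> hgerm" where
  "exc_divisor q = exc_divisor_from 1 q"

definition passes_through :: "hgerm \<Rightarrow> direction list \<Rightarrow> bool" where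
  "passes_through g q \<longleftrightarrow> at0 (strict q g) = 0"


section \<open>Minimal desingularization and weak isolation\<close>

text \<open>
  The requirements on the strict transforms of the irreducible components of \<open>f\<close> at a point \<open>q\<close>
  of the exceptional divisor.
\<close>

definition resolved_at :: "hgerm \<Rightarrow> direction list \<Rightarrow> bool" where
  "resolved_at f q \<longleftrightarrow> (\<forall>g. component g f \<and> passes_through g q \<longrightarrow>
     nonsingular (strict q g) \<and>
     nonsingular (exc_divisor q) \<and>
     transverse (strict q g) (exc_divisor q) \<and>
     (\<forall>g'. component g' f \<and> passes_through g' q \<longrightarrow> same_germ g g'))"

text \<open>
  A (nonempty) sequence of point blow-ups over the origin is given by the set \<open>T\<close> of its centres,
  a finite prefix-closed set of infinitely near points. The points of the resulting exceptional
  divisor are then the points \<open>p @ [t] \<notin> T\<close> with \<open>p \<in> T\<close>.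
\<close>

definition centres :: "direction list set \<Rightarrow> bool" where
  "centres T \<longleftrightarrow> finite T \<and> [] \<in> T \<and> (\<forall>p t. p @ [t] \<in> T \<longrightarrow> p \<in> T)"

definition points_over :: "direction list set \<Rightarrow> direction list set" where
  "points_over T = {p @ [t] | p t. p \<in> T \<and> p @ [t] \<notin> T}"

definition desingularization :: "hgerm \<Rightarrow> direction list set \<Rightarrow> bool" where
  "desingularization f T \<longleftrightarrow> centres T \<and> (\<forall>q\<in>points_over T. resolved_at f q)"

definition minimal_desingularization :: "hgerm \<Rightarrow> direction list set \<Rightarrow> bool" where
  "minimal_desingularization f T \<longleftrightarrow>
     desingularization f T \<and> (\<forall>T'. desingularization f T' \<longrightarrow> T \<subseteq> T')"

text \<open>
  In \<open>weakly_isolated X f\<close>, the factorization \<open>f = g * h\<close> of the reduced equation \<open>f\<close> expresses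
  that the curve is the union of the curves \<open>g = 0\<close> and \<open>h = 0\<close>. For a component \<open>\<gamma>\<close>, the point
  \<open>q\<close> is \<open>P\<^sub>\<gamma>\<close>; the exceptional divisor is nonsingular there, so that its germ at \<open>q\<close> is the germ
  of the component \<open>D\<^sub>\<gamma>\<close>.
\<close>

definition weakly_isolated :: "vfield \<Rightarrow> hgerm \<Rightarrow> bool" where
  "weakly_isolated X f \<longleftrightarrow>
     reduced_germ f \<and> singular f \<and> invariant X f \<and>
     (\<exists>T g h. minimal_desingularization f T \<and>
        f = g * h \<and> normal_crossings h \<and> meet_in_origin g h \<and>
        (\<forall>\<gamma>. component \<gamma> g \<longrightarrow>
           (\<forall>q\<in>points_over T. passes_through \<gamma> q \<longrightarrow>
              (\<forall>Y. pullback q X Y \<longrightarrow> kappa Y (exc_divisor q) \<ge> 1))))"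

end

theory Submission
  imports Defs "HOL-Complex_Analysis.Conformal_Mappings"
begin

text \<open>
  Let \<open>E\<close> be the exceptional divisor of the blow-up \<open>\<pi>\<^sub>1\<close>, with local equation \<open>exc P\<close> at the point
  \<open>P\<close>, and let \<open>T\<close> be the set of centres of the minimal desingularization of the given curve
  \<open>f = g h\<close>, where \<open>h\<close> is the normal-crossings part.

  The components of the germ at \<open>P\<close> are those of the strict transform of \<open>f\<close>, all of which are
  invariant because the singularity of \<open>X\<close> is isolated (\<open>strict1_component_invariant\<close>), together
  with \<open>E\<close> if \<open>E\<close> is invariant. The centres of \<open>T\<close> above \<open>P\<close> desingularize this germ
  (\<open>resolved_at_tail\<close>), but possibly not minimally. Consider a point \<open>q\<close> of the exceptional divisor
  of the minimal desingularization at \<open>P\<close>, through which a component \<open>\<gamma>\<close> of the strict transform of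
  \<open>g\<close> passes. If \<open>q\<close> is also a final point of the desingularization of \<open>f\<close>, the divisor \<open>D\<^sub>\<gamma>\<close> and the
  foliation are the same before and after, and the condition on \<open>\<kappa>\<close> is inherited. Otherwise
  \<open>q\<close> is a centre of \<open>T\<close> at which the germ at \<open>P\<close> is already resolved, while \<open>f\<close> is not. The only
  possible reason is that \<open>E\<close> is not invariant and still passes through \<open>q\<close>
  (\<open>resolved_at_tail_converse\<close>, \<open>minimal_centre_not_resolved\<close>). Since \<open>E\<close> is nonsingular, this
  happens for one point \<open>q\<close> only, and then for one \<open>\<gamma>\<close> only. The condition on \<open>\<kappa>\<close> may fail there;
  but \<open>\<gamma>\<close> is nonsingular at \<open>P\<close> and tangent to \<open>E\<close> (\<open>blow_down_along_nonsingular\<close>). The strict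
  transform of \<open>h\<close>, on the contrary, is empty or nonsingular and transverse to \<open>E\<close> at \<open>P\<close>
  (\<open>normal_crossings_strict1\<close>), since a blow-up separates transverse branches. So \<open>\<gamma>\<close> may be moved
  to the normal-crossings part. If \<open>E\<close> is invariant, no such \<open>q\<close> exists, and it is \<open>E\<close> that joins
  the normal-crossings part. If \<open>P\<close> is not a centre of \<open>T\<close> at all, the germ at \<open>P\<close> can be singular
  only as a node formed by \<open>E\<close> and one branch, and there is nothing to check.

  The algebra behind this is that the ring of germs is factorial (\<open>irreducible_dvd_mult\<close>) and that
  the ideal of two germs without common component contains a power of \<open>x\<close> and a power of \<open>y\<close>
  (\<open>Xc_power_in_coprime_ideal\<close>). Both come from a Euclidean algorithm based on Weierstrass division.
  The second statement is used again and again: it shows that blowing up creates neither common nor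
  multiple components (\<open>coprime_strict1\<close>, \<open>squarefree_strict1\<close>), and it turns the analytic notion
  of meeting in the origin only into the absence of common components
  (\<open>coprime_imp_meet_in_origin\<close>, \<open>meet_in_origin_imp_coprime\<close>).
\<close>

unbundle no vec_syntax


section \<open>Coefficients of germs\<close>

lemma hgerm_eqI: "(\<And>i j. cf f i j = cf g i j) \<Longrightarrow> f = g"
  by transfer (simp add: fps_eq_iff)

lemma cf_0 [simp]: "cf 0 i j = 0"
  by transfer simp

lemma cf_1: "cf 1 i j = (if i = 0 \<and> j = 0 then 1 else 0)"
  by transfer (simp add: fps_one_nth)

lemma cf_add [simp]: "cf (f + g) i j = cf f i j + cf g i j"
  by transfer simp

lemma cf_diff [simp]: "cf (f - g) i j = cf f i j - cf g i j"
  by transfer simp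

lemma cf_uminus [simp]: "cf (- f) i j = - cf f i j"
  by transfer simp

lemma cf_const: "cf (const c) i j = (if i = 0 \<and> j = 0 then c else 0)"
  by transfer simp

lemma cf_mult: "cf (f * g) i j = (\<Sum>k\<le>i. \<Sum>l\<le>j. cf f k l * cf g (i - k) (j - l))"
  by transfer (simp add: mult_nth2, rule sum.swap)

lemma cf_Xc: "cf Xc i j = (if i = 1 \<and> j = 0 then 1 else 0)"
  by transfer (simp add: fps_X_nth)

lemma cf_Yc: "cf Yc i j = (if i = 0 \<and> j = 1 then 1 else 0)"
  by transfer (auto simp: fps_X_nth)

lemma at0_mult [simp]: "at0 (f * g) = at0 f * at0 g"
  by (simp add: cf_mult)

lemma cf_Xc_mult: "cf (Xc * f) i j = (if i = 0 then 0 else cf f (i - 1) j)"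
proof -
  have "cf (Xc * f) i j = (\<Sum>k\<le>i. \<Sum>l\<le>j. if k = 1 \<and> l = 0 then cf f (i - 1) j else 0)"
    unfolding cf_mult by (intro sum.cong refl) (auto simp: cf_Xc)
  also have "\<dots> = (\<Sum>k\<le>i. if k = 1 then cf f (i - 1) j else 0)"
    by (intro sum.cong refl) (simp split: if_splits)
  finally show ?thesis by (auto simp: sum.delta)
qed

lemma cf_const_mult [simp]: "cf (const c * f) i j = c * cf f i j"
proof -
  have "cf (const c * f) i j = (\<Sum>k\<le>i. \<Sum>l\<le>j. if l = 0 then (if k = 0 then c * cf f i j else 0) else 0)"
    unfolding cf_mult by (intro sum.cong refl) (auto simp: cf_const)
  thus ?thesis by (simp add: sum.delta)
qed

lemma cf_dx [simp]: "cf (dx f) i j = of_nat (Suc i) * cf f (Suc i) j"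
  by transfer simp

lemma cf_dy [simp]: "cf (dy f) i j = of_nat (Suc j) * cf f i (Suc j)"
  by transfer (simp add: fps_of_nat[symmetric] del: of_nat_Suc fps_of_nat)

lemma cf_boundE:
  obtains C R where "C \<ge> 1" "R \<ge> 1" "\<And>i j. norm (cf f i j) \<le> C * R ^ (i + j)"
  using Rep_hgerm[of f] by (auto simp: cf.rep_eq elim: convergent2E)

lemma germ_of_coeffs:
  assumes "\<And>i j. norm (c i j :: complex) \<le> C * R ^ (i + j)"
  obtains f where "\<And>i j. cf f i j = c i j"
proof -
  have "convergent2 (Abs_fps (\<lambda>j. Abs_fps (\<lambda>i. c i j)))"
    by (rule convergent2I[of _ C R]) (simp add: assms)
  hence "cf (Abs_hgerm (Abs_fps (\<lambda>j. Abs_fps (\<lambda>i. c i j)))) i j = c i j" for i j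
    by (simp add: cf.rep_eq Abs_hgerm_inverse)
  thus ?thesis by (rule that)
qed

lemma Xc_dvd_iff: "Xc dvd f \<longleftrightarrow> (\<forall>j. cf f 0 j = 0)"
proof
  assume R: "\<forall>j. cf f 0 j = 0"
  obtain C S where CS: "C \<ge> 1" "S \<ge> 1" "\<And>i j. norm (cf f i j) \<le> C * S ^ (i + j)"
    by (rule cf_boundE[of f], rule that)
  have "norm (cf f (Suc i) j) \<le> (C * S) * S ^ (i + j)" for i j
    using CS(3)[of "Suc i" j] by (simp add: ac_simps)
  then obtain g where g: "\<And>i j. cf g i j = cf f (Suc i) j"
    using germ_of_coeffs[of "\<lambda>i j. cf f (Suc i) j"] by metis
  have "f = Xc * g"
    by (rule hgerm_eqI) (auto simp: cf_Xc_mult g R)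
  thus "Xc dvd f" by simp
qed (auto simp: cf_Xc_mult elim!: dvdE)

text \<open>
  The involution exchanging the two variables halves the work: whatever is proved for powers of
  \<open>x\<close> holds for powers of \<open>y\<close>.
\<close>

lift_definition swap :: "hgerm \<Rightarrow> hgerm" is "\<lambda>f. Abs_fps (\<lambda>j. Abs_fps (\<lambda>i. f $ i $ j))"
proof -
  fix f :: "complex fps fps" assume "convergent2 f"
  then obtain C R where "C \<ge> 1" "R \<ge> 1" "\<And>i j. norm (f $ j $ i) \<le> C * R ^ (i + j)"
    by (rule convergent2E) (rule that)
  thus "convergent2 (Abs_fps (\<lambda>j. Abs_fps (\<lambda>i. f $ i $ j)))"
    by (intro convergent2I[of _ C R]) (simp add: add.commute)
qed

lemma cf_swap [simp]: "cf (swap f) i j = cf f j i"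
  by transfer simp

lemma swap_swap [simp]: "swap (swap f) = f"
  by (rule hgerm_eqI) simp

lemma swap_add [simp]: "swap (f + g) = swap f + swap g"
  by (rule hgerm_eqI) simp

lemma swap_mult [simp]: "swap (f * g) = swap f * swap g"
  by (rule hgerm_eqI) (simp add: cf_mult, rule sum.swap)

lemma swap_1 [simp]: "swap 1 = 1"
  by (rule hgerm_eqI) (auto simp: cf_1)

lemma swap_Xc [simp]: "swap Xc = Yc"
  by (rule hgerm_eqI) (auto simp: cf_Xc cf_Yc)

lemma swap_power [simp]: "swap (f ^ n) = swap f ^ n"
  by (induction n) auto

lemma swap_dvd: "f dvd g \<Longrightarrow> swap f dvd swap g"
  by (auto elim!: dvdE)

lemma swap_dvd_iff [simp]: "swap f dvd swap g \<longleftrightarrow> f dvd g"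
  using swap_dvd[of f g] swap_dvd[of "swap f" "swap g"] by auto

lemma Yc_dvd_iff: "Yc dvd f \<longleftrightarrow> (\<forall>i. cf f i 0 = 0)"
  using swap_dvd_iff[of Xc "swap f"] Xc_dvd_iff[of "swap f"] by simp


section \<open>Weierstrass division\<close>

text \<open>
  Sort by powers of \<open>x\<close>: write \<open>G = \<Sum> G\<^sub>i(y) x\<^sup>i\<close>, and likewise \<open>F\<close> with \<open>F\<^sub>0 = y\<^sup>d\<close>. In the equation
  \<open>G = Q F + r\<close>, the coefficient of \<open>x\<^sup>i\<close> reads
  \<open>q\<^sub>i y\<^sup>d + r\<^sub>i = G\<^sub>i - (\<Sum>k<i. q\<^sub>k F\<^sub>i\<^sub>-\<^sub>k)\<close>, so that \<open>q\<^sub>i\<close> and \<open>r\<^sub>i\<close> are the two halves of the right-hand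
  side, cut at degree \<open>d\<close>. The function below is this right-hand side.
\<close>

function division_step :: "nat \<Rightarrow> (nat \<Rightarrow> complex fps) \<Rightarrow> (nat \<Rightarrow> complex fps) \<Rightarrow> nat \<Rightarrow> complex fps" where
  "division_step d F G i = G i - (\<Sum>k\<in>{..<i}. fps_shift d (division_step d F G k) * F (i - k))"
  by pat_completeness auto
termination by (relation "inv_image less_than (\<lambda>(d, F, G, i). i)") auto

declare division_step.simps [simp del]

text \<open>
  The partial sums of the norm \<open>\<Sum> \<bar>p\<^sub>j\<bar> \<rho>\<^sup>j\<close>. Unlike a bound on single coefficients, a bound on them
  loses nothing under multiplication, which is what the recursion needs.
\<close>

definition wnorm :: "real \<Rightarrow> nat \<Rightarrow> complex fps \<Rightarrow> real" where
  "wnorm \<rho> n p = (\<Sum>j\<le>n. norm (p $ j) * \<rho> ^ j)"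

lemma wnorm_nonneg: "\<rho> \<ge> 0 \<Longrightarrow> wnorm \<rho> n p \<ge> 0"
  unfolding wnorm_def by (intro sum_nonneg) auto

lemma wnorm_diff: "\<rho> \<ge> 0 \<Longrightarrow> wnorm \<rho> n (p - q) \<le> wnorm \<rho> n p + wnorm \<rho> n q"
  unfolding wnorm_def sum.distrib[symmetric] distrib_right[symmetric]
  by (intro sum_mono mult_right_mono) (auto intro: norm_triangle_ineq4)

lemma wnorm_add: "\<rho> \<ge> 0 \<Longrightarrow> wnorm \<rho> n (p + q) \<le> wnorm \<rho> n p + wnorm \<rho> n q"
  unfolding wnorm_def sum.distrib[symmetric] distrib_right[symmetric]
  by (intro sum_mono mult_right_mono) (auto intro: norm_triangle_ineq)

lemma wnorm_sum: "\<rho> \<ge> 0 \<Longrightarrow> wnorm \<rho> n (sum f A) \<le> (\<Sum>a\<in>A. wnorm \<rho> n (f a))"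
proof (induction A rule: infinite_finite_induct)
  case (insert a A)
  thus ?case using wnorm_add[of \<rho> n "f a" "sum f A"] by simp
qed (auto simp: wnorm_def)

lemma wnorm_mult:
  assumes "\<rho> \<ge> 0"
  shows "wnorm \<rho> n (p * q) \<le> wnorm \<rho> n p * wnorm \<rho> n q"
proof -
  let ?a = "\<lambda>k. norm (p $ k) * \<rho> ^ k" and ?b = "\<lambda>k. norm (q $ k) * \<rho> ^ k"
  have "wnorm \<rho> n (p * q) \<le> (\<Sum>j\<le>n. \<Sum>k\<le>j. ?a k * ?b (j - k))"
    unfolding wnorm_def
  proof (intro sum_mono)
    fix j
    have "norm ((p * q) $ j) * \<rho> ^ j \<le> (\<Sum>k\<le>j. norm (p $ k * q $ (j - k))) * \<rho> ^ j"
      using assms by (intro mult_right_mono) (auto simp: fps_mult_nth atLeast0AtMost intro: norm_sum)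
    also have "\<dots> = (\<Sum>k\<le>j. ?a k * ?b (j - k))"
      unfolding sum_distrib_right
      by (intro sum.cong refl) (simp add: norm_mult power_add[symmetric] mult_ac)
    finally show "norm ((p * q) $ j) * \<rho> ^ j \<le> (\<Sum>k\<le>j. ?a k * ?b (j - k))" .
  qed
  also have "\<dots> = (\<Sum>(k, l) | k + l \<le> n. ?a k * ?b l)"
    by (subst sum.Sigma) (auto intro!: sum.reindex_bij_witness[of _ "\<lambda>(k, l). (k + l, k)" "\<lambda>(j, k). (k, j - k)"])
  also have "\<dots> \<le> (\<Sum>(k, l)\<in>{..n} \<times> {..n}. ?a k * ?b l)"
    using assms by (intro sum_mono2) auto
  also have "\<dots> = wnorm \<rho> n p * wnorm \<rho> n q"
    unfolding wnorm_def sum_product by (simp add: sum.cartesian_product)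
  finally show ?thesis .
qed

lemma wnorm_shift:
  assumes "\<rho> > 0"
  shows "wnorm \<rho> n (fps_shift d p) \<le> wnorm \<rho> (n + d) p / \<rho> ^ d"
proof -
  have "wnorm \<rho> n (fps_shift d p) * \<rho> ^ d = (\<Sum>j\<le>n. norm (p $ (j + d)) * \<rho> ^ (j + d))"
    by (simp only: wnorm_def sum_distrib_right sum_distrib_left fps_shift_nth power_add mult_ac)
  also have "\<dots> = (\<Sum>j\<in>{d..n+d}. norm (p $ j) * \<rho> ^ j)"
    by (rule sum.reindex_bij_witness[of _ "\<lambda>j. j - d" "\<lambda>j. j + d"]) auto
  also have "\<dots> \<le> wnorm \<rho> (n + d) p"
    unfolding wnorm_def using assms by (intro sum_mono2) auto
  finally show ?thesis using assms by (simp add: field_simps)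
qed

text \<open>
  With \<open>c = M / \<rho>\<^sup>d\<close> this is the recursion satisfied by the norms of the division steps, with
  equality in place of the inequality; it is where the growth rate \<open>R (1 + c)\<close> below comes from.
\<close>

lemma geometric_recursion:
  "R ^ i + (\<Sum>k<i. c * (R * (1 + c)) ^ k * R ^ (i - k)) = (R * (1 + c) :: real) ^ i"
proof (induction i)
  case (Suc i)
  have "(\<Sum>k<Suc i. c * (R * (1 + c)) ^ k * R ^ (Suc i - k))
      = R * (\<Sum>k<i. c * (R * (1 + c)) ^ k * R ^ (i - k)) + c * (R * (1 + c)) ^ i * R"
    by (simp add: sum_distrib_left Suc_diff_le mult_ac)
  hence "R ^ Suc i + (\<Sum>k<Suc i. c * (R * (1 + c)) ^ k * R ^ (Suc i - k))
      = R * (R ^ i + (\<Sum>k<i. c * (R * (1 + c)) ^ k * R ^ (i - k))) + c * (R * (1 + c)) ^ i * R"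
    by (simp only: distrib_left power_Suc add.assoc)
  also have "\<dots> = (R * (1 + c)) ^ Suc i"
    unfolding Suc by (simp only: power_Suc distrib_left distrib_right mult_ac mult_1_left mult_1_right)
  finally show ?case .
qed simp

lemma division_step_bound:
  assumes \<rho>: "\<rho> > 0" and R: "R \<ge> 0" and M: "M \<ge> 0"
    and F: "\<And>i n. wnorm \<rho> n (F i) \<le> M * R ^ i" and G: "\<And>i n. wnorm \<rho> n (G i) \<le> M * R ^ i"
  shows "wnorm \<rho> n (division_step d F G i) \<le> M * (R * (1 + M / \<rho> ^ d)) ^ i"
proof (induction i arbitrary: n rule: less_induct)
  case (less i)
  let ?h = "division_step d F G" and ?c = "M / \<rho> ^ d"
  have "wnorm \<rho> n (?h i) \<le> wnorm \<rho> n (G i) + (\<Sum>k<i. wnorm \<rho> n (fps_shift d (?h k) * F (i - k)))"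
    unfolding division_step.simps[of d F G i] using \<rho>
    by (intro order.trans[OF wnorm_diff] add_mono wnorm_sum) auto
  also have "\<dots> \<le> M * R ^ i + (\<Sum>k<i. M * (?c * (R * (1 + ?c)) ^ k * R ^ (i - k)))"
  proof (intro add_mono G sum_mono)
    fix k assume k: "k \<in> {..<i}"
    have "wnorm \<rho> n (fps_shift d (?h k) * F (i - k))
        \<le> wnorm \<rho> n (fps_shift d (?h k)) * wnorm \<rho> n (F (i - k))"
      using \<rho> by (intro wnorm_mult) auto
    also have "\<dots> \<le> (M * (R * (1 + ?c)) ^ k / \<rho> ^ d) * (M * R ^ (i - k))"
    proof (intro mult_mono F)
      have "wnorm \<rho> n (fps_shift d (?h k)) \<le> wnorm \<rho> (n + d) (?h k) / \<rho> ^ d"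
        using \<rho> by (rule wnorm_shift)
      also have "\<dots> \<le> M * (R * (1 + ?c)) ^ k / \<rho> ^ d"
        using \<rho> k by (intro divide_right_mono less) auto
      finally show "wnorm \<rho> n (fps_shift d (?h k)) \<le> M * (R * (1 + ?c)) ^ k / \<rho> ^ d" .
    qed (use \<rho> R M in \<open>auto intro!: wnorm_nonneg\<close>)
    finally show "wnorm \<rho> n (fps_shift d (?h k) * F (i - k)) \<le> M * (?c * (R * (1 + ?c)) ^ k * R ^ (i - k))"
      by (simp add: mult_ac)
  qed
  also have "\<dots> = M * (R ^ i + (\<Sum>k<i. ?c * (R * (1 + ?c)) ^ k * R ^ (i - k)))"
    by (simp add: distrib_left sum_distrib_left)
  also note geometric_recursion
  finally show ?case .
qed

text \<open>
  The radius \<open>1 / (2R)\<close> makes the norms of the coefficients of \<open>x\<^sup>i\<close> grow geometrically.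
\<close>

lemma wnorm_slice_bound:
  assumes "\<And>i j. norm (cf f i j) \<le> C * R ^ (i + j)" "C \<ge> 0" "R \<ge> 1"
  shows "wnorm (1 / (2 * R)) n (Abs_fps (\<lambda>j. cf f i j)) \<le> 2 * C * R ^ i"
proof -
  have "wnorm (1 / (2 * R)) n (Abs_fps (\<lambda>j. cf f i j)) \<le> (\<Sum>j\<le>n. C * R ^ i * (1/2) ^ (n - (n - j)))"
    unfolding wnorm_def
  proof (intro sum_mono)
    fix j assume "j \<in> {..n}"
    have "norm (cf f i j) * (1 / (2 * R)) ^ j \<le> C * R ^ (i + j) * (1 / (2 * R)) ^ j"
      using assms by (intro mult_right_mono) auto
    also have "\<dots> = C * R ^ i * (1/2) ^ j"
      using assms(3) by (simp add: power_add power_divide power_mult_distrib)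
    finally show "norm (Abs_fps (\<lambda>j. cf f i j) $ j) * (1 / (2 * R)) ^ j \<le> C * R ^ i * (1/2) ^ (n - (n - j))"
      using \<open>j \<in> {..n}\<close> by simp
  qed
  also have "\<dots> = C * R ^ i * (\<Sum>k\<le>n. (1/2) ^ (n - k))"
    unfolding sum_distrib_left
    by (rule sum.reindex_bij_witness[of _ "\<lambda>k. n - k" "\<lambda>k. n - k"]) auto
  also have "\<dots> \<le> C * R ^ i * 2"
    using assms by (intro mult_left_mono sum_half_power_le) auto
  finally show ?thesis by (simp add: mult_ac)
qed

lemma Weierstrass_division_normalized:
  assumes F: "\<And>j. cf F 0 j = (if j = d then 1 else 0)"
  obtains Q r where "G = Q * F + r" "\<And>i j. j \<ge> d \<Longrightarrow> cf r i j = 0"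
proof -
  define sl where "sl = (\<lambda>f i. Abs_fps (\<lambda>j. cf f i j))"
  define h where "h = division_step d (sl F) (sl G)"
  obtain C1 R1 where 1: "C1 \<ge> 1" "R1 \<ge> 1" "\<And>i j. norm (cf F i j) \<le> C1 * R1 ^ (i + j)"
    by (rule cf_boundE[of F], rule that)
  obtain C2 R2 where 2: "C2 \<ge> 1" "R2 \<ge> 1" "\<And>i j. norm (cf G i j) \<le> C2 * R2 ^ (i + j)"
    by (rule cf_boundE[of G], rule that)
  define C R where "C = max C1 C2" and "R = max R1 R2"
  have C: "C \<ge> 1" and R: "R \<ge> 1" using 1 2 by (auto simp: C_def R_def)
  have bF: "norm (cf F i j) \<le> C * R ^ (i + j)" for i j
    by (rule bound2_mono[OF 1(3)]) (use 1 in \<open>auto simp: C_def R_def\<close>)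
  have bG: "norm (cf G i j) \<le> C * R ^ (i + j)" for i j
    by (rule bound2_mono[OF 2(3)]) (use 2 in \<open>auto simp: C_def R_def\<close>)
  define \<rho> where "\<rho> = 1 / (2 * R)"
  have \<rho>: "\<rho> > 0" using R by (simp add: \<rho>_def)
  define S where "S = R * (1 + 2 * C / \<rho> ^ d)"
  have S: "S \<ge> 1"
  proof -
    have "1 * 1 \<le> R * (1 + 2 * C / \<rho> ^ d)"
      using R C \<rho> by (intro mult_mono) auto
    thus ?thesis by (simp add: S_def)
  qed
  have h_norm: "wnorm \<rho> n (h i) \<le> 2 * C * S ^ i" for n i
    unfolding h_def S_def using R C \<rho> bF bG
    by (intro division_step_bound) (auto simp: sl_def \<rho>_def intro!: wnorm_slice_bound)
  have h_cf: "norm (h i $ j) \<le> 2 * C * (max S (2 * R)) ^ (i + j)" for i j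
  proof -
    have "norm (h i $ j) * \<rho> ^ j \<le> wnorm \<rho> j (h i)"
      unfolding wnorm_def using \<rho> by (intro member_le_sum) auto
    also have "\<dots> \<le> 2 * C * S ^ i" by (rule h_norm)
    finally have "norm (h i $ j) \<le> 2 * C * (S ^ i * (2 * R) ^ j)"
      using R by (simp add: \<rho>_def field_simps)
    also have "\<dots> \<le> 2 * C * (max S (2 * R) ^ i * max S (2 * R) ^ j)"
      using C S R by (intro mult_left_mono mult_mono power_mono) auto
    finally show ?thesis by (simp add: power_add)
  qed
  have "norm (h i $ (j + d)) \<le> (2 * C * max S (2 * R) ^ d) * max S (2 * R) ^ (i + j)" for i j
    using h_cf[of i "j + d"] by (simp add: power_add mult_ac)
  then obtain Q where Q: "\<And>i j. cf Q i j = h i $ (j + d)"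
    using germ_of_coeffs[of "\<lambda>i j. h i $ (j + d)"] by metis
  have "norm (if j < d then h i $ j else 0) \<le> 2 * C * max S (2 * R) ^ (i + j)" for i j
    using h_cf[of i j] C S by auto
  then obtain r where r: "\<And>i j. cf r i j = (if j < d then h i $ j else 0)"
    using germ_of_coeffs[of "\<lambda>i j. if j < d then h i $ j else 0"] by metis
  have Fd: "sl F 0 = fps_X ^ d"
    by (rule fps_ext) (auto simp: sl_def F)
  have "cf G i j = cf (Q * F + r) i j" for i j
  proof -
    have "cf (Q * F) i j = (\<Sum>k\<le>i. fps_shift d (h k) * sl F (i - k)) $ j"
      by (simp add: cf_mult fps_sum_nth fps_mult_nth atLeast0AtMost Q sl_def)
    also have "(\<Sum>k\<le>i. fps_shift d (h k) * sl F (i - k))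
        = (\<Sum>k<i. fps_shift d (h k) * sl F (i - k)) + fps_shift d (h i) * fps_X ^ d"
      by (simp add: lessThan_Suc_atMost[symmetric] Fd)
    also have "(\<Sum>k<i. fps_shift d (h k) * sl F (i - k)) = sl G i - h i"
      unfolding h_def using division_step.simps[of d "sl F" "sl G" i] by simp
    finally show ?thesis
      by (simp add: r sl_def fps_X_power_mult_right_nth)
  qed
  hence "G = Q * F + r" by (rule hgerm_eqI)
  thus ?thesis by (rule that) (simp add: r)
qed

text \<open>
  Division by a germ of order \<open>d = 0\<close> leaves no remainder, so that dividing \<open>1\<close> inverts the germ. Since
  division is so far available for germs equal to \<open>y\<^sup>d\<close> on the axis \<open>x = 0\<close> only, the germ is first
  multiplied by the inverse of its restriction to this axis.
\<close>

lemma dvd_1_iff_at0: "f dvd 1 \<longleftrightarrow> at0 f \<noteq> 0"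
proof
  assume "f dvd 1"
  then obtain g where "1 = f * g" by (rule dvdE)
  hence "at0 1 = at0 f * at0 g" by (metis at0_mult)
  thus "at0 f \<noteq> 0" by (auto simp: cf_1)
next
  assume f: "at0 f \<noteq> 0"
  have easy: "F dvd 1" if F: "\<And>j. cf F 0 j = (if j = 0 then 1 else 0)" for F
  proof -
    obtain Q r where "1 = Q * F + r" "\<And>i j. j \<ge> 0 \<Longrightarrow> cf r i j = 0"
      by (rule Weierstrass_division_normalized[OF F, of 1], rule that)
    moreover from this have "r = 0" by (intro hgerm_eqI) auto
    ultimately show ?thesis by (metis add_0_right dvd_triv_right)
  qed
  \<comment> \<open>The part of \<open>f\<close> without \<open>x\<close> falls under the easy case once the variables are exchanged.\<close>
  obtain C R where CR: "C \<ge> 1" "R \<ge> 1" "\<And>i j. norm (cf f i j) \<le> C * R ^ (i + j)"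
    by (rule cf_boundE[of f], rule that)
  have "norm (if i = 0 then cf f i j / at0 f else 0) \<le> (C / norm (at0 f)) * R ^ (i + j)" for i j
    using CR(1,2) CR(3)[of 0 j] by (auto simp: norm_divide divide_right_mono)
  then obtain u where u: "\<And>i j. cf u i j = (if i = 0 then cf f i j / at0 f else 0)"
    using germ_of_coeffs[of "\<lambda>i j. if i = 0 then cf f i j / at0 f else 0"] by metis
  have "swap u dvd 1" by (rule easy) (auto simp: u f)
  hence "u dvd 1" using swap_dvd[of "swap u" 1] by simp
  then obtain v where v: "1 = u * v" by (rule dvdE)
  have "f * (v * const (1 / at0 f)) dvd 1"
  proof (rule easy)
    fix j
    have "cf (f * v * const (1 / at0 f)) 0 j = cf (f * v) 0 j / at0 f"
      by (metis cf_const_mult mult.commute mult_1 times_divide_eq_left)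
    also have "cf (f * v) 0 j = at0 f * cf (u * v) 0 j"
      by (simp add: cf_mult u f sum_distrib_left)
    also have "cf (u * v) 0 j = (if j = 0 then 1 else 0)"
      using v by (metis cf_1)
    finally show "cf (f * (v * const (1 / at0 f))) 0 j = (if j = 0 then 1 else 0)"
      using f by (simp add: mult.assoc)
  qed
  thus "f dvd 1" by (rule dvd_mult_left)
qed

theorem Weierstrass_division:
  assumes d: "cf F 0 d \<noteq> 0" "\<And>j. j < d \<Longrightarrow> cf F 0 j = 0"
  obtains Q r where "G = Q * F + r" "\<And>i j. j \<ge> d \<Longrightarrow> cf r i j = 0"
proof -
  obtain C R where CR: "C \<ge> 1" "R \<ge> 1" "\<And>i j. norm (cf F i j) \<le> C * R ^ (i + j)"
    by (rule cf_boundE[of F], rule that)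
  have "norm (if i = 0 then cf F 0 (j + d) else 0) \<le> (C * R ^ d) * R ^ (i + j)" for i j
    using CR(1,2) CR(3)[of 0 "j + d"] by (auto simp: power_add mult_ac)
  then obtain u where u: "\<And>i j. cf u i j = (if i = 0 then cf F 0 (j + d) else 0)"
    using germ_of_coeffs[of "\<lambda>i j. if i = 0 then cf F 0 (j + d) else 0"] by metis
  have "u dvd 1" using d by (simp add: dvd_1_iff_at0 u)
  then obtain v where v: "1 = u * v" by (rule dvdE)
  \<comment> \<open>By construction \<open>F = y\<^sup>d u\<close> on the axis \<open>x = 0\<close>; multiplying by \<open>v = 1 / u\<close> normalizes \<open>F\<close>.\<close>
  have "cf (F * v) 0 j = (if j = d then 1 else 0)" for j
  proof (cases "j < d")
    case True
    thus ?thesis using d(2) by (auto simp: cf_mult intro!: sum.neutral)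
  next
    case False
    have "cf (F * v) 0 j = (\<Sum>l\<le>j. cf F 0 l * cf v 0 (j - l))" by (simp add: cf_mult)
    also have "\<dots> = (\<Sum>l\<in>{d..j}. cf F 0 l * cf v 0 (j - l))"
      using d(2) by (intro sum.mono_neutral_right) auto
    also have "\<dots> = (\<Sum>l\<le>j - d. cf u 0 l * cf v 0 (j - d - l))"
      using False
      by (intro sum.reindex_bij_witness[of _ "\<lambda>l. l + d" "\<lambda>l. l - d"]) (auto simp: u)
    also have "\<dots> = cf (u * v) 0 (j - d)" by (simp add: cf_mult)
    also have "\<dots> = (if j = d then 1 else 0)" using v False by (metis cf_1 diff_is_0_eq linorder_not_less le_antisym diff_self_eq_0)
    finally show ?thesis .
  qed
  then obtain Q r where "G = Q * (F * v) + r" "\<And>i j. j \<ge> d \<Longrightarrow> cf r i j = 0"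
    using Weierstrass_division_normalized[of "F * v" d G] by metis
  thus ?thesis by (intro that[of "Q * v" r]) (auto simp: mult_ac)
qed


section \<open>Order of vanishing and factorization\<close>

text \<open>
  The multiplicity of the zero germ is unspecified. This predicate holds for the zero germ and
  every \<open>n\<close>, as it should.
\<close>

definition vanishes :: "hgerm \<Rightarrow> nat \<Rightarrow> bool" where
  "vanishes f n \<longleftrightarrow> (\<forall>i j. i + j < n \<longrightarrow> cf f i j = 0)"

lemma vanishes_0 [simp]: "vanishes f 0"
  by (simp add: vanishes_def)

lemma vanishes_Suc_0: "vanishes f (Suc 0) \<longleftrightarrow> at0 f = 0"
  by (auto simp: vanishes_def)

lemma vanishes_add: "vanishes f n \<Longrightarrow> vanishes g n \<Longrightarrow> vanishes (f + g) n"
  by (simp add: vanishes_def)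

lemma vanishes_mult:
  assumes "vanishes f m" "vanishes g n"
  shows "vanishes (f * g) (m + n)"
  unfolding vanishes_def cf_mult
proof (intro allI impI sum.neutral ballI)
  fix i j k l assume *: "i + j < m + n" "k \<in> {..i}" "l \<in> {..j}"
  hence "k + l < m \<or> (i - k) + (j - l) < n" by auto
  thus "cf f k l * cf g (i - k) (j - l) = 0"
    using assms by (auto simp: vanishes_def)
qed

lemma vanishes_all_imp_0: "(\<And>n. vanishes f n) \<Longrightarrow> f = 0"
  by (rule hgerm_eqI) (metis cf_0 less_Suc_eq vanishes_def)

lemma le_mult_iff:
  assumes "f \<noteq> 0"
  shows "n \<le> mult f \<longleftrightarrow> vanishes f n"
proof -
  have "\<exists>n i j. i + j = n \<and> cf f i j \<noteq> 0"
    using assms hgerm_eqI[of f 0] by auto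
  hence L: "\<exists>i j. i + j = mult f \<and> cf f i j \<noteq> 0"
    unfolding mult_def by (rule LeastI_ex)
  show ?thesis
  proof
    assume "n \<le> mult f"
    thus "vanishes f n"
      unfolding vanishes_def mult_def using not_less_Least by (metis (mono_tags, lifting) order_less_le_trans)
  next
    assume "vanishes f n"
    thus "n \<le> mult f" using L by (auto simp: vanishes_def not_less[symmetric])
  qed
qed

lemma nonsingular_iff:
  assumes "f \<noteq> 0"
  shows "nonsingular f \<longleftrightarrow> at0 f = 0 \<and> (cf f 1 0 \<noteq> 0 \<or> cf f 0 1 \<noteq> 0)"
proof -
  have "nonsingular f \<longleftrightarrow> vanishes f 1 \<and> \<not> vanishes f 2"
    unfolding nonsingular_def le_mult_iff[OF assms, symmetric] by auto
  also have "vanishes f 2 \<longleftrightarrow> at0 f = 0 \<and> cf f 1 0 = 0 \<and> cf f 0 1 = 0"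
  proof -
    have "i + j < 2 \<longleftrightarrow> (i = 0 \<and> j = 0 \<or> i = 1 \<and> j = 0 \<or> i = 0 \<and> j = 1)" for i j :: nat by auto
    thus ?thesis unfolding vanishes_def by (metis (full_types))
  qed
  finally show ?thesis by (auto simp: vanishes_Suc_0)
qed

text \<open>
  Splitting off a factor lowers the multiplicity. All factorizations below are by induction on it.
\<close>

lemma mult_proper_factor:
  assumes "e * f \<noteq> 0" "\<not> e dvd 1"
  shows "mult f < mult (e * f)"
proof -
  have "vanishes e 1" using assms by (simp add: vanishes_Suc_0 dvd_1_iff_at0)
  moreover have "vanishes f (mult f)" using assms le_mult_iff[of f] by auto
  ultimately have "vanishes (e * f) (1 + mult f)" by (rule vanishes_mult)
  thus ?thesis using le_mult_iff[OF assms(1), of "Suc (mult f)"] by (simp add: Suc_le_eq)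
qed

lemma power_factor_exists:
  fixes e f :: hgerm
  assumes "f \<noteq> 0" "\<not> e dvd 1"
  shows "\<exists>k g. f = e ^ k * g \<and> \<not> e dvd g"
  using assms(1)
proof (induction "mult f" arbitrary: f rule: less_induct)
  case less
  show ?case
  proof (cases "e dvd f")
    case True
    then obtain f' where f': "f = e * f'" by (rule dvdE)
    obtain k g where "f' = e ^ k * g" "\<not> e dvd g"
      using less(1)[of f'] less(2) mult_proper_factor[of e f'] assms(2) f' by auto
    thus ?thesis by (intro exI[of _ "Suc k"] exI[of _ g]) (simp add: f')
  next
    case False
    thus ?thesis by (intro exI[of _ 0] exI[of _ f]) simp
  qed
qed

lemma irreducible_factor_exists:
  fixes f :: hgerm
  assumes "f \<noteq> 0" "\<not> f dvd 1"
  shows "\<exists>p. irreducible p \<and> p dvd f"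
  using assms
proof (induction "mult f" arbitrary: f rule: less_induct)
  case less
  show ?case
  proof (cases "irreducible f")
    case False
    then obtain a b where ab: "f = a * b" "\<not> a dvd 1" "\<not> b dvd 1"
      using less.prems by (auto simp: irreducible_def)
    thus ?thesis using less(1)[of b] mult_proper_factor[of a b] less.prems
      by (metis dvd_mult mult_zero_right)
  qed auto
qed

lemma factor_induct [consumes 1, case_names unit factor]:
  fixes f :: hgerm
  assumes "f \<noteq> 0"
    and unit: "\<And>u. u dvd 1 \<Longrightarrow> P u"
    and factor: "\<And>p f. irreducible p \<Longrightarrow> f \<noteq> 0 \<Longrightarrow> P f \<Longrightarrow> P (p * f)"
  shows "P f"
  using assms(1)
proof (induction "mult f" arbitrary: f rule: less_induct)
  case less
  show ?case
  proof (cases "f dvd 1")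
    case False
    then obtain p g where p: "irreducible p" "f = p * g"
      using irreducible_factor_exists[of f] less.prems by (auto elim: dvdE)
    thus ?thesis
      using less mult_proper_factor[of p g] by (auto simp: irreducible_not_unit intro!: factor)
  qed (rule unit)
qed

lemma nonsingular_imp_irreducible:
  assumes "f \<noteq> 0" "nonsingular f"
  shows "irreducible f"
proof (rule irreducibleI)
  show "\<not> f dvd 1" using assms by (simp add: nonsingular_iff dvd_1_iff_at0)
next
  fix a b assume ab: "f = a * b"
  show "a dvd 1 \<or> b dvd 1"
  proof (rule ccontr)
    assume "\<not> (a dvd 1 \<or> b dvd 1)"
    hence "vanishes f (1 + 1)"
      unfolding ab by (intro vanishes_mult) (simp_all add: vanishes_Suc_0 dvd_1_iff_at0)
    thus False using assms le_mult_iff[of f "1 + 1"] by (simp add: nonsingular_def)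
  qed
qed (rule assms)


section \<open>The ring of germs is factorial\<close>

lemma Xc_neq_0 [simp]: "Xc \<noteq> 0" and Yc_neq_0 [simp]: "Yc \<noteq> 0"
  using cf_Xc[of 1 0] cf_Yc[of 0 1] by auto

lemma Xc_dvd_multD:
  assumes "Xc dvd f * g"
  shows "Xc dvd f \<or> Xc dvd g"
proof -
  have "Abs_fps (\<lambda>j. cf f 0 j) * Abs_fps (\<lambda>j. cf g 0 j) = Abs_fps (\<lambda>j. cf (f * g) 0 j)"
    by (rule fps_ext) (simp add: fps_mult_nth cf_mult atLeast0AtMost)
  also have "\<dots> = 0" using assms by (auto simp: Xc_dvd_iff fps_eq_iff)
  finally have "Abs_fps (\<lambda>j. cf f 0 j) = 0 \<or> Abs_fps (\<lambda>j. cf g 0 j) = 0" by simp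
  thus ?thesis unfolding Xc_dvd_iff by (metis fps_nth_Abs_fps fps_zero_nth)
qed

lemma irreducible_swap [simp]: "irreducible (swap p) \<longleftrightarrow> irreducible p"
proof -
  have "irreducible (swap p)" if p: "irreducible p" for p
  proof (rule irreducibleI)
    show "swap p \<noteq> 0"
    proof
      assume "swap p = 0"
      hence "p = 0" by (intro hgerm_eqI) (metis cf_0 cf_swap)
      thus False using p by simp
    qed
    show "\<not> swap p dvd 1" using irreducible_not_unit[OF p] by (simp add: dvd_1_iff_at0)
    fix a b assume "swap p = a * b"
    hence "p = swap a * swap b" by (metis swap_mult swap_swap)
    thus "a dvd 1 \<or> b dvd 1" using irreducibleD[OF p, of "swap a" "swap b"] by (simp add: dvd_1_iff_at0)
  qed
  from this[of p] this[of "swap p"] show ?thesis by auto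
qed

lemma irreducible_Xc: "irreducible Xc"
  by (rule nonsingular_imp_irreducible) (auto simp: nonsingular_iff cf_Xc)

lemma irreducible_Yc: "irreducible Yc"
  using irreducible_Xc irreducible_swap[of Xc] by simp

lemma Xc_power_cancel:
  assumes "D dvd Xc ^ n * G" "\<not> Xc dvd D"
  shows "D dvd G"
  using assms(1)
proof (induction n)
  case (Suc n)
  then obtain K where K: "Xc * (Xc ^ n * G) = D * K" by (auto simp: mult.assoc)
  hence "Xc dvd D * K" by (metis dvd_triv_left)
  then obtain K' where "K = Xc * K'" using Xc_dvd_multD[of D K] assms(2) by (auto elim: dvdE)
  hence "Xc * (Xc ^ n * G) = Xc * (D * K')" using K by (simp add: mult_ac)
  hence "Xc ^ n * G = D * K'" by simp
  thus ?case using Suc.IH by auto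
qed simp

text \<open>
  Once \<open>x\<close> is inverted, the ring of germs is Euclidean: for germs not divisible by \<open>x\<close>, the order in
  \<open>y\<close> of the restriction to \<open>x = 0\<close> is a Euclidean size. Indeed, the remainder of a Weierstrass
  division by a germ of order \<open>d\<close> is a polynomial in \<open>y\<close> of degree less than \<open>d\<close>, and so it has order
  less than \<open>d\<close> as soon as the powers of \<open>x\<close> in it are divided out.
\<close>

lemma bezout_up_to_Xc:
  assumes "\<not> Xc dvd F"
  shows "\<exists>D n a b. D dvd F \<and> D dvd G \<and> Xc ^ n * D = a * F + b * G"
  using assms
proof (induction "LEAST j. cf F 0 j \<noteq> 0" arbitrary: F G rule: less_induct)
  case less
  define d where "d = (LEAST j. cf F 0 j \<noteq> 0)"
  have ex: "\<exists>j. cf F 0 j \<noteq> 0" using less.prems by (auto simp: Xc_dvd_iff)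
  have d: "cf F 0 d \<noteq> 0" "\<And>j. j < d \<Longrightarrow> cf F 0 j = 0"
    using LeastI_ex[OF ex] unfolding d_def by (auto dest: not_less_Least)
  obtain Q r where Qr: "G = Q * F + r" "\<And>i j. j \<ge> d \<Longrightarrow> cf r i j = 0"
    by (rule Weierstrass_division[OF d, of G], assumption, rule that)
  show ?case
  proof (cases "r = 0")
    case True
    thus ?thesis using Qr
      by (intro exI[of _ F] exI[of _ 0] exI[of _ 1]) auto
  next
    case False
    obtain k s where s: "r = Xc ^ k * s" "\<not> Xc dvd s"
      using power_factor_exists[OF False irreducible_not_unit[OF irreducible_Xc]] by blast
    have r_cf: "cf r (i + k) j = cf s i j" for i j
      unfolding s(1) by (induction k arbitrary: i) (simp_all add: cf_Xc_mult mult.assoc)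
    obtain j where j: "cf s 0 j \<noteq> 0" using s(2) by (auto simp: Xc_dvd_iff)
    hence "j < d" using r_cf[of 0 j] Qr(2)[of j k] by (auto simp: not_le[symmetric])
    hence "(LEAST j. cf s 0 j \<noteq> 0) < d" using Least_le[of "\<lambda>j. cf s 0 j \<noteq> 0" j] j by linarith
    then obtain D n a b where D: "D dvd s" "D dvd F" "Xc ^ n * D = a * s + b * F"
      using less.hyps[of s F] s(2) unfolding d_def by blast
    have "D dvd G" unfolding Qr(1) s(1) using D by (intro dvd_add dvd_mult)
    moreover have "Xc ^ (n + k) * D = (b * Xc ^ k - a * Q) * F + a * G"
    proof -
      have "Xc ^ (n + k) * D = Xc ^ k * (Xc ^ n * D)" by (simp add: power_add mult_ac)
      also have "\<dots> = a * r + b * Xc ^ k * F" unfolding D(3) s(1) by (simp add: algebra_simps)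
      also have "r = G - Q * F" using Qr(1) by simp
      finally show ?thesis by (simp add: algebra_simps)
    qed
    ultimately show ?thesis using D(2) by blast
  qed
qed

lemma irreducible_dvd_cases:
  assumes "irreducible p" "D dvd p"
  shows "D dvd 1 \<or> p dvd D"
proof -
  obtain E where E: "p = D * E" using assms(2) by (rule dvdE)
  hence "D dvd 1 \<or> E dvd 1" using assms(1) by (rule irreducibleD[rotated])
  moreover have "p dvd D" if "E dvd 1"
  proof -
    obtain E' where "1 = E * E'" using \<open>E dvd 1\<close> by (rule dvdE)
    hence "D = p * E'" by (simp add: E mult.assoc)
    thus ?thesis by simp
  qed
  ultimately show ?thesis by blast
qed

text \<open>
  Irreducible germs are prime. For \<open>x\<close> this is clear after restriction to \<open>x = 0\<close>. Any other
  irreducible \<open>p\<close> not dividing \<open>G\<close> has with \<open>G\<close> no common divisor but units, so that the Bezout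
  identity expresses a power of \<open>x\<close>; multiply it by \<open>H\<close> and cancel this power.
\<close>

theorem irreducible_dvd_mult:
  fixes p :: hgerm
  assumes p: "irreducible p" and dvd: "p dvd G * H"
  shows "p dvd G \<or> p dvd H"
proof (cases "Xc dvd p")
  case True
  hence "p dvd Xc" using irreducible_dvd_cases[OF p True] irreducible_not_unit[OF irreducible_Xc] by blast
  thus ?thesis using True dvd Xc_dvd_multD by (metis dvd_trans)
next
  case False
  obtain D n a b where D: "D dvd p" "D dvd G" "Xc ^ n * D = a * p + b * G"
    using bezout_up_to_Xc[OF False] by blast
  consider "D dvd 1" | "p dvd D" using irreducible_dvd_cases[OF p D(1)] by blast
  thus ?thesis
  proof cases
    case 1
    then obtain E where E: "1 = D * E" by (rule dvdE)
    have "Xc ^ n * H = (Xc ^ n * D) * E * H" by (metis E mult.assoc mult_1_right)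
    also have "\<dots> = p * (a * E * H) + b * E * (G * H)" unfolding D(3) by (simp add: algebra_simps)
    finally have "p dvd Xc ^ n * H" using dvd by simp
    thus ?thesis using Xc_power_cancel False by blast
  next
    case 2
    thus ?thesis using D(2) dvd_trans by blast
  qed
qed

lemma irreducible_dvd_power: "irreducible (p :: hgerm) \<Longrightarrow> p dvd f ^ n \<Longrightarrow> p dvd f"
  by (induction n) (auto dest: irreducible_dvd_mult irreducible_not_unit)

lemma irreducible_associated:
  assumes "irreducible p" "irreducible q" "p dvd q"
  shows "q dvd p"
  using irreducible_dvd_cases[OF assms(2,3)] irreducible_not_unit[OF assms(1)] by blast

definition coprime_germs :: "hgerm \<Rightarrow> hgerm \<Rightarrow> bool" where
  "coprime_germs f g \<longleftrightarrow> (\<forall>p. irreducible p \<longrightarrow> p dvd f \<longrightarrow> \<not> p dvd g)"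

text \<open>
  The algebraic form of the fact that two curves without common component meet in the origin only:
  an elimination of \<open>y\<close>.
\<close>

theorem Xc_power_in_coprime_ideal:
  assumes "coprime_germs F G"
  shows "\<exists>n a b. Xc ^ n = a * F + b * G"
proof -
  have main: "\<exists>n a b. Xc ^ n = a * F + b * G" if cop: "coprime_germs F G" and F: "\<not> Xc dvd F" for F G
  proof -
    obtain D n a b where D: "D dvd F" "D dvd G" "Xc ^ n * D = a * F + b * G"
      using bezout_up_to_Xc[OF F] by blast
    have "D \<noteq> 0" using D(1) F by auto
    hence "D dvd 1"
      using irreducible_factor_exists[of D] D cop unfolding coprime_germs_def by (metis dvd_trans)
    then obtain E where E: "1 = D * E" by (rule dvdE)
    have "Xc ^ n = (Xc ^ n * D) * E" by (metis E mult.assoc mult_1_right)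
    also have "\<dots> = (E * a) * F + (E * b) * G" unfolding D(3) by (simp add: algebra_simps)
    finally show ?thesis by blast
  qed
  show ?thesis
  proof (cases "Xc dvd F")
    case True
    hence "\<not> Xc dvd G" using assms irreducible_Xc by (auto simp: coprime_germs_def)
    moreover have "coprime_germs G F" using assms by (auto simp: coprime_germs_def)
    ultimately show ?thesis using main[of G F] by (metis add.commute)
  qed (use main assms in blast)
qed

corollary Yc_power_in_coprime_ideal:
  assumes "coprime_germs F G"
  shows "\<exists>n a b. Yc ^ n = a * F + b * G"
proof -
  have "coprime_germs (swap F) (swap G)"
    using assms unfolding coprime_germs_def by (metis irreducible_swap swap_dvd_iff swap_swap)
  then obtain n a b where "Xc ^ n = a * swap F + b * swap G"
    using Xc_power_in_coprime_ideal by blast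
  hence "swap (Xc ^ n) = swap a * F + swap b * G" by simp
  thus ?thesis by auto
qed

text \<open>
  A reduced germ is determined by its components; this is how germs of curves are compared below.
\<close>

lemma squarefree_imp_dvd:
  fixes f g :: hgerm
  assumes "f \<noteq> 0" "squarefree f" "\<And>p. irreducible p \<Longrightarrow> p dvd f \<Longrightarrow> p dvd g"
  shows "f dvd g"
  using assms
proof (induction f rule: factor_induct)
  case (unit u)
  thus ?case by (metis dvd_trans one_dvd)
next
  case (factor p f)
  have "squarefree f" by (rule squarefree_mono[OF _ factor.prems(1)]) simp
  hence "f dvd g" using factor by simp
  then obtain h where h: "g = f * h" by (rule dvdE)
  have "\<not> p dvd f"
  proof
    assume "p dvd f"
    hence "p ^ 2 dvd p * f" by (simp add: power2_eq_square)
    thus False using squarefreeD[OF factor.prems(1)] irreducible_not_unit[OF factor.hyps(1)] by blast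
  qed
  moreover have "p dvd f * h" using factor h by simp
  ultimately have "p dvd h" using irreducible_dvd_mult[OF factor.hyps(1)] by blast
  thus ?case unfolding h by (simp add: mult.commute mult_dvd_mono)
qed

lemma squarefree_germI:
  fixes f :: hgerm
  assumes "f \<noteq> 0" "\<And>p. irreducible p \<Longrightarrow> \<not> p\<^sup>2 dvd f"
  shows "squarefree f"
proof (rule squarefreeI, rule ccontr)
  fix x assume x: "x\<^sup>2 dvd f" "\<not> x dvd 1"
  hence "x \<noteq> 0" using assms(1) by auto
  then obtain p where "irreducible p" "p dvd x" using x irreducible_factor_exists by blast
  thus False using assms(2)[of p] x(1) dvd_trans[OF dvd_power_same] by blast
qed

lemma irreducible_imp_squarefree:
  fixes g :: hgerm
  assumes "irreducible g"
  shows "squarefree g"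
proof (rule squarefreeI)
  fix x assume "x\<^sup>2 dvd g"
  then obtain k where "g = x\<^sup>2 * k" by (rule dvdE)
  hence "g = x * (x * k)" by (simp add: power2_eq_square mult.assoc)
  thus "x dvd 1" using irreducibleD[OF assms, of x "x * k"] dvd_mult_left by blast
qed

lemma unit_imp_squarefree:
  fixes u :: hgerm
  assumes "u dvd 1"
  shows "squarefree u"
proof (rule squarefreeI)
  fix x assume "x\<^sup>2 dvd u"
  hence "x * x dvd 1" using assms dvd_trans unfolding power2_eq_square by blast
  thus "x dvd 1" by (rule dvd_mult_left)
qed

lemma squarefree_mult_imp_coprime:
  assumes "squarefree (f * g)"
  shows "coprime_germs f g"
  unfolding coprime_germs_def
proof (intro allI impI notI)
  fix p assume p: "irreducible p" "p dvd f" "p dvd g"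
  hence "p\<^sup>2 dvd f * g" unfolding power2_eq_square by (intro mult_dvd_mono)
  thus False using squarefreeD[OF assms] irreducible_not_unit p by blast
qed

lemma irreducible_square_dvd_mult:
  fixes p f g :: hgerm
  assumes p: "irreducible p" and "p\<^sup>2 dvd f * g" and "\<not> p dvd f"
  shows "p\<^sup>2 dvd g"
proof -
  obtain h where "f * g = p\<^sup>2 * h" using assms(2) by (rule dvdE)
  hence h: "f * g = p * (p * h)" by (simp add: power2_eq_square mult.assoc)
  have "p dvd f * g" by (simp add: h)
  hence "p dvd g" using irreducible_dvd_mult[OF p] assms(3) by blast
  then obtain g1 where g1: "g = p * g1" by (rule dvdE)
  have "p * (f * g1) = p * (p * h)" using h by (simp add: g1 mult_ac)
  hence "f * g1 = p * h" using p by auto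
  hence "p dvd f * g1" by simp
  hence "p dvd g1" using irreducible_dvd_mult[OF p] assms(3) by blast
  thus ?thesis by (simp add: g1 power2_eq_square)
qed

lemma squarefree_coprime_mult:
  fixes f g :: hgerm
  assumes "f \<noteq> 0" "g \<noteq> 0" "squarefree f" "squarefree g" "coprime_germs f g"
  shows "squarefree (f * g)"
proof (rule squarefree_germI)
  fix p :: hgerm assume p: "irreducible p"
  have np: "\<not> p\<^sup>2 dvd f" "\<not> p\<^sup>2 dvd g"
    using assms squarefreeD irreducible_not_unit[OF p] by blast+
  show "\<not> p\<^sup>2 dvd f * g"
  proof
    assume *: "p\<^sup>2 dvd f * g"
    have "\<not> p dvd f \<or> \<not> p dvd g" using assms(5) p by (auto simp: coprime_germs_def)
    thus False
      using irreducible_square_dvd_mult[OF p *] irreducible_square_dvd_mult[OF p, of g f] * np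
      by (auto simp: mult.commute)
  qed
qed (use assms in auto)


section \<open>Substitution is a ring homomorphism\<close>

text \<open>
  All identities below are proved modulo terms of arbitrarily high order. This section works with
  formal double series, since both substitution of germs and restriction to a parametrized curve
  are instances of formal substitution.
\<close>

definition fvanishes :: "complex fps fps \<Rightarrow> nat \<Rightarrow> bool" where
  "fvanishes f n \<longleftrightarrow> (\<forall>i j. i + j < n \<longrightarrow> f $ j $ i = 0)"

lemma fvanishes_0 [simp]: "fvanishes f 0"
  by (simp add: fvanishes_def)

lemma fvanishes_1_iff: "fvanishes f (Suc 0) \<longleftrightarrow> f $ 0 $ 0 = 0"
  by (auto simp: fvanishes_def)

lemma fvanishes_zero [simp]: "fvanishes 0 n"
  by (simp add: fvanishes_def)

lemma fvanishes_add: "fvanishes f n \<Longrightarrow> fvanishes g n \<Longrightarrow> fvanishes (f + g) n"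
  by (simp add: fvanishes_def)

lemma fvanishes_diff: "fvanishes f n \<Longrightarrow> fvanishes g n \<Longrightarrow> fvanishes (f - g) n"
  by (simp add: fvanishes_def)

lemma fvanishes_sum: "(\<And>a. a \<in> A \<Longrightarrow> fvanishes (f a) n) \<Longrightarrow> fvanishes (sum f A) n"
  by (induction A rule: infinite_finite_induct) (auto intro: fvanishes_add)

lemma fvanishes_mult:
  assumes "fvanishes f m" "fvanishes g n"
  shows "fvanishes (f * g) (m + n)"
  unfolding fvanishes_def mult_nth2
proof (intro allI impI sum.neutral ballI)
  fix i j k l assume *: "i + j < m + n" "k \<in> {..j}" "l \<in> {..i}"
  hence "k + l < m \<or> (i - l) + (j - k) < n" by auto
  thus "f $ k $ l * g $ (j - k) $ (i - l) = 0"
    using assms by (auto simp: fvanishes_def)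
qed

lemma fvanishes_mult_left: "fvanishes g n \<Longrightarrow> fvanishes (f * g) n"
  using fvanishes_mult[of f 0 g n] by simp

lemma fvanishes_power: "fvanishes f 1 \<Longrightarrow> fvanishes (f ^ n) n"
  by (induction n) (use fvanishes_mult[of f 1] in auto)

lemma fvanishes_mono: "fvanishes f n \<Longrightarrow> m \<le> n \<Longrightarrow> fvanishes f m"
  by (auto simp: fvanishes_def)

lemma fvanishes_all_imp_eq: "(\<And>n. fvanishes (f - g) n) \<Longrightarrow> f = g"
proof (rule fps_ext, rule fps_ext)
  fix i j assume "\<And>n. fvanishes (f - g) n"
  from this[of "Suc (i + j)"] show "f $ j $ i = g $ j $ i" by (auto simp: fvanishes_def)
qed

abbreviation fconst :: "complex \<Rightarrow> complex fps fps" where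
  "fconst c \<equiv> fps_const (fps_const c)"

abbreviation fX :: "complex fps fps" where
  "fX \<equiv> fps_const fps_X"

lemma fps_double_decompose:
  fixes f :: "complex fps fps"
  obtains c g h where "f = fconst c + fX * g + fps_X * h"
proof
  show "f = fconst (f $ 0 $ 0) + fX * Abs_fps (\<lambda>j. fps_shift 1 (f $ j))
      + fps_X * Abs_fps (\<lambda>j. fps_const (f $ Suc j $ 0))"
    by (rule fps_ext, rule fps_ext) (auto simp: fps_X_mult_nth)
qed

context
  fixes u v :: "complex fps fps"
  assumes u: "fvanishes u 1" and v: "fvanishes v 1"
begin

text \<open>The partial sum of the terms whose degrees in the two variables are at most \<open>K\<close>.\<close>

definition partial_subst :: "nat \<Rightarrow> complex fps fps \<Rightarrow> complex fps fps" where
  "partial_subst K f = (\<Sum>i\<le>K. \<Sum>j\<le>K. fconst (f $ j $ i) * (u ^ i * v ^ j))"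

lemma fvanishes_monomial: "fvanishes (u ^ i * v ^ j) (i + j)"
  by (intro fvanishes_mult fvanishes_power u v)

lemma subst_minus_partial: "fvanishes (fps_subst2 f u v - partial_subst K f) (Suc K)"
proof -
  have "fps_subst2 f u v $ n $ m = partial_subst K f $ n $ m" if "m + n \<le> K" for m n
  proof -
    have 0: "(u ^ i * v ^ j) $ n $ m = 0" if "i > m + n \<or> j > m + n" for i j
      using fvanishes_monomial[of i j] that by (auto simp: fvanishes_def)
    have "partial_subst K f $ n $ m = (\<Sum>i\<le>K. \<Sum>j\<le>K. f $ j $ i * (u ^ i * v ^ j) $ n $ m)"
      by (simp add: partial_subst_def fps_sum_nth)
    also have "\<dots> = (\<Sum>i\<le>K. \<Sum>j\<le>m+n. f $ j $ i * (u ^ i * v ^ j) $ n $ m)"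
      using that 0 by (intro sum.cong refl sum.mono_neutral_right) auto
    also have "\<dots> = (\<Sum>i\<le>m+n. \<Sum>j\<le>m+n. f $ j $ i * (u ^ i * v ^ j) $ n $ m)"
      using that 0 by (intro sum.mono_neutral_right) (auto intro!: sum.neutral)
    finally show ?thesis by (simp add: fps_subst2_def)
  qed
  thus ?thesis by (auto simp: fvanishes_def)
qed

lemma subst_eqI:
  assumes "\<And>K. \<exists>L\<ge>K. fvanishes (partial_subst L f - g) K"
  shows "fps_subst2 f u v = g"
proof (rule fvanishes_all_imp_eq)
  fix n
  obtain L where L: "L \<ge> n" "fvanishes (partial_subst L f - g) n" using assms by blast
  have "fvanishes ((fps_subst2 f u v - partial_subst L f) + (partial_subst L f - g)) n"
    using L by (intro fvanishes_add fvanishes_mono[OF subst_minus_partial]) auto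
  thus "fvanishes (fps_subst2 f u v - g) n" by simp
qed

lemma fps_subst2_add: "fps_subst2 (f + g) u v = fps_subst2 f u v + fps_subst2 g u v"
  by (rule fps_ext, rule fps_ext) (simp add: fps_subst2_def distrib_right sum.distrib)

lemma fps_subst2_cmult: "fps_subst2 (fconst c * f) u v = fconst c * fps_subst2 f u v"
  by (rule fps_ext, rule fps_ext) (simp add: fps_subst2_def sum_distrib_left mult_ac)

lemma fps_subst2_1: "fps_subst2 1 u v = 1"
proof (rule subst_eqI)
  fix K
  have "partial_subst K 1 = (\<Sum>i\<le>K. \<Sum>j\<le>K. if j = 0 then if i = 0 then 1 else 0 else 0)"
    unfolding partial_subst_def by (intro sum.cong refl) (auto simp: fps_one_nth)
  also have "\<dots> = 1" by (simp add: sum.delta)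
  finally show "\<exists>L\<ge>K. fvanishes (partial_subst L 1 - 1) K" by (intro exI[of _ K]) simp
qed

lemma fps_subst2_X_mult: "fps_subst2 (fX * f) u v = u * fps_subst2 f u v"
proof (rule subst_eqI)
  fix K
  let ?t = "\<lambda>i j. fconst (f $ j $ i) * (u ^ Suc i * v ^ j)"
  have "partial_subst (Suc K) (fX * f) = (\<Sum>i\<le>K. \<Sum>j\<le>Suc K. ?t i j)"
    unfolding partial_subst_def sum.atMost_Suc_shift by simp
  also have "\<dots> = (\<Sum>i\<le>K. \<Sum>j\<le>K. ?t i j) + (\<Sum>i\<le>K. ?t i (Suc K))"
    by (simp add: sum.distrib)
  also have "(\<Sum>i\<le>K. \<Sum>j\<le>K. ?t i j) = u * partial_subst K f"
    by (simp add: partial_subst_def sum_distrib_left mult_ac)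
  finally have "partial_subst (Suc K) (fX * f) - u * fps_subst2 f u v
      = (\<Sum>i\<le>K. ?t i (Suc K)) - u * (fps_subst2 f u v - partial_subst K f)"
    by (simp add: algebra_simps)
  moreover have "fvanishes \<dots> K"
  proof (intro fvanishes_diff fvanishes_sum)
    show "fvanishes (?t i (Suc K)) K" for i
      by (intro fvanishes_mult_left fvanishes_mono[OF fvanishes_monomial]) simp
    show "fvanishes (u * (fps_subst2 f u v - partial_subst K f)) K"
      by (intro fvanishes_mult_left fvanishes_mono[OF subst_minus_partial]) simp
  qed
  ultimately show "\<exists>L\<ge>K. fvanishes (partial_subst L (fX * f) - u * fps_subst2 f u v) K"
    by (intro exI[of _ "Suc K"]) simp
qed

lemma fps_subst2_Y_mult: "fps_subst2 (fps_X * f) u v = v * fps_subst2 f u v"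
proof (rule subst_eqI)
  fix K
  let ?t = "\<lambda>i j. fconst (f $ j $ i) * (u ^ i * v ^ Suc j)"
  have "partial_subst (Suc K) (fps_X * f) = (\<Sum>i\<le>Suc K. \<Sum>j\<le>K. ?t i j)"
    unfolding partial_subst_def
    by (rule sum.cong[OF refl]) (simp add: sum.atMost_Suc_shift del: sum.atMost_Suc)
  also have "\<dots> = (\<Sum>i\<le>K. \<Sum>j\<le>K. ?t i j) + (\<Sum>j\<le>K. ?t (Suc K) j)"
    by simp
  also have "(\<Sum>i\<le>K. \<Sum>j\<le>K. ?t i j) = v * partial_subst K f"
    by (simp add: partial_subst_def sum_distrib_left mult_ac)
  finally have "partial_subst (Suc K) (fps_X * f) - v * fps_subst2 f u v
      = (\<Sum>j\<le>K. ?t (Suc K) j) - v * (fps_subst2 f u v - partial_subst K f)"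
    by (simp add: algebra_simps)
  moreover have "fvanishes \<dots> K"
  proof (intro fvanishes_diff fvanishes_sum)
    show "fvanishes (?t (Suc K) j) K" for j
      by (intro fvanishes_mult_left fvanishes_mono[OF fvanishes_monomial]) simp
    show "fvanishes (v * (fps_subst2 f u v - partial_subst K f)) K"
      by (intro fvanishes_mult_left fvanishes_mono[OF subst_minus_partial]) simp
  qed
  ultimately show "\<exists>L\<ge>K. fvanishes (partial_subst L (fps_X * f) - v * fps_subst2 f u v) K"
    by (intro exI[of _ "Suc K"]) simp
qed

text \<open>
  The defect of multiplicativity is bilinear and vanishes when the first factor is constant. Splitting
  off \<open>x\<close> or \<open>y\<close> from the first factor multiplies the defect by \<open>u\<close> or \<open>v\<close>; repeating this shows that it
  vanishes to arbitrarily high order.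
\<close>

lemma fps_subst2_mult: "fps_subst2 (f * g) u v = fps_subst2 f u v * fps_subst2 g u v"
proof (rule fvanishes_all_imp_eq)
  fix n
  show "fvanishes (fps_subst2 (f * g) u v - fps_subst2 f u v * fps_subst2 g u v) n"
  proof (induction n arbitrary: f)
    case (Suc n)
    let ?E = "\<lambda>f. fps_subst2 (f * g) u v - fps_subst2 f u v * fps_subst2 g u v"
    obtain c f1 f2 where f: "f = fconst c * 1 + fX * f1 + fps_X * f2"
      by (rule fps_double_decompose[of f], rule that) simp
    have fg: "f * g = fconst c * g + fX * (f1 * g) + fps_X * (f2 * g)"
      by (simp add: f algebra_simps)
    have "?E f = u * ?E f1 + v * ?E f2"
      unfolding fg unfolding f fps_subst2_add fps_subst2_X_mult fps_subst2_Y_mult fps_subst2_cmult fps_subst2_1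
      by (simp add: algebra_simps)
    also have "fvanishes \<dots> (1 + n)"
      by (intro fvanishes_add fvanishes_mult u v Suc)
    finally show ?case by simp
  qed simp
qed

end

context
  fixes u v :: hgerm
  assumes uv: "at0 u = 0" "at0 v = 0"
begin

lemma subst_add: "subst (f + g) u v = subst f u v + subst g u v"
  using uv by transfer (simp add: fps_subst2_add fvanishes_1_iff)

lemma subst_mult: "subst (f * g) u v = subst f u v * subst g u v"
  using uv by transfer (simp add: fps_subst2_mult fvanishes_1_iff)

lemma subst_1: "subst 1 u v = 1"
  using uv by transfer (simp add: fps_subst2_1 fvanishes_1_iff)

lemma subst_const: "subst (const c) u v = const c"
  using uv by transfer (metis One_nat_def fps_subst2_1 fps_subst2_cmult fvanishes_1_iff mult_1_right)

lemma subst_Xc: "subst Xc u v = u"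
  using uv by transfer (metis One_nat_def fps_subst2_1 fps_subst2_X_mult fvanishes_1_iff mult_1_right)

lemma subst_Yc: "subst Yc u v = v"
  using uv by transfer (metis One_nat_def fps_subst2_1 fps_subst2_Y_mult fvanishes_1_iff mult_1_right)

end

lemma along_eq_subst: "along f p q $ n = fps_subst2 (Rep_hgerm f) (fps_const p) (fps_const q) $ 0 $ n"
  by (simp add: along_def fps_subst2_def cf.rep_eq fps_const_power)

lemma along_mult:
  assumes "p $ 0 = 0" "q $ 0 = 0"
  shows "along (f * g) p q = along f p q * along g p q"
proof (rule fps_ext)
  fix n
  have "along (f * g) p q $ n = (fps_subst2 (Rep_hgerm f) (fps_const p) (fps_const q)
      * fps_subst2 (Rep_hgerm g) (fps_const p) (fps_const q)) $ 0 $ n"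
    unfolding along_eq_subst times_hgerm.rep_eq using assms
    by (subst fps_subst2_mult) (simp_all add: fvanishes_1_iff)
  also have "\<dots> = (along f p q * along g p q) $ n"
    by (simp add: fps_mult_nth along_eq_subst)
  finally show "along (f * g) p q $ n = (along f p q * along g p q) $ n" .
qed

lemma along_nth_0: "along f p q $ 0 = at0 f"
  by (simp add: along_def)


section \<open>The chain rule\<close>

lemma germ_decompose:
  obtains c g h where "f = const c + Xc * g + Yc * h"
proof -
  obtain C R where CR: "C \<ge> 1" "R \<ge> 1" "\<And>i j. norm (cf f i j) \<le> C * R ^ (i + j)"
    by (rule cf_boundE[of f], rule that)
  have "norm (if i = 0 \<and> j \<noteq> 0 then cf f i j else 0) \<le> C * R ^ (i + j)" for i j
    using CR(1,2) CR(3)[of i j] by auto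
  then obtain r where r: "\<And>i j. cf r i j = (if i = 0 \<and> j \<noteq> 0 then cf f i j else 0)"
    using germ_of_coeffs[of "\<lambda>i j. if i = 0 \<and> j \<noteq> 0 then cf f i j else 0"] by metis
  have "Yc dvd r" by (simp add: Yc_dvd_iff r)
  moreover have "Xc dvd f - const (at0 f) - r"
    by (auto simp: Xc_dvd_iff r cf_const)
  ultimately obtain g h where "r = Yc * h" "f - const (at0 f) - r = Xc * g"
    by (auto elim!: dvdE)
  hence "f = const (at0 f) + Xc * g + Yc * h" by (simp add: algebra_simps)
  thus ?thesis by (rule that)
qed

lemma const_0: "const 0 = 0"
  by (rule hgerm_eqI) (simp add: cf_const)

lemma vanishing_decompose:
  assumes "at0 f = 0"
  obtains g h where "f = Xc * g + Yc * h"
proof -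
  obtain c g h where f: "f = const c + Xc * g + Yc * h" by (rule germ_decompose[of f], rule that)
  hence "c = 0" using assms by (simp add: cf_const cf_Xc cf_Yc)
  thus ?thesis using f that by (simp add: const_0)
qed

text \<open>
  The values of such an operator vanish to arbitrarily high order: split off \<open>x\<close> or \<open>y\<close> from its
  argument again and again. The difference of two derivations along a substitution is of this kind
  if it vanishes on the coordinates.
\<close>

lemma derivation_eq_0:
  assumes add: "\<And>f g. \<Delta> (f + g) = \<Delta> f + \<Delta> g"
    and const: "\<And>c. \<Delta> (const c) = 0"
    and X: "\<And>f. \<Delta> (Xc * f) = u * \<Delta> f" and Y: "\<And>f. \<Delta> (Yc * f) = v * \<Delta> f"
    and uv: "at0 u = 0" "at0 v = 0"
  shows "\<Delta> f = 0"
proof (rule vanishes_all_imp_0)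
  fix n show "vanishes (\<Delta> f) n"
  proof (induction n arbitrary: f)
    case (Suc n)
    obtain c g h where f: "f = const c + Xc * g + Yc * h" by (rule germ_decompose[of f], rule that)
    have "\<Delta> f = u * \<Delta> g + v * \<Delta> h" by (simp add: f add const X Y)
    also have "vanishes \<dots> (1 + n)"
      using uv by (intro vanishes_add vanishes_mult Suc) (simp_all add: vanishes_Suc_0)
    finally show ?case by simp
  qed simp
qed

lemma dx_add: "dx (f + g) = dx f + dx g"
  by (rule hgerm_eqI) (simp add: distrib_left)

lemma dy_add: "dy (f + g) = dy f + dy g"
  by (rule hgerm_eqI) (simp add: distrib_left)

lemma dx_mult: "dx (f * g) = dx f * g + f * dx g"
proof (rule Rep_hgerm_inject[THEN iffD1], rule fps_ext)
  fix n
  let ?f = "Rep_hgerm f" and ?g = "Rep_hgerm g"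
  show "Rep_hgerm (dx (f * g)) $ n = Rep_hgerm (dx f * g + f * dx g) $ n"
    by (simp add: dx.rep_eq times_hgerm.rep_eq plus_hgerm.rep_eq fps_mult_nth fps_deriv_sum sum.distrib add.commute)
qed

lemma dy_mult: "dy (f * g) = dy f * g + f * dy g"
  by transfer (simp add: add.commute)

lemma dx_const [simp]: "dx (const c) = 0" and dy_const [simp]: "dy (const c) = 0"
  and dx_Xc [simp]: "dx Xc = 1" and dx_Yc [simp]: "dx Yc = 0"
  and dy_Xc [simp]: "dy Xc = 0" and dy_Yc [simp]: "dy Yc = 1"
  by (rule hgerm_eqI; auto simp: cf_const cf_Xc cf_Yc cf_1)+

lemma der_add: "der X (f + g) = der X f + der X g"
  by (simp add: der_def dx_add dy_add algebra_simps)

lemma der_mult: "der X (f * g) = der X f * g + f * der X g"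
  by (simp add: der_def dx_mult dy_mult algebra_simps)

lemma der_const [simp]: "der X (const c) = 0"
  by (simp add: der_def)

theorem chain_rule:
  assumes "at0 u = 0" "at0 v = 0"
  shows "der Y (subst f u v) = subst (dx f) u v * der Y u + subst (dy f) u v * der Y v"
proof -
  let ?S = "\<lambda>f. subst f u v"
  let ?\<Delta> = "\<lambda>f. der Y (?S f) - (?S (dx f) * der Y u + ?S (dy f) * der Y v)"
  note S = subst_add[OF assms] subst_mult[OF assms] subst_Xc[OF assms] subst_Yc[OF assms]
    subst_1[OF assms] subst_const[OF assms]
  have S0: "?S 0 = 0" using subst_const[OF assms, of 0] by (simp add: const_0)
  have "?\<Delta> f = 0"
    by (rule derivation_eq_0[OF _ _ _ _ assms])
       (simp_all only: S S0 der_add der_mult dx_add dy_add dx_mult dy_mult dx_const dy_const der_const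
         dx_Xc dx_Yc dy_Xc dy_Yc, simp_all add: algebra_simps)
  thus ?thesis by simp
qed


section \<open>Nonsingular and transverse germs\<close>

lemma nonsingular_dvd:
  assumes "g \<noteq> 0" "nonsingular g" "f dvd g" "at0 f = 0"
  shows "nonsingular f \<and> g dvd f"
proof -
  have irr: "irreducible g" using assms by (intro nonsingular_imp_irreducible)
  have "\<not> f dvd 1" using assms by (simp add: dvd_1_iff_at0)
  hence gf: "g dvd f" using irreducible_dvd_cases[OF irr assms(3)] by blast
  have f0: "f \<noteq> 0" using assms by auto
  obtain k where k: "g = f * k" using assms(3) by (rule dvdE)
  have "mult f \<le> mult g"
    unfolding le_mult_iff[OF assms(1)] unfolding k
    using vanishes_mult[of f "mult f" k 0] le_mult_iff[OF f0, of "mult f"] by simp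
  moreover have "1 \<le> mult f" using f0 assms(4) by (simp add: le_mult_iff vanishes_Suc_0)
  ultimately show ?thesis using assms(2) gf by (simp add: nonsingular_def)
qed

lemma not_nonsingular_mult:
  assumes "f * g \<noteq> 0" "at0 f = 0" "at0 g = 0"
  shows "\<not> nonsingular (f * g)"
proof
  assume "nonsingular (f * g)"
  hence "irreducible (f * g)" using assms by (intro nonsingular_imp_irreducible)
  thus False using assms irreducibleD[of "f * g" f g] by (simp add: dvd_1_iff_at0)
qed

lemma at0_dx_mult: "at0 f = 0 \<Longrightarrow> at0 (dx (u * f)) = at0 u * at0 (dx f)"
  and at0_dy_mult: "at0 f = 0 \<Longrightarrow> at0 (dy (u * f)) = at0 u * at0 (dy f)"
  unfolding dx_mult dy_mult cf_add at0_mult by simp_all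

lemma nonsingular_iff_gradient:
  assumes "f \<noteq> 0"
  shows "nonsingular f \<longleftrightarrow> at0 f = 0 \<and> (at0 (dx f) \<noteq> 0 \<or> at0 (dy f) \<noteq> 0)"
  using nonsingular_iff[OF assms] by simp

lemma nonsingular_unit_mult:
  assumes "at0 u \<noteq> 0" "f \<noteq> 0"
  shows "nonsingular (u * f) \<longleftrightarrow> nonsingular f"
proof -
  have "u * f \<noteq> 0" using assms by auto
  thus ?thesis using assms
    unfolding nonsingular_iff_gradient[OF \<open>u * f \<noteq> 0\<close>] nonsingular_iff_gradient[OF assms(2)]
    by (auto simp: at0_dx_mult at0_dy_mult simp del: cf_dx cf_dy)
qed

lemma transverse_sym: "transverse f g \<Longrightarrow> transverse g f"
  by (auto simp: transverse_def algebra_simps)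

lemma transverse_unit_mult_left:
  assumes "at0 u \<noteq> 0" "at0 f = 0"
  shows "transverse (u * f) g \<longleftrightarrow> transverse f g"
  using assms unfolding transverse_def
  by (simp add: at0_dx_mult at0_dy_mult mult.assoc right_diff_distrib[symmetric] del: cf_dx cf_dy)

lemma transverse_unit_mult_right:
  assumes "at0 u \<noteq> 0" "at0 g = 0"
  shows "transverse f (u * g) \<longleftrightarrow> transverse f g"
  using transverse_unit_mult_left[OF assms] transverse_sym by blast


section \<open>One blow-up\<close>

text \<open>
  For both kinds of charts there are coordinates \<open>(a, b)\<close> at the origin and \<open>(e, w)\<close> at the point
  of the exceptional divisor in which the blow-up is \<open>a = e\<close>, \<open>b = e w\<close>. As elements of the ring,
  \<open>a\<close> and \<open>e\<close> are the same variable \<open>exc t\<close>; the germ \<open>b\<close> is \<open>axis t\<close>, whose zero set is the line in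
  direction \<open>t\<close>, and \<open>w\<close> is \<open>fibre t\<close>. The vector field \<open>vert t\<close> is \<open>\<partial>\<^sub>w\<close>, and \<open>\<partial>\<^sub>b\<close> as well.
\<close>

fun axis :: "direction \<Rightarrow> hgerm" where
  "axis (Slope c) = Yc - const c * Xc"
| "axis Vertical = Xc"

fun fibre :: "direction \<Rightarrow> hgerm" where
  "fibre (Slope c) = Yc"
| "fibre Vertical = Xc"

fun vert :: "direction \<Rightarrow> vfield" where
  "vert (Slope c) = (0, 1)"
| "vert Vertical = (1, 0)"

lemma at0_chart: "at0 (fst (chart t)) = 0" "at0 (snd (chart t)) = 0"
  by (cases t; simp add: cf_Xc cf_Yc)+

lemma exc_nonzero [simp]: "exc t \<noteq> 0" and fibre_nonzero [simp]: "fibre t \<noteq> 0"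
  and at0_exc [simp]: "at0 (exc t) = 0" and at0_fibre [simp]: "at0 (fibre t) = 0"
  and irreducible_exc: "irreducible (exc t)" and irreducible_fibre: "irreducible (fibre t)"
  and at0_axis [simp]: "at0 (axis t) = 0"
  by (cases t; simp add: cf_Xc cf_Yc irreducible_Xc irreducible_Yc)+

lemma exc_not_unit: "\<not> exc t dvd 1"
  by (simp add: dvd_1_iff_at0)

lemma nonsingular_exc: "nonsingular (exc t)"
  by (cases t) (auto simp: nonsingular_iff cf_Xc cf_Yc)

lemma fibre_not_dvd_exc: "\<not> fibre t dvd exc t"
  by (cases t) (auto simp: Xc_dvd_iff Yc_dvd_iff cf_Xc cf_Yc)

lemma der_vert [simp]: "der (vert t) (exc t) = 0" "der (vert t) (fibre t) = 1" "der (vert t) (axis t) = 1"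
proof -
  have "dx (a - b) = dx a - dx b" "dy (a - b) = dy a - dy b" for a b
    by (rule hgerm_eqI, simp add: right_diff_distrib)+
  thus "der (vert t) (exc t) = 0" "der (vert t) (fibre t) = 1" "der (vert t) (axis t) = 1"
    by (cases t; simp add: der_def dy_mult dx_mult)+
qed

lemma at0_der_vert_exc_mult [simp]: "at0 (der (vert t) (exc t * f)) = 0"
  by (simp add: der_mult)

lemma total_transform_add: "total_transform t (f + g) = total_transform t f + total_transform t g"
  and total_transform_mult: "total_transform t (f * g) = total_transform t f * total_transform t g"
  and total_transform_1 [simp]: "total_transform t 1 = 1"
  and total_transform_const [simp]: "total_transform t (const c) = const c"
  unfolding total_transform_def
  by (simp_all only: subst_add subst_mult subst_1 subst_const at0_chart)

lemma total_transform_power: "total_transform t (f ^ n) = total_transform t f ^ n"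
  by (induction n) (simp_all add: total_transform_mult)

lemma total_transform_Xc: "total_transform t Xc = fst (chart t)"
  and total_transform_Yc: "total_transform t Yc = snd (chart t)"
  unfolding total_transform_def by (simp_all only: subst_Xc subst_Yc at0_chart)

lemma total_transform_diff: "total_transform t (f - g) = total_transform t f - total_transform t g"
  using total_transform_add[of t "f - g" g] by (simp add: algebra_simps)

lemma total_transform_exc [simp]: "total_transform t (exc t) = exc t"
  by (cases t) (simp_all add: total_transform_Xc total_transform_Yc)

lemma total_transform_axis [simp]: "total_transform t (axis t) = exc t * fibre t"
  by (cases t) (simp_all add: total_transform_Xc total_transform_Yc total_transform_diff
      total_transform_mult algebra_simps)

lemma total_transform_dvd: "f dvd g \<Longrightarrow> total_transform t f dvd total_transform t g"
  by (auto simp: total_transform_mult elim!: dvdE)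

lemma axis_decompose:
  assumes "at0 f = 0"
  obtains g h where "f = exc t * g + axis t * h"
proof -
  obtain g h where f: "f = Xc * g + Yc * h" by (rule vanishing_decompose[OF assms], rule that)
  show ?thesis
  proof (cases t)
    case (Slope c)
    thus ?thesis using f by (intro that[of "g + const c * h" h]) (simp add: algebra_simps)
  next
    case Vertical
    thus ?thesis using f by (intro that[of h g]) (simp add: algebra_simps)
  qed
qed

lemma at0_total_transform [simp]: "at0 (total_transform t f) = at0 f"
proof -
  obtain c g h where f: "f = const c + Xc * g + Yc * h" by (rule germ_decompose[of f], rule that)
  show ?thesis
    unfolding f total_transform_add total_transform_mult total_transform_Xc total_transform_Yc
    by (simp add: at0_chart cf_Xc cf_Yc)
qed

lemma exc_dvd_total_transform:
  assumes "at0 f = 0"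
  shows "exc t dvd total_transform t f"
proof -
  obtain g h where f: "f = exc t * g + axis t * h" by (rule axis_decompose[OF assms, of t], rule that)
  show ?thesis unfolding f total_transform_add total_transform_mult by (simp add: mult.assoc)
qed

lemma der_vert_total_transform: "der (vert t) (total_transform t f) = exc t * total_transform t (der (vert t) f)"
  unfolding total_transform_def chain_rule[OF at0_chart]
  by (cases t) (simp_all add: der_def dx_mult dy_mult dx_add dy_add mult.commute)

lemma exc_power_in_coprime_ideal:
  assumes "coprime_germs F G"
  shows "\<exists>n a b. exc t ^ n = a * F + b * G"
  using Xc_power_in_coprime_ideal[OF assms] Yc_power_in_coprime_ideal[OF assms] by (cases t) auto

text \<open>
  Injectivity of the blow-up on functions. Suppose an irreducible \<open>p\<close> is sent to \<open>0\<close>. If \<open>p\<close> is coprime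
  to \<open>b\<close>, then a power of \<open>a\<close> lies in the ideal of \<open>p\<close> and \<open>b\<close>, and so a power of \<open>e\<close> is a multiple
  of \<open>e w\<close>, which is absurd. Otherwise \<open>p\<close> is \<open>b\<close> up to a unit.
\<close>

lemma total_transform_nonzero:
  assumes "f \<noteq> 0"
  shows "total_transform t f \<noteq> 0"
  using assms
proof (induction f rule: factor_induct)
  case (unit u)
  hence "at0 (total_transform t u) \<noteq> 0" by (simp add: dvd_1_iff_at0)
  thus ?case by (metis cf_0)
next
  case (factor p f)
  have "total_transform t p \<noteq> 0"
  proof
    assume 0: "total_transform t p = 0"
    show False
    proof (cases "coprime_germs p (axis t)")
      case True
      then obtain n a b where n: "exc t ^ n = a * p + b * axis t"
        using exc_power_in_coprime_ideal by blast
      have "exc t ^ n = total_transform t (exc t ^ n)" by (simp add: total_transform_power)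
      also have "\<dots> = fibre t * (total_transform t b * exc t)"
        unfolding n total_transform_add total_transform_mult 0 by (simp add: mult_ac)
      finally have "fibre t dvd exc t ^ n" by simp
      thus False using irreducible_dvd_power[OF irreducible_fibre] fibre_not_dvd_exc by blast
    next
      case False
      then obtain q where q: "irreducible q" "q dvd p" "q dvd axis t"
        by (auto simp: coprime_germs_def)
      hence "p dvd axis t" using irreducible_associated[OF q(1) factor.hyps(1) q(2)] dvd_trans by blast
      hence "total_transform t p dvd exc t * fibre t" using total_transform_dvd[of p "axis t" t] by simp
      thus False by (simp add: 0)
    qed
  qed
  thus ?case using factor by (simp add: total_transform_mult)
qed

lemma strict1_eqI:
  assumes "total_transform t f = exc t ^ m * h" "\<not> exc t dvd h"
  shows "strict1 t f = h"
  unfolding strict1_def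
proof (rule the_equality)
  fix k assume "\<exists>m. total_transform t f = exc t ^ m * k \<and> \<not> exc t dvd k"
  then obtain n where n: "total_transform t f = exc t ^ n * k" "\<not> exc t dvd k" by blast
  have "n \<le> m" if "exc t ^ m * h = exc t ^ n * k" "\<not> exc t dvd h" for m n h k
  proof (rule ccontr)
    assume "\<not> n \<le> m"
    then obtain l where "n = m + Suc l" by (metis less_imp_Suc_add not_le add_Suc_right)
    hence "exc t ^ m * h = exc t ^ m * (exc t * (exc t ^ l * k))"
      using that by (simp add: power_add mult_ac)
    hence "h = exc t * (exc t ^ l * k)" by simp
    thus False using that by simp
  qed
  from this[of m h n k] this[of n k m h] have "m = n" using assms n by simp
  thus "k = h" using assms n by simp
qed (use assms in blast)

lemma total_transform_eq:
  assumes "f \<noteq> 0"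
  obtains m where "total_transform t f = exc t ^ m * strict1 t f"
proof -
  obtain m h where "total_transform t f = exc t ^ m * h" "\<not> exc t dvd h"
    using power_factor_exists[OF total_transform_nonzero[OF assms] exc_not_unit] by blast
  thus ?thesis using strict1_eqI that by metis
qed

lemma exc_not_dvd_strict1:
  assumes "f \<noteq> 0"
  shows "\<not> exc t dvd strict1 t f"
proof -
  obtain m h where "total_transform t f = exc t ^ m * h" "\<not> exc t dvd h"
    using power_factor_exists[OF total_transform_nonzero[OF assms] exc_not_unit] by blast
  thus ?thesis using strict1_eqI by metis
qed

lemma strict1_nonzero: "f \<noteq> 0 \<Longrightarrow> strict1 t f \<noteq> 0"
  using exc_not_dvd_strict1[of f t] by (metis dvd_0_right)

lemma strict1_mult:
  assumes "f \<noteq> 0" "g \<noteq> 0"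
  shows "strict1 t (f * g) = strict1 t f * strict1 t g"
proof -
  obtain m where m: "total_transform t f = exc t ^ m * strict1 t f"
    by (rule total_transform_eq[OF assms(1)], rule that)
  obtain n where n: "total_transform t g = exc t ^ n * strict1 t g"
    by (rule total_transform_eq[OF assms(2)], rule that)
  have "total_transform t (f * g) = exc t ^ (m + n) * (strict1 t f * strict1 t g)"
    by (simp add: total_transform_mult m n power_add mult_ac)
  moreover have "\<not> exc t dvd strict1 t f * strict1 t g"
    using irreducible_dvd_mult[OF irreducible_exc] exc_not_dvd_strict1 assms by blast
  ultimately show ?thesis by (rule strict1_eqI)
qed

lemma strict1_1 [simp]: "strict1 t 1 = 1"
  by (rule strict1_eqI[of t 1 0]) (simp_all add: exc_not_unit)

lemma strict1_exc [simp]: "strict1 t (exc t) = 1"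
  by (rule strict1_eqI[of t _ 1]) (simp_all add: exc_not_unit)

lemma strict1_dvd: "f dvd g \<Longrightarrow> g \<noteq> 0 \<Longrightarrow> strict1 t f dvd strict1 t g"
  by (auto simp: strict1_mult elim!: dvdE)

lemma strict1_unit: "u dvd 1 \<Longrightarrow> strict1 t u dvd 1"
  using strict1_dvd[of u 1 t] by simp

text \<open>
  Components of strict transforms are never the exceptional divisor, which is what allows
  cancelling powers of \<open>exc t\<close> in the arguments below.
\<close>

lemma irreducible_dvd_strict1_imp_not_exc:
  assumes "f \<noteq> 0" "irreducible s" "s dvd strict1 t f"
  shows "\<not> s dvd exc t"
  using irreducible_associated[OF assms(2) irreducible_exc] assms exc_not_dvd_strict1 dvd_trans by blast

text \<open>
  A common component of two strict transforms would divide the total transform of every element of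
  the ideal generated by the two germs, in particular of a power of the variable \<open>exc t\<close>.
\<close>

lemma coprime_strict1:
  assumes "coprime_germs F G" "F \<noteq> 0" "G \<noteq> 0"
  shows "coprime_germs (strict1 t F) (strict1 t G)"
  unfolding coprime_germs_def
proof (intro allI impI notI)
  fix p assume p: "irreducible p" "p dvd strict1 t F" "p dvd strict1 t G"
  have pF: "p dvd total_transform t F" "p dvd total_transform t G"
    using p assms total_transform_eq dvd_mult by metis+
  obtain n a b where n: "exc t ^ n = a * F + b * G"
    using exc_power_in_coprime_ideal[OF assms(1)] by blast
  have "exc t ^ n = total_transform t (a * F + b * G)"
    unfolding n[symmetric] by (simp add: total_transform_power)
  hence "p dvd exc t ^ n" using pF by (simp add: total_transform_add total_transform_mult)
  thus False
    using irreducible_dvd_power[OF p(1)] irreducible_dvd_strict1_imp_not_exc[OF assms(2) p(1,2)] by blast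
qed

lemma irreducible_dvd_strict1:
  assumes "f \<noteq> 0" "irreducible s" "s dvd strict1 t f"
  shows "\<exists>g. component g f \<and> s dvd strict1 t g"
  using assms(1,3)
proof (induction f rule: factor_induct)
  case (unit u)
  thus ?case using strict1_unit irreducible_not_unit[OF assms(2)] dvd_trans by blast
next
  case (factor p f)
  moreover have "p \<noteq> 0" using factor.hyps(1) by auto
  ultimately have "s dvd strict1 t p \<or> s dvd strict1 t f"
    using irreducible_dvd_mult[OF assms(2), of "strict1 t p" "strict1 t f"] by (simp add: strict1_mult)
  thus ?case using factor by (auto simp: component_def intro: dvd_mult)
qed

text \<open>
  A Jacobian argument for the absence of double components in a strict transform. An irreducible
  \<open>\<gamma>\<close> other than the line \<open>a = 0\<close>, whose strict transform is empty, is coprime to \<open>\<partial>\<^sub>b \<gamma>\<close>, because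
  differentiation lowers the order in \<open>b\<close> along \<open>a = 0\<close>. But a double component of the strict
  transform of \<open>\<gamma>\<close> would divide the pull-backs of both, since \<open>\<partial>\<^sub>w\<close> lifts \<open>e \<partial>\<^sub>b\<close>.
\<close>

lemma irreducible_coprime_der_vert:
  assumes \<gamma>: "irreducible \<gamma>" and "\<not> exc t dvd \<gamma>"
  shows "coprime_germs \<gamma> (der (vert t) \<gamma>)"
proof -
  have "\<not> \<gamma> dvd der (vert t) \<gamma>"
  proof (rule ccontr, unfold not_not)
    have main: False if g: "\<not> Xc dvd g" "g dvd dy g" "at0 g = 0" for g
    proof -
      define d where "d = (LEAST j. cf g 0 j \<noteq> 0)"
      have ex: "\<exists>j. cf g 0 j \<noteq> 0" using g by (auto simp: Xc_dvd_iff)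
      have d: "cf g 0 d \<noteq> 0" "\<And>j. j < d \<Longrightarrow> cf g 0 j = 0"
        using LeastI_ex[OF ex] unfolding d_def by (auto dest: not_less_Least)
      obtain c where c: "d = Suc c" using d(1) g(3) by (cases d) auto
      obtain k where k: "dy g = g * k" using g(2) by (rule dvdE)
      have "cf (dy g) 0 c = 0"
        unfolding k cf_mult using d(2) c by (auto intro!: sum.neutral)
      thus False using d(1) c by (simp del: of_nat_Suc)
    qed
    assume *: "\<gamma> dvd der (vert t) \<gamma>"
    have 0: "at0 \<gamma> = 0" using irreducible_not_unit[OF \<gamma>] by (simp add: dvd_1_iff_at0)
    show False
    proof (cases t)
      case (Slope c)
      thus ?thesis using main[of \<gamma>] assms * 0 by (simp add: der_def)
    next
      case Vertical
      have "dy (swap \<gamma>) = swap (dx \<gamma>)" by (rule hgerm_eqI) simp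
      moreover have "swap \<gamma> dvd swap (dx \<gamma>)" using * Vertical by (simp add: der_def)
      moreover have "\<not> Xc dvd swap \<gamma>"
        using assms(2) Vertical swap_dvd[of Xc "swap \<gamma>"] by auto
      ultimately show ?thesis using main[of "swap \<gamma>"] 0 by simp
    qed
  qed
  thus ?thesis
    unfolding coprime_germs_def using irreducible_associated \<gamma> dvd_trans by blast
qed

lemma squarefree_strict1:
  assumes "f \<noteq> 0" "squarefree f"
  shows "squarefree (strict1 t f)"
  using assms
proof (induction f rule: factor_induct)
  case (unit u)
  show ?case by (intro unit_imp_squarefree strict1_unit unit.hyps)
next
  case (factor \<gamma> f)
  have \<gamma>0: "\<gamma> \<noteq> 0" using factor.hyps by auto
  have "squarefree (strict1 t \<gamma>)"
  proof (rule squarefree_germI[OF strict1_nonzero[OF \<gamma>0]], rule notI)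
    fix p assume p: "irreducible p" "p\<^sup>2 dvd strict1 t \<gamma>"
    have "p dvd strict1 t \<gamma>" using p(2) unfolding power2_eq_square by (rule dvd_mult_left)
    hence not_exc: "\<not> p dvd exc t" using irreducible_dvd_strict1_imp_not_exc \<gamma>0 p by blast
    have "\<not> exc t dvd \<gamma>"
    proof
      assume "exc t dvd \<gamma>"
      hence "\<gamma> dvd exc t" by (rule irreducible_associated[OF irreducible_exc factor.hyps(1)])
      hence "strict1 t \<gamma> dvd 1" using strict1_dvd[of \<gamma> "exc t" t] by simp
      thus False using \<open>p dvd strict1 t \<gamma>\<close> irreducible_not_unit[OF p(1)] dvd_trans by blast
    qed
    then obtain n a b where n: "exc t ^ n = a * \<gamma> + b * der (vert t) \<gamma>"
      using exc_power_in_coprime_ideal[OF irreducible_coprime_der_vert[OF factor.hyps(1)]] by blast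
    obtain m where m: "total_transform t \<gamma> = exc t ^ m * strict1 t \<gamma>"
      by (rule total_transform_eq[OF \<gamma>0], rule that)
    obtain l where "strict1 t \<gamma> = p\<^sup>2 * l" using p(2) by (rule dvdE)
    hence k: "total_transform t \<gamma> = p * (p * (exc t ^ m * l))"
      unfolding m by (simp add: power2_eq_square mult_ac)
    have "exc t ^ Suc n = exc t * total_transform t (a * \<gamma> + b * der (vert t) \<gamma>)"
      unfolding n[symmetric] by (simp add: total_transform_power)
    also have "\<dots> = exc t * (total_transform t a * total_transform t \<gamma>)
        + total_transform t b * der (vert t) (total_transform t \<gamma>)"
      by (simp add: total_transform_add total_transform_mult der_vert_total_transform algebra_simps)
    also have "p dvd \<dots>" unfolding k der_mult by simp
    finally show False using irreducible_dvd_power[OF p(1)] not_exc by blast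
  qed
  moreover have "squarefree (strict1 t f)"
    using factor squarefree_mono[of f "\<gamma> * f"] by simp
  moreover have "coprime_germs (strict1 t \<gamma>) (strict1 t f)"
    using squarefree_mult_imp_coprime[OF factor.prems] \<gamma>0 factor.hyps by (intro coprime_strict1)
  ultimately show ?case
    using \<gamma>0 factor.hyps by (simp add: strict1_mult strict1_nonzero squarefree_coprime_mult)
qed


section \<open>Blowing up nonsingular germs\<close>

lemma transverse_exc_iff: "transverse s (exc t) \<longleftrightarrow> at0 (der (vert t) s) \<noteq> 0"
  by (cases t) (simp_all add: transverse_def der_def cf_1)

text \<open>
  The values of \<open>g\<close> and \<open>h\<close> at the origin are the components of the differential of \<open>f\<close> in the
  coordinates \<open>a\<close> and \<open>b\<close>; after the blow-up they become the value and the \<open>w\<close>-derivative of the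
  strict transform.
\<close>

lemma at0_gradient_decomposed:
  assumes "f = exc t * g + axis t * h"
  shows "at0 (dx f) = at0 g * at0 (dx (exc t)) + at0 h * at0 (dx (axis t))"
    and "at0 (dy f) = at0 g * at0 (dy (exc t)) + at0 h * at0 (dy (axis t))"
  unfolding assms dx_add dx_mult dy_add dy_mult cf_add at0_mult at0_exc at0_axis by simp_all

lemma strict1_decomposed:
  assumes f: "f = exc t * g + axis t * h" and gh: "at0 g \<noteq> 0 \<or> at0 h \<noteq> 0"
  shows "strict1 t f = total_transform t g + fibre t * total_transform t h"
    and "at0 (strict1 t f) = at0 g" and "at0 (der (vert t) (strict1 t f)) = at0 h"
proof -
  let ?s = "total_transform t g + fibre t * total_transform t h"
  have s0: "at0 ?s = at0 g" by simp
  have s1: "at0 (der (vert t) ?s) = at0 h"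
    by (simp add: der_add der_mult der_vert_total_transform)
  have "total_transform t f = exc t ^ 1 * ?s"
    by (simp add: f total_transform_add total_transform_mult algebra_simps)
  moreover have "\<not> exc t dvd ?s"
  proof
    assume "exc t dvd ?s"
    then obtain k where k: "?s = exc t * k" by (rule dvdE)
    hence "at0 ?s = 0" "at0 (der (vert t) ?s) = 0" by simp_all
    thus False using gh s0 s1 by simp
  qed
  ultimately show "strict1 t f = ?s" by (rule strict1_eqI)
  thus "at0 (strict1 t f) = at0 g" "at0 (der (vert t) (strict1 t f)) = at0 h" using s0 s1 by simp_all
qed

text \<open>
  If the strict transform passes through the point, \<open>f\<close> is tangent to the direction \<open>t\<close>: its
  differential is a multiple of that of the line \<open>axis t\<close>.
\<close>

lemma nonsingular_strict1:
  assumes "f \<noteq> 0" "nonsingular f" "at0 (strict1 t f) = 0"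
  shows "nonsingular (strict1 t f)" "transverse (strict1 t f) (exc t)"
    and "\<exists>k. k \<noteq> 0 \<and> at0 (dx f) = k * at0 (dx (axis t)) \<and> at0 (dy f) = k * at0 (dy (axis t))"
proof -
  have f0: "at0 f = 0" "at0 (dx f) \<noteq> 0 \<or> at0 (dy f) \<noteq> 0"
    using assms nonsingular_iff_gradient by blast+
  obtain g h where f: "f = exc t * g + axis t * h" by (rule axis_decompose[OF f0(1), of t], rule that)
  have gh: "at0 g \<noteq> 0 \<or> at0 h \<noteq> 0"
    using f0(2) at0_gradient_decomposed[OF f] by auto
  note s = strict1_decomposed[OF f gh]
  have "at0 g = 0" "at0 h \<noteq> 0" using s(2) assms(3) gh by auto
  hence d: "at0 (der (vert t) (strict1 t f)) \<noteq> 0" using s(3) by simp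
  thus "transverse (strict1 t f) (exc t)" by (simp add: transverse_exc_iff)
  have "at0 (dx (strict1 t f)) \<noteq> 0 \<or> at0 (dy (strict1 t f)) \<noteq> 0"
    using d by (auto simp: der_def simp del: cf_dx cf_dy)
  thus "nonsingular (strict1 t f)"
    using assms strict1_nonzero nonsingular_iff_gradient by blast
  show "\<exists>k. k \<noteq> 0 \<and> at0 (dx f) = k * at0 (dx (axis t)) \<and> at0 (dy f) = k * at0 (dy (axis t))"
    using at0_gradient_decomposed[OF f] \<open>at0 g = 0\<close> \<open>at0 h \<noteq> 0\<close>
    by (intro exI[of _ "at0 h"]) simp
qed

lemma transverse_separated:
  assumes "f \<noteq> 0" "nonsingular f" "at0 (strict1 t f) = 0"
    and "g \<noteq> 0" "nonsingular g" "at0 (strict1 t g) = 0"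
  shows "\<not> transverse f g"
proof -
  obtain k where k: "at0 (dx f) = k * at0 (dx (axis t))" "at0 (dy f) = k * at0 (dy (axis t))"
    using nonsingular_strict1(3)[OF assms(1-3)] by blast
  obtain l where l: "at0 (dx g) = l * at0 (dx (axis t))" "at0 (dy g) = l * at0 (dy (axis t))"
    using nonsingular_strict1(3)[OF assms(4-6)] by blast
  show ?thesis unfolding transverse_def k l by simp
qed

lemma transverse_same_direction:
  assumes "f \<noteq> 0" "nonsingular f" "at0 (strict1 t f) = 0"
    and "g \<noteq> 0" "nonsingular g" "at0 (strict1 t g) = 0" "transverse g h"
  shows "transverse f h"
proof -
  obtain k where k: "k \<noteq> 0" "at0 (dx f) = k * at0 (dx (axis t))" "at0 (dy f) = k * at0 (dy (axis t))"
    using nonsingular_strict1(3)[OF assms(1-3)] by blast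
  obtain l where l: "l \<noteq> 0" "at0 (dx g) = l * at0 (dx (axis t))" "at0 (dy g) = l * at0 (dy (axis t))"
    using nonsingular_strict1(3)[OF assms(4-6)] by blast
  show ?thesis
    using assms(7) k(1) l(1) unfolding transverse_def k l mult.assoc right_diff_distrib[symmetric] by simp
qed

lemma nonsingular_unique_direction:
  assumes "f \<noteq> 0" "nonsingular f" "at0 (strict1 t f) = 0" "at0 (strict1 t' f) = 0"
  shows "t = t'"
proof -
  obtain k where k: "k \<noteq> 0" "at0 (dx f) = k * at0 (dx (axis t))" "at0 (dy f) = k * at0 (dy (axis t))"
    using nonsingular_strict1(3)[OF assms(1-3)] by blast
  obtain l where l: "l \<noteq> 0" "at0 (dx f) = l * at0 (dx (axis t'))" "at0 (dy f) = l * at0 (dy (axis t'))"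
    using nonsingular_strict1(3)[OF assms(1,2,4)] by blast
  show ?thesis
    using k(1) l(1) trans[OF k(2)[symmetric] l(2)] trans[OF k(3)[symmetric] l(3)]
    by (cases t; cases t') (auto simp: cf_Xc cf_Yc)
qed

text \<open>
  Since \<open>a\<close> and \<open>e\<close> are the same element of the ring, pulling back a germ that depends on \<open>a\<close> alone
  does not change it.
\<close>

lemma total_transform_of_base_function:
  assumes "der (vert t) r = 0"
  shows "total_transform t r = r"
proof -
  have "vanishes (total_transform t r - r) n" for n
    using assms
  proof (induction n arbitrary: r)
    case (Suc n)
    have "exc t dvd r - const (at0 r)"
    proof (cases t)
      case (Slope c)
      hence "dy r = 0" using Suc.prems by (simp add: der_def)
      hence "cf r 0 (Suc j) = 0" for j using cf_dy[of r 0 j] by (simp del: of_nat_Suc)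
      hence "cf r 0 j = 0" if "j \<noteq> 0" for j using that by (cases j) auto
      thus ?thesis using Slope by (auto simp: Xc_dvd_iff cf_const)
    next
      case Vertical
      hence "dx r = 0" using Suc.prems by (simp add: der_def)
      hence "cf r (Suc j) 0 = 0" for j using cf_dx[of r j 0] by (simp del: of_nat_Suc)
      hence "cf r j 0 = 0" if "j \<noteq> 0" for j using that by (cases j) auto
      thus ?thesis using Vertical by (auto simp: Yc_dvd_iff cf_const)
    qed
    then obtain r1 where "r - const (at0 r) = exc t * r1" by (rule dvdE)
    hence r: "r = const (at0 r) + exc t * r1" by (simp add: algebra_simps)
    have "der (vert t) r = exc t * der (vert t) r1"
      by (subst r) (simp add: der_add der_mult)
    hence "der (vert t) r1 = 0" using Suc.prems by simp
    hence "vanishes (total_transform t r1 - r1) n" by (rule Suc.IH)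
    hence "vanishes (exc t * (total_transform t r1 - r1)) (1 + n)"
      by (intro vanishes_mult) (simp_all add: vanishes_Suc_0)
    also have "exc t * (total_transform t r1 - r1) = total_transform t r - r"
      by (subst (1 2) r) (simp add: total_transform_add total_transform_mult algebra_simps)
    finally show ?case by simp
  qed simp
  hence "total_transform t r - r = 0" by (rule vanishes_all_imp_0)
  thus ?thesis by simp
qed

text \<open>
  Weierstrass division of \<open>w\<close> by \<open>s\<close>, which has order \<open>1\<close> in \<open>w\<close>: the remainder \<open>r\<close> is a function
  of \<open>e\<close>, and \<open>s = 0\<close> is the graph \<open>w = r(e)\<close>.
\<close>

lemma implicit_function:
  assumes "at0 s = 0" "transverse s (exc t)"
  obtains q r where "fibre t = q * s + r" "der (vert t) r = 0" "at0 r = 0" "at0 q \<noteq> 0"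
proof -
  have "\<exists>q r. fibre t = q * s + r \<and> der (vert t) r = 0"
  proof (cases t)
    case (Slope c)
    have "cf s 0 1 \<noteq> 0" using assms(2)[unfolded transverse_exc_iff] Slope by (simp add: der_def)
    then obtain q r where "Yc = q * s + r" "\<And>i j. j \<ge> 1 \<Longrightarrow> cf r i j = 0"
      using Weierstrass_division[of s 1 Yc] assms(1) by (metis less_one)
    moreover from this have "dy r = 0" by (intro hgerm_eqI) simp
    ultimately show ?thesis using Slope by (auto simp: der_def)
  next
    case Vertical
    have "cf (swap s) 0 1 \<noteq> 0" using assms(2)[unfolded transverse_exc_iff] Vertical by (simp add: der_def)
    then obtain q r where qr: "Yc = q * swap s + r" "\<And>i j. j \<ge> 1 \<Longrightarrow> cf r i j = 0"
      using Weierstrass_division[of "swap s" 1 Yc] assms(1) by (metis cf_swap less_one)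
    have "Xc = swap q * s + swap r"
      using arg_cong[OF qr(1), of swap] by (metis swap_Xc swap_add swap_mult swap_swap)
    moreover have "dx (swap r) = 0" using qr(2) by (intro hgerm_eqI) simp
    ultimately show ?thesis using Vertical by (auto simp: der_def)
  qed
  then obtain q r where qr: "fibre t = q * s + r" "der (vert t) r = 0" by blast
  have "at0 (fibre t) = at0 (q * s + r)" by (simp only: qr(1))
  hence "at0 r = 0" using assms(1) by simp
  moreover have "at0 (der (vert t) (fibre t)) = at0 (der (vert t) (q * s + r))" by (simp only: qr(1))
  hence "at0 q \<noteq> 0" using assms(1) by (auto simp: der_add der_mult qr(2) cf_1)
  ultimately show ?thesis using qr that by blast
qed

text \<open>
  A nonsingular germ transverse to the exceptional divisor is the graph \<open>w = r(e)\<close> of a function,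
  hence a component of the strict transform of the nonsingular germ \<open>b = a r(a)\<close>.
\<close>

lemma blow_down_nonsingular:
  assumes \<gamma>: "irreducible \<gamma>" and s: "s \<noteq> 0" "nonsingular s" "s dvd strict1 t \<gamma>" "transverse s (exc t)"
  shows "nonsingular \<gamma>"
proof -
  have s0: "at0 s = 0" using s nonsingular_iff by blast
  obtain q r where qr: "fibre t = q * s + r" "der (vert t) r = 0" "at0 r = 0" "at0 q \<noteq> 0"
    by (rule implicit_function[OF s0 s(4)], rule that)
  define S where "S = exc t * (- r) + axis t * 1"
  have 1: "at0 (- r) \<noteq> 0 \<or> at0 1 \<noteq> 0" by (simp add: cf_1)
  have "total_transform t (- r) = - r"
  proof (rule total_transform_of_base_function)
    have "der (vert t) (- r) + der (vert t) r = der (vert t) (const 0)"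
      unfolding der_add[symmetric] by (simp add: const_0)
    thus "der (vert t) (- r) = 0" using qr(2) by simp
  qed
  hence "strict1 t S = q * s"
    using strict1_decomposed(1)[OF S_def 1] qr(1) by simp
  hence sS: "s dvd strict1 t S" by simp
  have S0: "at0 S = 0" by (simp add: S_def)
  have grad: "at0 (dx S) \<noteq> 0 \<or> at0 (dy S) \<noteq> 0"
    unfolding at0_gradient_decomposed[OF S_def] using qr(3)
    by (cases t) (auto simp: cf_1 cf_Xc cf_Yc)
  have S: "S \<noteq> 0" using grad by auto
  have nsS: "nonsingular S" using S0 grad S nonsingular_iff_gradient by blast
  have irrS: "irreducible S" using S nsS by (rule nonsingular_imp_irreducible)
  have irrs: "irreducible s" using s by (intro nonsingular_imp_irreducible)
  have \<gamma>0: "\<gamma> \<noteq> 0" using \<gamma> by auto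
  have "\<not> coprime_germs (strict1 t \<gamma>) (strict1 t S)"
    using irrs s(3) sS by (auto simp: coprime_germs_def)
  hence "\<not> coprime_germs \<gamma> S" using coprime_strict1 \<gamma>0 S by blast
  then obtain p where p: "irreducible p" "p dvd \<gamma>" "p dvd S" by (auto simp: coprime_germs_def)
  hence "\<gamma> dvd S" using irreducible_associated[OF p(1) \<gamma>] dvd_trans by blast
  moreover have "at0 \<gamma> = 0" using irreducible_not_unit[OF \<gamma>] by (simp add: dvd_1_iff_at0)
  ultimately show ?thesis using nonsingular_dvd[OF S nsS] by blast
qed


section \<open>Common zeros of germs\<close>

text \<open>
  Values of a germ are computed by freezing \<open>x\<close>: the germ \<open>f\<close> becomes the power series
  \<open>slice f x\<close> in \<open>y\<close>, whose coefficients are the values at \<open>x\<close> of the power series \<open>row f j\<close>. This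
  reduces multiplicativity of evaluation and holomorphy in \<open>y\<close> to one-variable power series.
\<close>

definition row :: "hgerm \<Rightarrow> nat \<Rightarrow> complex fps" where
  "row f j = Abs_fps (\<lambda>i. cf f i j)"

definition slice :: "hgerm \<Rightarrow> complex \<Rightarrow> complex fps" where
  "slice f x = Abs_fps (\<lambda>j. eval_fps (row f j) x)"

definition expands_at :: "hgerm \<Rightarrow> complex \<Rightarrow> complex \<Rightarrow> bool" where
  "expands_at f x y \<longleftrightarrow> ev f (x, y) = eval_fps (slice f x) y \<and>
     (\<forall>j. ereal (norm x) < fps_conv_radius (row f j)) \<and> ereal (norm y) < fps_conv_radius (slice f x)"

lemma fps_conv_radius_geI:
  assumes "\<And>n. norm (fps_nth (p :: complex fps) n) \<le> C * R ^ n" "R > 0"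
  shows "fps_conv_radius p \<ge> ereal (1 / R)"
  unfolding fps_conv_radius_def
proof (rule conv_radius_geI_ex')
  fix r :: real assume r: "r > 0" "ereal r < ereal (1 / R)"
  hence "R * r < 1" using assms(2) by (simp add: field_simps)
  moreover have "norm (fps_nth p n * of_real r ^ n) \<le> C * (R * r) ^ n" for n
    using mult_right_mono[OF assms(1)[of n], of "r ^ n"] r
    by (simp add: norm_mult norm_power power_mult_distrib mult_ac)
  ultimately show "summable (\<lambda>n. fps_nth p n * of_real r ^ n)"
    using r assms(2)
    by (intro summable_norm_cancel[OF summable_comparison_test'[OF summable_mult[OF summable_geometric[of "R * r"]], of 0]])
       auto
qed

lemma norm_eval_fps_le:
  assumes "\<And>n. norm (fps_nth (p :: complex fps) n) \<le> C * R ^ n" "R > 0" "C \<ge> 0" "norm x \<le> 1 / (2 * R)"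
  shows "norm (eval_fps p x) \<le> 2 * C"
proof -
  have le: "norm (fps_nth p n * x ^ n) \<le> C * (1 / 2) ^ n" for n
  proof -
    have "norm (fps_nth p n * x ^ n) \<le> (C * R ^ n) * (1 / (2 * R)) ^ n"
      unfolding norm_mult norm_power using assms by (intro mult_mono power_mono) auto
    also have "\<dots> = C * (1 / 2) ^ n" using assms(2) by (simp add: power_divide power_mult_distrib)
    finally show ?thesis .
  qed
  have s: "summable (\<lambda>n. C * (1 / 2 :: real) ^ n)"
    by (intro summable_mult summable_geometric) auto
  have "norm (eval_fps p x) \<le> (\<Sum>n. norm (fps_nth p n * x ^ n))"
    unfolding eval_fps_def
    by (intro summable_norm summable_comparison_test'[OF s, of 0]) (use le in auto)
  also have "\<dots> \<le> (\<Sum>n. C * (1 / 2) ^ n)"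
    by (intro suminf_le le s summable_comparison_test'[OF s, of 0]) (use le in auto)
  also have "\<dots> = 2 * C"
    using suminf_mult[OF summable_geometric[of "1 / 2 :: real"], of C] suminf_geometric[of "1 / 2 :: real"] by simp
  finally show ?thesis .
qed

lemma infsum_eq_eval_fps:
  assumes "(\<lambda>n. fps_nth (p :: complex fps) n * x ^ n) summable_on UNIV"
  shows "(\<Sum>\<^sub>\<infinity>n. fps_nth p n * x ^ n) = eval_fps p x"
  using has_sum_imp_sums[OF has_sum_infsum[OF assms]] by (simp add: eval_fps_def sums_iff)

lemma summable_on_dominated_UNIV:
  fixes t :: "nat \<times> nat \<Rightarrow> complex"
  assumes "\<And>i j. norm (t (i, j)) \<le> C * ((1 / 2) ^ i * (1 / 2) ^ j)"
  shows "t summable_on UNIV"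
proof -
  have geo: "(\<lambda>i. (1 / 2 :: real) ^ i) summable_on UNIV"
    using norm_summable_imp_summable_on[of "\<lambda>i. (1 / 2 :: real) ^ i"] summable_geometric[of "1 / 2 :: real"]
    by simp
  have "(\<lambda>(i, j). (1 / 2 :: real) ^ i * (1 / 2) ^ j) summable_on (UNIV \<times> UNIV)"
  proof (rule summable_on_SigmaI)
    show "((\<lambda>j. case (i, j) of (i, j) \<Rightarrow> (1 / 2 :: real) ^ i * (1 / 2) ^ j)
        has_sum (1 / 2) ^ i * (\<Sum>\<^sub>\<infinity>j. (1 / 2) ^ j)) UNIV" for i
      unfolding prod.case by (rule has_sum_cmult_right[OF has_sum_infsum[OF geo]])
    show "(\<lambda>i. (1 / 2 :: real) ^ i * (\<Sum>\<^sub>\<infinity>j. (1 / 2) ^ j)) summable_on UNIV"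
      by (rule summable_on_cmult_left[OF geo])
  qed auto
  hence "(\<lambda>z. C * (case z of (i, j) \<Rightarrow> (1 / 2 :: real) ^ i * (1 / 2) ^ j)) summable_on UNIV"
    by (intro summable_on_cmult_right) simp
  thus ?thesis
  proof (rule abs_summable_summable[OF Infinite_Sum.abs_summable_on_comparison_test'])
    show "norm (t z) \<le> C * (case z of (i, j) \<Rightarrow> (1 / 2 :: real) ^ i * (1 / 2) ^ j)" for z
      by (cases z) (simp only: prod.case assms)
  qed
qed

lemma eventually_nhds_0_I:
  assumes "r > 0" "\<And>(x :: complex) (y :: complex). norm x < r \<Longrightarrow> norm y < r \<Longrightarrow> P (x, y)"
  shows "\<forall>\<^sub>F z in nhds 0. P z"
  unfolding eventually_nhds_metric
proof (intro exI[of _ r] conjI allI impI)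
  fix z :: "complex \<times> complex" assume "dist z 0 < r"
  moreover have "norm (fst z) \<le> norm z" "norm (snd z) \<le> norm z"
    using norm_fst_le[of "fst z" "snd z"] norm_snd_le[of "snd z" "fst z"] by simp_all
  ultimately show "P z" using assms(2)[of "fst z" "snd z"] by (simp add: dist_norm)
qed (rule assms)

lemma eventually_nhds_0_D:
  assumes "\<forall>\<^sub>F z :: complex \<times> complex in nhds 0. P z"
  obtains r where "r > 0" "\<And>x y. norm x < r \<Longrightarrow> norm y < r \<Longrightarrow> P (x, y)"
proof -
  obtain d where d: "d > 0" "\<And>z :: complex \<times> complex. dist z 0 < d \<Longrightarrow> P z"
    using assms unfolding eventually_nhds_metric by blast
  show ?thesis
  proof (rule that[of "d / 2"])
    fix x y :: complex assume "norm x < d / 2" "norm y < d / 2"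
    hence "norm x + norm y < d" by simp
    moreover have "norm (x, y) \<le> norm x + norm y"
      using norm_Pair_le by (simp add: norm_Pair sqrt_sum_squares_le_sum)
    ultimately show "P (x, y)" by (intro d) (simp add: dist_norm)
  qed (use d in auto)
qed

lemma expands_near_0:
  obtains M where "\<forall>\<^sub>F z in nhds 0. expands_at f (fst z) (snd z) \<and> norm (ev f z) \<le> M"
proof -
  obtain C R where CR: "C \<ge> 1" "R \<ge> 1" "\<And>i j. norm (cf f i j) \<le> C * R ^ (i + j)"
    by (rule cf_boundE[of f], rule that)
  define r where "r = 1 / (2 * R)"
  have r: "r > 0" "r < 1 / R" using CR by (auto simp: r_def field_simps)
  have main: "expands_at f x y \<and> norm (ev f (x, y)) \<le> 2 * (2 * C)" if xy: "norm x < r" "norm y < r" for x y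
  proof -
    have row_bd: "norm (fps_nth (row f j) i) \<le> (C * R ^ j) * R ^ i" for i j
      using CR(3)[of i j] by (simp add: row_def power_add mult_ac)
    have row_conv: "ereal (norm x) < fps_conv_radius (row f j)" for j
    proof (rule less_le_trans)
      show "ereal (norm x) < ereal (1 / R)" using xy r by (subst less_ereal.simps(1), linarith)
      show "ereal (1 / R) \<le> fps_conv_radius (row f j)"
        by (rule fps_conv_radius_geI[OF row_bd]) (use CR in simp)
    qed
    have slice_bd: "norm (fps_nth (slice f x) j) \<le> (2 * C) * R ^ j" for j
    proof -
      have "norm (eval_fps (row f j) x) \<le> 2 * (C * R ^ j)"
        by (rule norm_eval_fps_le[OF row_bd]) (use CR xy in \<open>auto simp: r_def\<close>)
      thus ?thesis by (simp add: slice_def mult.assoc)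
    qed
    have slice_conv: "ereal (norm y) < fps_conv_radius (slice f x)"
    proof (rule less_le_trans)
      show "ereal (norm y) < ereal (1 / R)" using xy r by (subst less_ereal.simps(1), linarith)
      show "ereal (1 / R) \<le> fps_conv_radius (slice f x)"
        by (rule fps_conv_radius_geI[OF slice_bd]) (use CR in simp)
    qed
    define t where "t = (\<lambda>i j. cf f i j * x ^ i * y ^ j)"
    have t_le: "norm (t i j) \<le> C * ((1 / 2) ^ i * (1 / 2) ^ j)" for i j
    proof -
      have "norm (t i j) = norm (cf f i j) * (norm x ^ i * norm y ^ j)"
        by (simp add: t_def norm_mult norm_power mult.assoc)
      also have "\<dots> \<le> (C * R ^ (i + j)) * (r ^ i * r ^ j)"
        using xy CR(1,2) r by (intro mult_mono CR(3) power_mono) auto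
      also have "\<dots> = C * ((R * r) ^ i * (R * r) ^ j)"
        by (simp add: power_add power_mult_distrib mult_ac)
      also have "R * r = 1 / 2" using CR by (simp add: r_def)
      finally show ?thesis .
    qed
    have sum_t: "(\<lambda>(i, j). t i j) summable_on (UNIV \<times> UNIV)"
      using summable_on_dominated_UNIV[of "\<lambda>(i, j). t i j" C] t_le by simp
    have inner: "(\<Sum>\<^sub>\<infinity>i. t i j) = eval_fps (row f j) x * y ^ j" for j
    proof -
      have "(\<lambda>i. fps_nth (row f j) i * x ^ i) summable_on UNIV"
        using norm_summable_imp_summable_on[OF norm_summable_fps[OF row_conv]] .
      thus ?thesis
        by (simp add: t_def row_def infsum_cmult_left infsum_eq_eval_fps[symmetric])
    qed
    have "ev f (x, y) = (\<Sum>\<^sub>\<infinity>(i, j)\<in>UNIV \<times> UNIV. t i j)"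
      by (simp add: ev_def t_def)
    also have "\<dots> = (\<Sum>\<^sub>\<infinity>j. \<Sum>\<^sub>\<infinity>i. t i j)"
      using infsum_Sigma'_banach[OF sum_t] infsum_swap_banach[of t UNIV UNIV] sum_t by simp
    also have "\<dots> = (\<Sum>\<^sub>\<infinity>j. fps_nth (slice f x) j * y ^ j)"
      by (simp add: inner slice_def)
    also have "\<dots> = eval_fps (slice f x) y"
      by (rule infsum_eq_eval_fps[OF norm_summable_imp_summable_on[OF norm_summable_fps[OF slice_conv]]])
    finally have "ev f (x, y) = eval_fps (slice f x) y" .
    moreover from this have "norm (ev f (x, y)) \<le> 2 * (2 * C)"
      using norm_eval_fps_le[OF slice_bd, of y] CR xy by (simp add: r_def)
    ultimately show ?thesis using row_conv slice_conv by (simp add: expands_at_def)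
  qed
  have "\<forall>\<^sub>F z in nhds 0. expands_at f (fst z) (snd z) \<and> norm (ev f z) \<le> 2 * (2 * C)"
    by (rule eventually_nhds_0_I[OF r(1)]) (use main in auto)
  thus ?thesis by (rule that)
qed

lemma eventually_expands: "\<forall>\<^sub>F z in nhds 0. expands_at f (fst z) (snd z)"
  by (rule expands_near_0[of f]) (auto elim: eventually_mono)

lemma ev_add: "\<forall>\<^sub>F z in nhds 0. ev (f + g) z = ev f z + ev g z"
  using eventually_expands[of f] eventually_expands[of g] eventually_expands[of "f + g"]
proof eventually_elim
  case (elim z)
  have "row (f + g) j = row f j + row g j" for j by (rule fps_ext) (simp add: row_def)
  hence "slice (f + g) (fst z) = slice f (fst z) + slice g (fst z)"
    using elim by (intro fps_ext) (simp add: slice_def eval_fps_add expands_at_def)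
  thus ?case using elim by (cases z) (simp add: expands_at_def eval_fps_add)
qed

lemma ev_mult: "\<forall>\<^sub>F z in nhds 0. ev (f * g) z = ev f z * ev g z"
  using eventually_expands[of f] eventually_expands[of g] eventually_expands[of "f * g"]
proof eventually_elim
  case (elim z)
  let ?x = "fst z"
  have x: "ereal (norm ?x) < fps_conv_radius (row f j)" "ereal (norm ?x) < fps_conv_radius (row g j)" for j
    using elim by (auto simp: expands_at_def)
  have row: "row (f * g) j = (\<Sum>l\<le>j. row f l * row g (j - l))" for j
    by (rule fps_ext) (simp add: row_def fps_sum_nth fps_mult_nth cf_mult atLeast0AtMost, rule sum.swap)
  have eval_sum: "eval_fps (\<Sum>l\<in>A. row f l * row g (j - l)) ?x = (\<Sum>l\<in>A. eval_fps (row f l) ?x * eval_fps (row g (j - l)) ?x)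
      \<and> ereal (norm ?x) < fps_conv_radius (\<Sum>l\<in>A. row f l * row g (j - l))" if "finite A" for A j
    using that
  proof (induction A)
    case (insert l A)
    have prod: "ereal (norm ?x) < fps_conv_radius (row f l * row g (j - l))"
      by (rule order.strict_trans2[OF _ fps_conv_radius_mult]) (simp add: x)
    moreover have "ereal (norm ?x) < fps_conv_radius (row f l * row g (j - l) + (\<Sum>l\<in>A. row f l * row g (j - l)))"
      by (rule order.strict_trans2[OF _ fps_conv_radius_add]) (use insert prod in simp)
    ultimately show ?case using insert by (simp add: eval_fps_add eval_fps_mult x)
  qed simp
  have "slice (f * g) ?x = slice f ?x * slice g ?x"
    by (rule fps_ext) (simp add: slice_def fps_mult_nth row eval_sum atLeast0AtMost)
  thus ?case using elim by (cases z) (simp add: expands_at_def eval_fps_mult)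
qed

lemma ev_Xc: "\<forall>\<^sub>F z in nhds 0. ev Xc z = fst z"
  using eventually_expands[of Xc]
proof eventually_elim
  case (elim z)
  have "row Xc j = (if j = 0 then fps_X else 0)" for j
    by (rule fps_ext) (auto simp: row_def cf_Xc)
  hence "slice Xc (fst z) = fps_const (fst z)"
    by (intro fps_ext) (simp add: slice_def)
  thus ?case using elim by (cases z) (simp add: expands_at_def)
qed

lemma ev_Yc: "\<forall>\<^sub>F z in nhds 0. ev Yc z = snd z"
  using eventually_expands[of Yc]
proof eventually_elim
  case (elim z)
  have "row Yc j = (if j = 1 then 1 else 0)" for j
    by (rule fps_ext) (auto simp: row_def cf_Yc)
  hence "slice Yc (fst z) = fps_X"
    by (intro fps_ext) (simp add: slice_def)
  thus ?case using elim by (cases z) (simp add: expands_at_def)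
qed

lemma ev_1: "\<forall>\<^sub>F z in nhds 0. ev 1 z = 1"
  using eventually_expands[of 1]
proof eventually_elim
  case (elim z)
  have "row 1 j = (if j = 0 then 1 else 0)" for j
    by (rule fps_ext) (auto simp: row_def cf_1)
  hence "slice 1 (fst z) = 1"
    by (intro fps_ext) (simp add: slice_def)
  thus ?case using elim by (cases z) (simp add: expands_at_def)
qed

lemma ev_power: "\<forall>\<^sub>F z in nhds 0. ev (f ^ n) z = ev f z ^ n"
proof (induction n)
  case 0
  show ?case using ev_1 by simp
next
  case (Suc n)
  with ev_mult[of f "f ^ n"] show ?case by eventually_elim simp
qed

lemma at0_eq_ev: "ev f 0 = at0 f"
proof -
  have "expands_at f 0 0" using eventually_nhds_x_imp_x[OF eventually_expands[of f]] by simp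
  thus ?thesis by (simp add: expands_at_def eval_fps_at_0 slice_def row_def zero_prod_def)
qed

theorem coprime_imp_meet_in_origin:
  assumes "coprime_germs f g"
  shows "meet_in_origin f g"
proof -
  have *: "\<forall>\<^sub>F z in nhds 0. ev f z = 0 \<and> ev g z = 0 \<longrightarrow> ev h z = 0"
    if "h ^ n = a * f + b * g" for h n a b
    using ev_power[of h n] ev_mult[of a f] ev_mult[of b g] ev_add[of "a * f" "b * g"]
    unfolding that[symmetric]
  proof eventually_elim
    case (elim z)
    thus ?case by (cases "ev h z = 0") auto
  qed
  obtain n a b where X: "Xc ^ n = a * f + b * g" using Xc_power_in_coprime_ideal[OF assms] by blast
  obtain m c d where Y: "Yc ^ m = c * f + d * g" using Yc_power_in_coprime_ideal[OF assms] by blast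
  show ?thesis
    unfolding meet_in_origin_def using *[OF X] *[OF Y] ev_Xc ev_Yc
    by eventually_elim (auto simp: prod_eq_iff)
qed

text \<open>
  A germ \<open>p\<close> vanishing at the origin has other zeros nearby. Otherwise \<open>1/p(x, \<cdot>)\<close> is holomorphic on
  a fixed disc for every small \<open>x \<noteq> 0\<close>; it is bounded on the boundary of the disc, uniformly in \<open>x\<close>,
  since \<open>p(0, \<cdot>)\<close> has no zero there. By the maximum principle it is then bounded at the centre,
  whereas \<open>p(x, 0)\<close> tends to \<open>0\<close>.
\<close>

lemma zeros_not_isolated:
  assumes p0: "at0 p = 0"
  shows "\<not> (\<forall>\<^sub>F z in nhds 0. ev p z = 0 \<longrightarrow> z = 0)"
proof
  assume iso: "\<forall>\<^sub>F z in nhds 0. ev p z = 0 \<longrightarrow> z = 0"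
  obtain C R where CR: "C \<ge> 1" "R \<ge> 1" "\<And>i j. norm (cf p i j) \<le> C * R ^ (i + j)"
    by (rule cf_boundE[of p], rule that)
  have "norm (if i = 0 then cf p i j else 0) \<le> C * R ^ (i + j)" for i j
    using CR(1,2) CR(3)[of i j] by auto
  then obtain p1 where p1: "\<And>i j. cf p1 i j = (if i = 0 then cf p i j else 0)"
    using germ_of_coeffs[of "\<lambda>i j. if i = 0 then cf p i j else 0"] by metis
  have "Xc dvd p - p1" by (simp add: Xc_dvd_iff p1)
  then obtain k where "p - p1 = Xc * k" by (rule dvdE)
  hence p: "p = p1 + Xc * k" by (simp add: algebra_simps)
  obtain M where M: "\<forall>\<^sub>F z in nhds 0. expands_at k (fst z) (snd z) \<and> norm (ev k z) \<le> M"
    by (rule expands_near_0[of k], rule that)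
  have "\<forall>\<^sub>F z in nhds 0. (ev p z = 0 \<longrightarrow> z = 0) \<and> expands_at p (fst z) (snd z) \<and>
      expands_at p1 (fst z) (snd z) \<and> norm (ev k z) \<le> M \<and> ev p z = ev p1 z + fst z * ev k z"
    using iso eventually_expands[of p] eventually_expands[of p1] M ev_add[of p1 "Xc * k"] ev_mult[of Xc k] ev_Xc
    unfolding p[symmetric] by eventually_elim auto
  then obtain r where r: "r > 0" and
    near: "\<And>x y. norm x < r \<Longrightarrow> norm y < r \<Longrightarrow> (ev p (x, y) = 0 \<longrightarrow> (x, y) = 0) \<and> expands_at p x y \<and>
      expands_at p1 x y \<and> norm (ev k (x, y)) \<le> M \<and> ev p (x, y) = ev p1 (x, y) + x * ev k (x, y)"
    by (rule eventually_nhds_0_D) auto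
  have M0: "M \<ge> 0" using near[of 0 0] r norm_ge_zero order_trans by (metis norm_zero)
  have row_p1: "slice p1 x = slice p1 0" for x
  proof -
    have "row p1 j = fps_const (cf p 0 j)" for j
      by (rule fps_ext) (auto simp: row_def p1)
    thus ?thesis by (simp add: slice_def)
  qed
  have p1_ev: "ev p1 (x, y) = ev p (0, y)" if "norm x < r" "norm y < r" for x y
  proof -
    have "ev p1 (x, y) = ev p1 (0, y)"
      using near[OF that] near[of 0 y] that r by (simp only: expands_at_def row_p1[of x] norm_zero)
    thus ?thesis using near[of 0 y] that r by simp
  qed
  have diff: "norm (ev p (x, y) - ev p (0, y)) \<le> norm x * M" if "norm x < r" "norm y < r" for x y
    using near[OF that] p1_ev[OF that] by (simp add: norm_mult mult_left_mono)
  define \<rho> where "\<rho> = r / 2"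
  have \<rho>: "\<rho> > 0" "\<rho> < r" using r by (auto simp: \<rho>_def)
  have ev_p: "ev p (x, y) = eval_fps (slice p x) y" if "norm x < r" "norm y < r" for x y
    using near[OF that] by (simp add: expands_at_def)
  have in_eball: "cball (0 :: complex) \<rho> \<subseteq> eball 0 (fps_conv_radius (slice p x))" if "norm x < r" for x
  proof
    fix y :: complex assume "y \<in> cball 0 \<rho>"
    hence "norm y < r" using \<rho> by simp
    thus "y \<in> eball 0 (fps_conv_radius (slice p x))"
      using near[OF that \<open>norm y < r\<close>] by (simp add: expands_at_def)
  qed
  have "\<exists>y\<in>sphere 0 \<rho>. \<forall>y'\<in>sphere 0 \<rho>. norm (eval_fps (slice p 0) y) \<le> norm (eval_fps (slice p 0) y')"
  proof (rule continuous_attains_inf[OF compact_sphere])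
    have "of_real \<rho> \<in> sphere (0 :: complex) \<rho>" using \<rho> by simp
    thus "sphere (0 :: complex) \<rho> \<noteq> {}" by blast
    have "sphere (0 :: complex) \<rho> \<subseteq> eball 0 (fps_conv_radius (slice p 0))"
      by (rule order.trans[OF sphere_cball in_eball]) (simp add: r)
    thus "continuous_on (sphere 0 \<rho>) (\<lambda>y. norm (eval_fps (slice p 0) y))"
      by (intro continuous_on_norm continuous_on_eval_fps'[OF continuous_on_id]) auto
  qed
  then obtain y0 where y0: "norm y0 = \<rho>"
    "\<And>y. norm y = \<rho> \<Longrightarrow> norm (eval_fps (slice p 0) y0) \<le> norm (eval_fps (slice p 0) y)"
    by auto
  define \<delta> where "\<delta> = norm (ev p (0, y0))"
  have \<delta>: "\<delta> > 0" using near[of 0 y0] y0(1) \<rho> r by (auto simp: \<delta>_def zero_prod_def)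
  have \<delta>_le: "\<delta> \<le> norm (ev p (0, y))" if "norm y = \<rho>" for y
    using y0(2)[OF that] ev_p[of 0 y] ev_p[of 0 y0] r \<rho> y0(1) that by (simp add: \<delta>_def)
  define x :: complex where "x = of_real (min (r / 2) (\<delta> / (4 * (M + 1))))"
  have x: "norm x > 0" "norm x < r" "norm x * M < \<delta> / 2"
  proof -
    have nx: "norm x = min (r / 2) (\<delta> / (4 * (M + 1)))" using r \<delta> M0 by (simp add: x_def)
    show "norm x > 0" "norm x < r" unfolding nx using r \<delta> M0 by auto
    have "norm x * M \<le> norm x * (M + 1)" by (intro mult_left_mono) auto
    also have "\<dots> \<le> (\<delta> / (4 * (M + 1))) * (M + 1)" unfolding nx using M0 by (intro mult_right_mono) auto
    also have "\<dots> = \<delta> / 4"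
    proof -
      have "M + 1 \<noteq> 0" using M0 by simp
      hence "\<delta> / (4 * (M + 1)) * (M + 1) = (\<delta> * (M + 1)) / (4 * (M + 1))" by simp
      also have "\<dots> = \<delta> / 4" using \<open>M + 1 \<noteq> 0\<close> by (rule nonzero_mult_divide_mult_cancel_right)
      finally show ?thesis .
    qed
    finally show "norm x * M < \<delta> / 2" using \<delta> by simp
  qed
  have nz: "eval_fps (slice p x) y \<noteq> 0" if "norm y < r" for y
    using near[OF x(2) that] ev_p[OF x(2) that] x(1) by (auto simp: zero_prod_def)
  have "norm (inverse (eval_fps (slice p x) 0)) \<le> inverse (\<delta> / 2)"
  proof (rule maximum_modulus_frontier[of "\<lambda>y. inverse (eval_fps (slice p x) y)" "ball 0 \<rho>"])
    have "ball (0 :: complex) \<rho> \<subseteq> eball 0 (fps_conv_radius (slice p x))" using in_eball[OF x(2)] ball_subset_cball by blast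
    thus "(\<lambda>y. inverse (eval_fps (slice p x) y)) holomorphic_on interior (ball 0 \<rho>)"
      using nz \<rho> by (auto intro!: holomorphic_intros)
    show "continuous_on (closure (ball 0 \<rho>)) (\<lambda>y. inverse (eval_fps (slice p x) y))"
      using nz \<rho> in_eball[OF x(2)] by (auto intro!: continuous_intros)
    show "norm (inverse (eval_fps (slice p x) y)) \<le> inverse (\<delta> / 2)" if "y \<in> frontier (ball 0 \<rho>)" for y
    proof -
      have y: "norm y = \<rho>" using that \<rho> by (simp add: frontier_ball)
      have "\<delta> \<le> norm (ev p (0, y))" by (rule \<delta>_le[OF y])
      also have "\<dots> \<le> norm (ev p (x, y)) + norm (ev p (x, y) - ev p (0, y))"
        by (metis norm_minus_commute norm_triangle_sub)
      also have "\<dots> \<le> norm (ev p (x, y)) + \<delta> / 2"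
        using diff[of x y] x y \<rho> by simp
      finally have "\<delta> / 2 \<le> norm (eval_fps (slice p x) y)"
        using ev_p[of x y] x y \<rho> by simp
      thus ?thesis using \<delta> unfolding norm_inverse by (intro le_imp_inverse_le) auto
    qed
  qed (use \<rho> in auto)
  hence "\<delta> / 2 \<le> norm (eval_fps (slice p x) 0)"
    unfolding norm_inverse by (rule inverse_le_imp_le) (use nz[of 0] r in simp)
  also have "\<dots> = norm (ev p (x, 0) - ev p (0, 0))"
    using ev_p[of x 0] x r at0_eq_ev[of p] p0 by (simp add: zero_prod_def)
  also have "\<dots> \<le> norm x * M" using diff[of x 0] x r by simp
  finally show False using x by simp
qed

theorem meet_in_origin_imp_coprime:
  assumes "meet_in_origin f g"
  shows "coprime_germs f g"
  unfolding coprime_germs_def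
proof (intro allI impI notI)
  fix p assume p: "irreducible p" "p dvd f" "p dvd g"
  then obtain a b where ab: "f = p * a" "g = p * b" by (auto elim!: dvdE)
  have "\<forall>\<^sub>F z in nhds 0. ev p z = 0 \<longrightarrow> z = 0"
    using assms[unfolded meet_in_origin_def] ev_mult[of p a] ev_mult[of p b] unfolding ab[symmetric]
    by eventually_elim auto
  moreover have "at0 p = 0" using irreducible_not_unit[OF p(1)] by (simp add: dvd_1_iff_at0)
  ultimately show False using zeros_not_isolated by blast
qed


section \<open>Infinitely near points\<close>

lemma strict_nonzero: "f \<noteq> 0 \<Longrightarrow> strict q f \<noteq> 0"
  by (induction q f rule: strict.induct) (simp_all add: strict1_nonzero)

lemma strict_mult: "f \<noteq> 0 \<Longrightarrow> g \<noteq> 0 \<Longrightarrow> strict q (f * g) = strict q f * strict q g"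
  by (induction q arbitrary: f g) (simp_all add: strict1_mult strict1_nonzero)

lemma strict_1 [simp]: "strict q 1 = 1"
  by (induction q) simp_all

lemma strict_dvd: "f dvd g \<Longrightarrow> g \<noteq> 0 \<Longrightarrow> strict q f dvd strict q g"
  by (auto simp: strict_mult elim!: dvdE)

lemma at0_strict_dvd:
  assumes "f dvd g" "g \<noteq> 0" "at0 (strict q f) = 0"
  shows "at0 (strict q g) = 0"
  using strict_dvd[OF assms(1,2), of q] assms(3) by (auto elim!: dvdE)

lemma at0_strict_unit:
  assumes "at0 u \<noteq> 0"
  shows "at0 (strict q u) \<noteq> 0"
  using strict_dvd[of u 1 q] assms by (simp add: dvd_1_iff_at0[symmetric])

lemma component_through_point:
  assumes "f \<noteq> 0" "at0 (strict q f) = 0"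
  shows "\<exists>g. component g f \<and> at0 (strict q g) = 0"
  using assms
proof (induction f rule: factor_induct)
  case (unit u)
  thus ?case using at0_strict_unit by (simp add: dvd_1_iff_at0)
next
  case (factor p f)
  have "p \<noteq> 0" using factor.hyps by auto
  hence "at0 (strict q p) = 0 \<or> at0 (strict q f) = 0" using factor by (simp add: strict_mult)
  thus ?case using factor by (auto simp: component_def intro: dvd_mult)
qed

text \<open>
  The exceptional divisor at a point above \<open>t\<close> is thus the one created by the blow-ups after the
  first, times the strict transform of the first exceptional divisor (\<open>exc_divisor_Cons\<close>). The
  comparison of a curve with its strict transform rests on this factorization.
\<close>

lemma exc_divisor_from_mult:
  "e \<noteq> 0 \<Longrightarrow> e' \<noteq> 0 \<Longrightarrow> exc_divisor_from (e * e') q = exc_divisor_from e q * strict q e'"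
proof (induction q arbitrary: e e')
  case (Cons t q)
  have "exc_divisor_from (e * e') (t # q) = exc_divisor_from ((exc t * strict1 t e) * strict1 t e') q"
    using Cons.prems by (simp add: strict1_mult mult.assoc)
  also have "\<dots> = exc_divisor_from (exc t * strict1 t e) q * strict q (strict1 t e')"
    using Cons.prems by (intro Cons.IH) (auto dest: strict1_nonzero)
  finally show ?case by simp
qed simp

lemma exc_divisor_Nil [simp]: "exc_divisor [] = 1"
  by (simp add: exc_divisor_def)

lemma exc_divisor_Cons: "exc_divisor (t # q) = exc_divisor q * strict q (exc t)"
  using exc_divisor_from_mult[of 1 "exc t" q] by (simp add: exc_divisor_def)

lemma exc_divisor_nonzero [simp]: "exc_divisor q \<noteq> 0"
  by (induction q) (simp_all add: exc_divisor_Cons strict_nonzero)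

lemma at0_exc_divisor: "q \<noteq> [] \<Longrightarrow> at0 (exc_divisor q) = 0"
proof (induction q)
  case (Cons t q)
  thus ?case by (cases "q = []") (simp_all add: exc_divisor_Cons)
qed simp

lemma transverse_strict_separated:
  assumes "f \<noteq> 0" "nonsingular f" "g \<noteq> 0" "nonsingular g" "transverse f g" "q \<noteq> []"
  shows "at0 (strict q f) \<noteq> 0 \<or> at0 (strict q g) \<noteq> 0"
proof -
  obtain t r where q: "q = t # r" using assms(6) by (cases q) auto
  show ?thesis
    using transverse_separated[OF assms(1,2) _ assms(3,4)] assms(5)
      at0_strict_unit[of "strict1 t f" r] at0_strict_unit[of "strict1 t g" r]
    unfolding q by auto
qed

text \<open>
  A nonsingular germ meets only the last exceptional component, transversally: it is transverse
  to a component when this is created, and therefore separated from it by the next blow-up.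
\<close>

lemma nonsingular_strict:
  assumes "v \<noteq> 0" "nonsingular v" "q \<noteq> []" "at0 (strict q v) = 0"
  shows "nonsingular (strict q v) \<and> nonsingular (exc_divisor q) \<and> transverse (strict q v) (exc_divisor q)"
  using assms
proof (induction q arbitrary: v)
  case (Cons t q)
  let ?v = "strict1 t v"
  have 0: "at0 ?v = 0" using Cons.prems at0_strict_unit[of ?v q] by auto
  have v: "?v \<noteq> 0" "nonsingular ?v" "transverse ?v (exc t)"
    using strict1_nonzero nonsingular_strict1[OF Cons.prems(1,2) 0] Cons.prems(1) by auto
  show ?case
  proof (cases "q = []")
    case True
    thus ?thesis using v by (simp add: exc_divisor_Cons nonsingular_exc)
  next
    case False
    have unit: "at0 (strict q (exc t)) \<noteq> 0"
      using transverse_strict_separated[OF v(1,2) exc_nonzero nonsingular_exc v(3) False] Cons.prems(4)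
      by auto
    have "nonsingular (strict q ?v) \<and> nonsingular (exc_divisor q) \<and> transverse (strict q ?v) (exc_divisor q)"
      using Cons.IH[OF v(1,2) False] Cons.prems by simp
    thus ?thesis using unit False
      by (simp add: exc_divisor_Cons mult.commute[of "exc_divisor q"] nonsingular_unit_mult
          transverse_unit_mult_right at0_exc_divisor)
  qed
qed simp

text \<open>
  A nonsingular germ has one tangent direction, at each stage; the points that it passes through
  form a single chain.
\<close>

lemma nonsingular_through_comparable_points:
  assumes "v \<noteq> 0" "nonsingular v" "at0 (strict q v) = 0" "at0 (strict q' v) = 0"
  shows "(\<exists>r. q' = q @ r) \<or> (\<exists>r. q = q' @ r)"
  using assms
proof (induction q arbitrary: v q')
  case (Cons t q)
  note prems = Cons.prems
  show ?case
  proof (cases q')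
    case (Cons t' r)
    have 0: "at0 (strict1 t v) = 0" "at0 (strict1 t' v) = 0"
      using prems(3,4) at0_strict_unit Cons by (metis strict.simps(2))+
    have "t = t'" using nonsingular_unique_direction[OF prems(1,2) 0] .
    moreover have "(\<exists>s. r = q @ s) \<or> (\<exists>s. q = r @ s)"
      using Cons.IH[of "strict1 t v" r] prems nonsingular_strict1(1)[OF prems(1,2) 0(1)] strict1_nonzero
        \<open>t = t'\<close> \<open>q' = t' # r\<close> by simp
    ultimately show ?thesis using Cons by simp
  qed simp
qed simp

text \<open>
  A branch that separates from a nonsingular germ \<open>E\<close> only at \<open>q\<close> or later, and has become
  nonsingular and transverse to the exceptional divisor at \<open>q\<close>, was nonsingular from the start. As
  long as the branch follows \<open>E\<close>, it shares the tangent of \<open>E\<close>, hence is transverse to the last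
  exceptional component, and the blow-down of such a branch is nonsingular.
\<close>

lemma blow_down_along_nonsingular:
  assumes "E \<noteq> 0" "nonsingular E" "irreducible \<gamma>" "q \<noteq> []"
    and "at0 (strict q E) = 0" "nonsingular (strict q \<gamma>)"
    and "nonsingular (exc_divisor q)" "transverse (strict q \<gamma>) (exc_divisor q)"
  shows "nonsingular \<gamma>"
  using assms
proof (induction q arbitrary: \<gamma> E)
  case (Cons t q)
  let ?\<sigma> = "strict1 t \<gamma>" and ?E = "strict1 t E"
  have \<gamma>0: "\<gamma> \<noteq> 0" using Cons.prems by auto
  hence \<sigma>0: "?\<sigma> \<noteq> 0" by (rule strict1_nonzero)
  show ?case
  proof (cases q)
    case Nil
    thus ?thesis
      using blow_down_nonsingular[OF Cons.prems(3) \<sigma>0 _ dvd_refl] Cons.prems by (simp add: exc_divisor_Cons)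
  next
    case q: (Cons t' r)
    have ne: "q \<noteq> []" by (simp add: q)
    have D0: "at0 (exc_divisor q) = 0" using ne by (rule at0_exc_divisor)
    have D: "exc_divisor (t # q) = strict q (exc t) * exc_divisor q"
      by (simp add: exc_divisor_Cons mult.commute)
    have unit: "at0 (strict q (exc t)) \<noteq> 0"
      using not_nonsingular_mult[of "strict q (exc t)" "exc_divisor q"] D0 Cons.prems(7)
      unfolding D by (auto simp: strict_nonzero)
    have nsD: "nonsingular (exc_divisor q)"
      using Cons.prems(7) unit unfolding D by (simp add: nonsingular_unit_mult)
    have trD: "transverse (strict q ?\<sigma>) (exc_divisor q)"
      using Cons.prems(8) unit D0 unfolding D by (simp add: transverse_unit_mult_right)
    have ns\<sigma>: "nonsingular (strict q ?\<sigma>)" using Cons.prems(6) by simp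
    have \<sigma>q0: "strict q ?\<sigma> \<noteq> 0" using \<sigma>0 by (rule strict_nonzero)
    have "at0 (strict q ?\<sigma>) = 0" using ns\<sigma> nonsingular_iff[OF \<sigma>q0] by blast
    then obtain s where s: "component s ?\<sigma>" "at0 (strict q s) = 0"
      using component_through_point[OF \<sigma>0] by blast
    obtain k where k: "?\<sigma> = s * k" using s(1) by (auto simp: component_def elim: dvdE)
    have nz: "s \<noteq> 0" "k \<noteq> 0" using \<sigma>0 k by auto
    have \<sigma>_eq: "strict q ?\<sigma> = strict q k * strict q s" by (simp add: k strict_mult nz mult.commute)
    have k_unit: "at0 (strict q k) \<noteq> 0"
      using not_nonsingular_mult[of "strict q k" "strict q s"] s(2) ns\<sigma> \<sigma>q0 unfolding \<sigma>_eq by blast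
    have ns: "nonsingular (strict q s)" "transverse (strict q s) (exc_divisor q)"
      using ns\<sigma> trD k_unit s(2) nz unfolding \<sigma>_eq
      by (simp_all add: nonsingular_unit_mult strict_nonzero transverse_unit_mult_left)
    have E0: "at0 ?E = 0" using Cons.prems(5) at0_strict_unit[of ?E q] by auto
    have E: "?E \<noteq> 0" "nonsingular ?E" "transverse ?E (exc t)"
      using strict1_nonzero nonsingular_strict1[OF Cons.prems(1,2) E0] Cons.prems(1) by auto
    have s_ns: "nonsingular s"
      using Cons.IH[OF E(1,2) _ ne _ ns(1) nsD ns(2)] s(1) Cons.prems(5) by (simp add: component_def)
    have "at0 (strict1 t' s) = 0" "at0 (strict1 t' ?E) = 0"
      using s(2) Cons.prems(5) at0_strict_unit[of "strict1 t' s" r] at0_strict_unit[of "strict1 t' ?E" r]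
      unfolding q by auto
    hence "transverse s (exc t)"
      using transverse_same_direction[OF nz(1) s_ns _ E(1,2) _ E(3)] by blast
    thus ?thesis
      using blow_down_nonsingular[OF Cons.prems(3) nz(1) s_ns, of t] s(1) by (simp add: component_def)
  qed
qed simp


section \<open>Resolution at a point\<close>

text \<open>
  For a reduced curve, the conditions on its components at a point amount to a condition on the
  whole strict transform.
\<close>

lemma resolved_at_iff:
  assumes f: "f \<noteq> 0" "squarefree f"
  shows "resolved_at f q \<longleftrightarrow> at0 (strict q f) \<noteq> 0 \<or>
    (nonsingular (strict q f) \<and> nonsingular (exc_divisor q) \<and> transverse (strict q f) (exc_divisor q))"
    (is "_ \<longleftrightarrow> _ \<or> ?ns")
proof
  assume R: "resolved_at f q"
  show "at0 (strict q f) \<noteq> 0 \<or> ?ns"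
  proof (cases "at0 (strict q f) = 0")
    case True
    then obtain g where g: "component g f" "at0 (strict q g) = 0"
      using component_through_point f(1) by blast
    then obtain k where k: "f = k * g" unfolding component_def by (metis dvdE mult.commute)
    have nz: "g \<noteq> 0" "k \<noteq> 0" using f k by auto
    have "at0 (strict q k) \<noteq> 0"
    proof
      assume "at0 (strict q k) = 0"
      then obtain g' where g': "component g' k" "at0 (strict q g') = 0"
        using component_through_point nz by blast
      have "component g' f" using g'(1) by (auto simp: component_def k)
      hence "g dvd g'" using R g g'(2) by (auto simp: resolved_at_def passes_through_def same_germ_def)
      hence "g\<^sup>2 dvd f"
        unfolding k power2_eq_square using g'(1) by (intro mult_dvd_mono) (auto simp: component_def intro: dvd_trans)
      thus False using squarefreeD[OF f(2)] g(1) irreducible_not_unit by (auto simp: component_def)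
    qed
    moreover have "nonsingular (strict q g)" "nonsingular (exc_divisor q)" "transverse (strict q g) (exc_divisor q)"
      using R g by (auto simp: resolved_at_def passes_through_def)
    ultimately show ?thesis
      using g(2) by (simp add: k strict_mult nz nonsingular_unit_mult strict_nonzero transverse_unit_mult_left)
  qed simp
next
  assume R: "at0 (strict q f) \<noteq> 0 \<or> ?ns"
  have main: "nonsingular (strict q g) \<and> nonsingular (exc_divisor q) \<and> transverse (strict q g) (exc_divisor q)
      \<and> (\<forall>g'. component g' f \<and> at0 (strict q g') = 0 \<longrightarrow> same_germ g g')"
    if g: "component g f" "at0 (strict q g) = 0" for g
  proof -
    obtain k where k: "f = k * g" using g unfolding component_def by (metis dvdE mult.commute)
    have nz: "g \<noteq> 0" "k \<noteq> 0" using f k by auto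
    have "at0 (strict q f) = 0" using g(2) by (simp add: k strict_mult nz)
    hence ns: "nonsingular (strict q f)" "nonsingular (exc_divisor q)" "transverse (strict q f) (exc_divisor q)"
      using R by auto
    have unit: "at0 (strict q k) \<noteq> 0"
      using ns(1) not_nonsingular_mult[of "strict q k" "strict q g"] g(2) nz
      by (auto simp: k strict_mult strict_nonzero)
    have "same_germ g g'" if g': "component g' f" "at0 (strict q g') = 0" for g'
    proof -
      have irr: "irreducible g" "irreducible g'" using g g' by (auto simp: component_def)
      have "\<not> g' dvd k" using at0_strict_dvd[OF _ nz(2) g'(2)] unit by blast
      hence "g' dvd g" using irreducible_dvd_mult[OF irr(2), of k g] g'(1) by (auto simp: component_def k)
      thus ?thesis using irreducible_associated[OF irr(2,1)] by (auto simp: same_germ_def)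
    qed
    thus ?thesis
      using ns g(2) unit
      by (auto simp: k strict_mult nz nonsingular_unit_mult strict_nonzero transverse_unit_mult_left)
  qed
  thus "resolved_at f q" unfolding resolved_at_def passes_through_def using main by blast
qed


section \<open>Minimal desingularizations\<close>

lemma centres_prefix: "centres T \<Longrightarrow> p @ r \<in> T \<Longrightarrow> p \<in> T"
proof (induction r rule: rev_induct)
  case (snoc t r)
  thus ?case unfolding centres_def by (metis append_assoc)
qed simp

lemma points_over_nonempty: "q \<in> points_over T \<Longrightarrow> q \<noteq> []"
  by (auto simp: points_over_def)

lemma points_over_comparable_imp_eq:
  assumes "centres T" "q \<in> points_over T" "q @ r \<in> points_over T"
  shows "r = []"
proof (rule ccontr)
  assume "r \<noteq> []"
  then obtain r' t where r: "r = r' @ [t]" by (cases r rule: rev_cases) auto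
  have "q @ r' \<in> T" using assms(3) unfolding r by (auto simp: points_over_def)
  hence "q \<in> T" using centres_prefix assms(1) by blast
  thus False using assms(2) by (auto simp: points_over_def)
qed

lemma desingularization_Int:
  assumes "desingularization f T" "desingularization f T'"
  shows "desingularization f (T \<inter> T')"
  unfolding desingularization_def
proof (intro conjI ballI)
  show "centres (T \<inter> T')" using assms by (auto simp: desingularization_def centres_def)
  fix q assume "q \<in> points_over (T \<inter> T')"
  hence "q \<in> points_over T \<or> q \<in> points_over T'" by (auto simp: points_over_def)
  thus "resolved_at f q" using assms by (auto simp: desingularization_def)
qed

text \<open>
  Desingularizations are closed under intersection, so that one with the least number of centres is
  contained in all others.
\<close>

lemma minimal_desingularization_exists:
  assumes "desingularization f T"
  obtains T' where "minimal_desingularization f T'" "T' \<subseteq> T"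
proof -
  obtain T' where T': "desingularization f T'" "\<And>S. desingularization f S \<Longrightarrow> card T' \<le> card S"
    using ex_has_least_nat[of "desingularization f" T card] assms by blast
  have "T' \<subseteq> S" if S: "desingularization f S" for S
  proof -
    have "finite T'" using T'(1) by (auto simp: desingularization_def centres_def)
    moreover have "card T' \<le> card (T' \<inter> S)" by (intro T'(2) desingularization_Int T'(1) S)
    ultimately have "T' \<inter> S = T'" using card_seteq[of T' "T' \<inter> S"] by blast
    thus ?thesis by blast
  qed
  thus ?thesis using that[of T'] T'(1) assms by (auto simp: minimal_desingularization_def)
qed

text \<open>If the curve were resolved at the centre \<open>q\<close>, that centre and all those above it could be omitted.\<close>

lemma minimal_centre_not_resolved:
  assumes T: "minimal_desingularization f T" and q: "q \<in> T" "q \<noteq> []"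
  shows "\<not> resolved_at f q"
proof
  assume R: "resolved_at f q"
  define S where "S = {p \<in> T. \<nexists>r. p = q @ r}"
  have c: "centres T" and res: "\<And>p. p \<in> points_over T \<Longrightarrow> resolved_at f p"
    using T by (auto simp: minimal_desingularization_def desingularization_def)
  have "centres S"
    unfolding centres_def
  proof (intro conjI allI impI)
    show "p \<in> S" if "p @ [t] \<in> S" for p t
    proof -
      have "p \<in> T" using that c by (auto simp: S_def centres_def)
      moreover have "p \<noteq> q @ r" for r using that by (auto simp: S_def)
      ultimately show ?thesis by (simp add: S_def)
    qed
  qed (use c q(2) in \<open>auto simp: S_def centres_def\<close>)
  moreover have "resolved_at f (p @ [t])" if p: "p \<in> S" "p @ [t] \<notin> S" for p t
  proof (cases "p @ [t] \<in> T")
    case True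
    then obtain r where r: "p @ [t] = q @ r" using p(2) by (auto simp: S_def)
    have "r = []"
    proof (rule ccontr)
      assume "r \<noteq> []"
      hence "p = q @ butlast r" using r by (metis butlast_append butlast_snoc)
      thus False using p(1) by (auto simp: S_def)
    qed
    thus ?thesis using R r by simp
  next
    case False
    thus ?thesis using p res by (auto simp: S_def points_over_def)
  qed
  ultimately have "desingularization f S" by (auto simp: desingularization_def points_over_def)
  hence "T \<subseteq> S" using T by (auto simp: minimal_desingularization_def)
  hence "q \<in> S" using q by blast
  thus False by (simp add: S_def)
qed

lemma centres_tail:
  assumes "centres T" "[P] \<in> T"
  shows "centres {q. P # q \<in> T}"
proof -
  have "finite {q. P # q \<in> T}"
    using assms finite_vimageI[of T "(#) P"] by (simp add: centres_def vimage_def)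
  moreover have "P # p \<in> T" if "P # p @ [t] \<in> T" for p t
    using assms(1) that unfolding centres_def by (metis append_Cons)
  ultimately show ?thesis using assms(2) by (auto simp: centres_def)
qed


section \<open>Independence of \<open>\<kappa>\<close> of the equation\<close>

lemma unit_mult_dvd_iff:
  fixes u :: hgerm
  assumes "u dvd 1"
  shows "u * d dvd x \<longleftrightarrow> d dvd x"
proof
  obtain v where v: "1 = u * v" using assms by (rule dvdE)
  assume "d dvd x"
  then obtain y where "x = d * y" by (rule dvdE)
  hence "x = (u * d) * (v * y)" using v by (metis mult.assoc mult.commute mult_1)
  thus "u * d dvd x" by simp
qed (rule dvd_mult_right)

lemma invariant_unit_mult:
  assumes "u dvd 1"
  shows "invariant Y (u * d) \<longleftrightarrow> invariant Y d"
proof -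
  have "invariant Y (u * d) \<longleftrightarrow> d dvd der Y u * d + u * der Y d"
    by (simp add: invariant_def unit_mult_dvd_iff[OF assms] der_mult)
  also have "\<dots> \<longleftrightarrow> d dvd u * der Y d" by (simp add: dvd_add_right_iff)
  also have "\<dots> \<longleftrightarrow> d dvd der Y d"
  proof
    assume "d dvd u * der Y d"
    moreover obtain v where v: "1 = u * v" using assms by (rule dvdE)
    moreover have "der Y d = v * (u * der Y d)" using v by (metis mult.assoc mult.commute mult_1)
    ultimately show "d dvd der Y d" by (metis dvd_mult)
  qed simp
  finally show ?thesis by (simp add: invariant_def)
qed

lemma ideal2_unit_mult:
  assumes "u dvd 1"
  shows "ideal2 (u * d) (der Y (u * d)) = ideal2 d (der Y d)"
proof -
  obtain v where v: "1 = u * v" using assms by (rule dvdE)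
  have "\<exists>r' s'. r * (u * d) + s * der Y (u * d) = r' * d + s' * der Y d" for r s
    by (rule exI[of _ "r * u + s * der Y u"], rule exI[of _ "s * u"]) (simp add: der_mult algebra_simps)
  moreover have "\<exists>r' s'. r * d + s * der Y d = r' * (u * d) + s' * der Y (u * d)" for r s
  proof (rule exI[of _ "(r - s * v * der Y u) * v"], rule exI[of _ "s * v"])
    have "(r - s * v * der Y u) * v * (u * d) + s * v * der Y (u * d)
        = (u * v) * ((r - s * v * der Y u) * d + s * der Y d) + s * v * der Y u * d"
      by (simp add: der_mult algebra_simps)
    also have "\<dots> = r * d + s * der Y d" unfolding v[symmetric] by (simp add: algebra_simps)
    finally show "r * d + s * der Y d
        = (r - s * v * der Y u) * v * (u * d) + s * v * der Y (u * d)" by simp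
  qed
  ultimately show ?thesis unfolding ideal2_def by blast
qed

lemma puiseux_unit_mult:
  assumes "at0 u \<noteq> 0"
  shows "puiseux (u * d) p q \<longleftrightarrow> puiseux d p q"
proof -
  have "along u p q \<noteq> 0" using along_nth_0[of u p q] assms by auto
  hence "along (u * d) p q = 0 \<longleftrightarrow> along d p q = 0" if "p $ 0 = 0" "q $ 0 = 0"
    using along_mult[OF that, of u d] by simp
  thus ?thesis unfolding puiseux_def by auto
qed

text \<open>
  The equation of the exceptional divisor changes by a unit when the first exceptional divisor is
  separated from the point, as in the factorization of \<open>exc_divisor\<close> above.
\<close>

lemma kappa_unit_mult:
  assumes "at0 u \<noteq> 0"
  shows "kappa Y (u * d) = kappa Y d"
proof -
  have u: "u dvd 1" using assms by (simp add: dvd_1_iff_at0)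
  show ?thesis
    unfolding kappa_def tang_def Z_index_def invariant_unit_mult[OF u] ideal2_unit_mult[OF u]
      puiseux_unit_mult[OF assms] ..
qed


section \<open>The invariant curve germs at a point of the exceptional divisor\<close>

text \<open>
  By the chain rule, \<open>c Y(\<phi> g) = e \<phi>(X g)\<close> for every germ \<open>g\<close>, where \<open>\<phi>\<close> is the pull-back. For the
  invariant \<open>f\<close> with \<open>\<phi> f = e\<^sup>m s r\<close> it follows that \<open>s\<close> divides \<open>c e\<^sup>m r Y(s)\<close>; and \<open>s\<close> divides none of
  the factors \<open>c\<close>, \<open>e\<close> and \<open>r\<close>.
\<close>

lemma strict1_component_invariant:
  assumes X: "foliation X" and f: "f \<noteq> 0" "squarefree f" "invariant X f" and Y: "pullback1 t X Y"
    and s: "irreducible s" "s dvd strict1 t f"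
  shows "invariant Y s"
proof -
  let ?\<phi> = "total_transform t"
  obtain c where c: "c \<noteq> 0" "c * der Y (fst (chart t)) = exc t * ?\<phi> (fst X)"
    "c * der Y (snd (chart t)) = exc t * ?\<phi> (snd X)"
    using Y by (auto simp: pullback1_def)
  have lift: "c * der Y (?\<phi> g) = exc t * ?\<phi> (der X g)" for g
  proof -
    have "c * der Y (?\<phi> g) = ?\<phi> (dx g) * (c * der Y (fst (chart t))) + ?\<phi> (dy g) * (c * der Y (snd (chart t)))"
      unfolding total_transform_def chain_rule[OF at0_chart] by (simp add: algebra_simps)
    also have "\<dots> = exc t * ?\<phi> (der X g)"
      unfolding c by (simp add: der_def total_transform_add total_transform_mult algebra_simps)
    finally show ?thesis .
  qed
  have s_exc: "\<not> s dvd exc t ^ n" for n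
    using irreducible_dvd_power[OF s(1)] irreducible_dvd_strict1_imp_not_exc[OF f(1) s] by blast
  \<comment> \<open>Along \<open>s = 0\<close> the field \<open>X\<close> has no zero, since its singularity is isolated; hence \<open>s\<close> does not
    divide the factor \<open>c\<close>.\<close>
  have "\<not> s dvd c"
  proof
    assume sc: "s dvd c"
    have "s dvd ?\<phi> (fst X)" "s dvd ?\<phi> (snd X)"
      using irreducible_dvd_mult[OF s(1)] s_exc[of 1] dvd_mult2[OF sc] c by (metis power_one_right)+
    moreover have "coprime_germs (fst X) (snd X)"
      using X meet_in_origin_imp_coprime by (simp add: foliation_def)
    then obtain n a b where n: "exc t ^ n = a * fst X + b * snd X"
      using exc_power_in_coprime_ideal by blast
    have "exc t ^ n = ?\<phi> (a * fst X + b * snd X)"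
      unfolding n[symmetric] by (simp add: total_transform_power)
    ultimately have "s dvd exc t ^ n" by (simp add: total_transform_add total_transform_mult)
    thus False using s_exc by blast
  qed
  obtain k where k: "der X f = f * k" using f(3) by (auto simp: invariant_def elim: dvdE)
  obtain m where m: "?\<phi> f = exc t ^ m * strict1 t f" by (rule total_transform_eq[OF f(1)], rule that)
  obtain r where r: "strict1 t f = s * r" using s(2) by (rule dvdE)
  have "\<not> s dvd r"
  proof
    assume "s dvd r"
    hence "s\<^sup>2 dvd strict1 t f" by (simp add: r power2_eq_square)
    thus False using squarefreeD[OF squarefree_strict1[OF f(1,2)]] irreducible_not_unit[OF s(1)] by blast
  qed
  have "c * der Y (?\<phi> f) = s * (exc t * (exc t ^ m * r) * ?\<phi> k)"
  proof -
    have "c * der Y (?\<phi> f) = exc t * (?\<phi> f * ?\<phi> k)" by (simp only: lift k total_transform_mult)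
    thus ?thesis unfolding m r by (simp add: mult_ac)
  qed
  moreover have "c * der Y (?\<phi> f) = c * exc t ^ m * r * der Y s + s * (c * (der Y (exc t ^ m) * r + exc t ^ m * der Y r))"
    unfolding m r der_mult by (simp add: algebra_simps)
  ultimately have "s dvd c * exc t ^ m * r * der Y s + s * (c * (der Y (exc t ^ m) * r + exc t ^ m * der Y r))"
    by (metis dvd_triv_left)
  hence "s dvd c * exc t ^ m * r * der Y s" by (simp only: dvd_add_left_iff dvd_triv_left)
  thus ?thesis
    unfolding invariant_def using irreducible_dvd_mult[OF s(1)] \<open>\<not> s dvd c\<close> \<open>\<not> s dvd r\<close> s_exc by blast
qed

lemma invariant_of_components:
  assumes "f \<noteq> 0" "\<And>s. component s f \<Longrightarrow> invariant Y s"
  shows "invariant Y f"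
  using assms
proof (induction f rule: factor_induct)
  case (unit u)
  thus ?case by (auto simp: invariant_def intro: dvd_trans)
next
  case (factor p f)
  have "invariant Y p" "invariant Y f" using factor by (auto simp: component_def)
  hence "p * f dvd der Y p * f" "p * f dvd p * der Y f"
    by (auto simp: invariant_def intro: mult_dvd_mono)
  thus ?case by (simp add: invariant_def der_mult)
qed

lemma reduced_germ_unique:
  assumes "f \<noteq> 0" "squarefree f" "g \<noteq> 0" "squarefree g" "\<And>s. component s f \<longleftrightarrow> component s g"
  shows "\<exists>u. at0 u \<noteq> 0 \<and> f = u * g"
proof -
  have c: "s dvd f \<longleftrightarrow> s dvd g" if "irreducible s" for s
    using assms(5)[of s] that by (simp add: component_def)
  have "f dvd g"
    by (rule squarefree_imp_dvd[OF assms(1,2)]) (simp add: c)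
  then obtain a where a: "g = f * a" by (rule dvdE)
  have "g dvd f"
    by (rule squarefree_imp_dvd[OF assms(3,4)]) (simp add: c)
  then obtain b where b: "f = g * b" by (rule dvdE)
  have "g * 1 = g * (b * a)" using a unfolding b by (simp add: mult.assoc)
  hence "1 = b * a" using assms(3) by (metis mult_left_cancel)
  hence "b dvd 1" by (rule dvdI)
  moreover have "f = b * g" using b by (simp add: mult.commute)
  ultimately show ?thesis unfolding dvd_1_iff_at0 by blast
qed

text \<open>
  Every component of the strict transform is invariant, so that the requirement of invariance concerns
  the exceptional divisor only.
\<close>

lemma reduced_invariant_germ_eq:
  assumes X: "foliation X" and f: "f \<noteq> 0" "squarefree f" "invariant X f" "at0 f = 0"
    and Y: "pullback1 t X Y" and fP: "fP \<noteq> 0" "squarefree fP"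
    and comp: "\<And>g. component g fP \<longleftrightarrow> component g (total_transform t f) \<and> invariant Y g"
  shows "\<exists>u. at0 u \<noteq> 0 \<and> fP = u * ((if invariant Y (exc t) then exc t else 1) * strict1 t f)"
proof (rule reduced_germ_unique)
  let ?\<epsilon> = "if invariant Y (exc t) then exc t else 1"
  have "coprime_germs ?\<epsilon> (strict1 t f)"
    using irreducible_dvd_strict1_imp_not_exc[OF f(1)] irreducible_not_unit by (auto simp: coprime_germs_def)
  moreover have "squarefree ?\<epsilon>"
    using irreducible_imp_squarefree[OF irreducible_exc] unit_imp_squarefree[of 1] by simp
  ultimately show "squarefree (?\<epsilon> * strict1 t f)"
    using squarefree_coprime_mult strict1_nonzero[OF f(1)] squarefree_strict1[OF f(1,2)] by auto
  show "?\<epsilon> * strict1 t f \<noteq> 0" using strict1_nonzero[OF f(1)] by auto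
  fix s
  obtain m where m: "total_transform t f = exc t ^ m * strict1 t f"
    by (rule total_transform_eq[OF f(1)], rule that)
  have "m \<noteq> 0"
    using exc_dvd_total_transform[OF f(4), of t] exc_not_dvd_strict1[OF f(1), of t] unfolding m
    by (cases m) auto
  hence "component s (total_transform t f) \<longleftrightarrow> irreducible s \<and> (s dvd exc t \<or> s dvd strict1 t f)"
    unfolding component_def m using irreducible_dvd_mult[of s] irreducible_dvd_power[of s]
      dvd_trans[OF _ dvd_power[of m "exc t"], of s] by (auto intro: dvd_mult dvd_mult2)
  moreover have "invariant Y s" if "irreducible s" "s dvd strict1 t f"
    using strict1_component_invariant[OF X f(1-3) Y that] .
  moreover have "invariant Y s \<longleftrightarrow> invariant Y (exc t)" if s: "irreducible s" "s dvd exc t"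
  proof -
    obtain v where v: "exc t = s * v" using s(2) by (rule dvdE)
    hence "v dvd 1" using irreducibleD[OF irreducible_exc v] irreducible_not_unit[OF s(1)] by blast
    thus ?thesis using invariant_unit_mult[of v Y s] v by (simp add: mult.commute)
  qed
  ultimately show "component s fP \<longleftrightarrow> component s (?\<epsilon> * strict1 t f)"
    unfolding comp using irreducible_dvd_mult[of s ?\<epsilon> "strict1 t f"] irreducible_not_unit[of s]
    by (auto simp: component_def)
qed (use fP in auto)

text \<open>
  Two transverse branches have different tangents, hence at most one of them passes through a given
  point of the exceptional divisor.
\<close>

lemma normal_crossings_strict1:
  assumes "normal_crossings h"
  shows "at0 (strict1 t h) \<noteq> 0 \<or> (nonsingular (strict1 t h) \<and> transverse (strict1 t h) (exc t))"
proof -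
  have one: "at0 (strict1 t v) \<noteq> 0 \<or> (nonsingular (strict1 t v) \<and> transverse (strict1 t v) (exc t))"
    if "irreducible v" "nonsingular v" for v
  proof -
    have "v \<noteq> 0" using that by auto
    thus ?thesis using nonsingular_strict1(1,2)[OF _ that(2), of t] by blast
  qed
  from assms consider "h dvd 1" | "irreducible h" "nonsingular h"
    | u v where "h = u * v" "irreducible u" "nonsingular u" "irreducible v" "nonsingular v" "transverse u v"
    unfolding normal_crossings_def by blast
  thus ?thesis
  proof cases
    case 1
    thus ?thesis using strict1_unit[of h t] by (simp add: dvd_1_iff_at0)
  next
    case 2
    thus ?thesis using one by blast
  next
    case (3 u v)
    have nz: "u \<noteq> 0" "v \<noteq> 0" using 3 by auto
    have h: "strict1 t h = strict1 t u * strict1 t v" by (simp add: 3(1) strict1_mult nz)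
    have "at0 (strict1 t u) \<noteq> 0 \<or> at0 (strict1 t v) \<noteq> 0"
      using transverse_separated 3 nz by blast
    thus ?thesis
    proof
      assume u: "at0 (strict1 t u) \<noteq> 0"
      show ?thesis
        using one[OF 3(4,5)] u nz unfolding h
        by (cases "at0 (strict1 t v) = 0") (simp_all add: nonsingular_unit_mult strict1_nonzero transverse_unit_mult_left)
    next
      assume v: "at0 (strict1 t v) \<noteq> 0"
      show ?thesis
        using one[OF 3(2,3)] v nz unfolding h mult.commute[of "strict1 t u"]
        by (cases "at0 (strict1 t u) = 0") (simp_all add: nonsingular_unit_mult strict1_nonzero transverse_unit_mult_left)
    qed
  qed
qed

lemma normal_crossings_nonsingular:
  "h \<noteq> 0 \<Longrightarrow> nonsingular h \<Longrightarrow> normal_crossings h"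
  using nonsingular_imp_irreducible by (auto simp: normal_crossings_def)

lemma normal_crossings_mult:
  assumes "u \<noteq> 0" "nonsingular u" "v \<noteq> 0" "at0 v \<noteq> 0 \<or> (nonsingular v \<and> transverse u v)"
  shows "normal_crossings (u * v)"
proof (cases "at0 v = 0")
  case True
  thus ?thesis using assms nonsingular_imp_irreducible by (auto simp: normal_crossings_def)
next
  case False
  thus ?thesis 
    using assms normal_crossings_nonsingular[of "v * u"] unfolding mult.commute[of u v]
    by (simp add: nonsingular_unit_mult)
qed


section \<open>Comparison of the desingularizations before and after one blow-up\<close>

text \<open>
  The exceptional divisor at \<open>P # q\<close> is nonsingular where a resolved curve meets it, and it already
  contains the components created above \<open>P\<close>; it has no room for the exceptional divisor of \<open>P\<close>.
\<close>

lemma resolved_imp_exc_separated: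
  assumes f: "f \<noteq> 0" "squarefree f" and q: "q \<noteq> []"
    and R: "resolved_at f (P # q)" "at0 (strict (P # q) f) = 0"
  shows "at0 (strict q (exc P)) \<noteq> 0"
proof
  assume 0: "at0 (strict q (exc P)) = 0"
  have "nonsingular (exc_divisor q * strict q (exc P))"
    using R resolved_at_iff[OF f] by (auto simp: exc_divisor_Cons)
  moreover have "exc_divisor q * strict q (exc P) \<noteq> 0" by (simp add: strict_nonzero)
  ultimately show False using not_nonsingular_mult at0_exc_divisor[OF q] 0 by blast
qed

text \<open>
  The curve \<open>fP\<close> is the strict transform of \<open>f\<close>, possibly together with the exceptional divisor of
  the first blow-up (then \<open>\<epsilon> = exc P\<close>). The latter cannot spoil the resolution: it is nonsingular,
  transverse to the later exceptional components, and separated from \<open>f\<close> where \<open>f\<close> is resolved.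
\<close>

lemma resolved_at_tail:
  assumes f: "f \<noteq> 0" "squarefree f" and fP: "fP \<noteq> 0" "squarefree fP"
    and eq: "fP = u * (\<epsilon> * strict1 P f)" "at0 u \<noteq> 0" "\<epsilon> = exc P \<or> \<epsilon> = 1"
    and q: "q \<noteq> []" and R: "resolved_at f (P # q)"
  shows "resolved_at fP q"
proof -
  let ?A = "strict q (strict1 P f)" and ?w = "strict q (exc P)" and ?D = "exc_divisor q"
  have nz: "u \<noteq> 0" "\<epsilon> \<noteq> 0" "strict1 P f \<noteq> 0" "?A \<noteq> 0" "?w \<noteq> 0" "strict q \<epsilon> \<noteq> 0"
    using fP(1) eq by (auto simp: strict_nonzero)
  have u: "at0 (strict q u) \<noteq> 0" by (rule at0_strict_unit[OF eq(2)])
  have fPq: "strict q fP = strict q u * (strict q \<epsilon> * ?A)" by (simp add: eq(1) strict_mult nz)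
  show ?thesis
  proof (cases "at0 ?A = 0")
    case A: True
    have w: "at0 ?w \<noteq> 0" using resolved_imp_exc_separated[OF f q R] A by simp
    have "nonsingular ?A" "nonsingular (?D * ?w)" "transverse ?A (?D * ?w)"
      using R resolved_at_iff[OF f, of "P # q"] A by (auto simp: exc_divisor_Cons)
    hence "nonsingular ?A" "nonsingular ?D" "transverse ?A ?D"
      using w by (simp_all add: mult.commute[of ?D] nonsingular_unit_mult transverse_unit_mult_right at0_exc_divisor[OF q])
    moreover have "at0 (strict q u * strict q \<epsilon>) \<noteq> 0" using u w eq(3) by (auto simp: cf_1)
    ultimately show ?thesis
      unfolding resolved_at_iff[OF fP] fPq mult.assoc[symmetric]
      using nonsingular_unit_mult[of "strict q u * strict q \<epsilon>" ?A] transverse_unit_mult_left[of "strict q u * strict q \<epsilon>" ?A] A nz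
      by blast
  next
    case A: False
    show ?thesis
    proof (cases "at0 (strict q \<epsilon>) = 0")
      case True
      hence \<epsilon>: "\<epsilon> = exc P" using eq(3) by (auto simp: cf_1)
      have ns: "nonsingular ?w" "nonsingular ?D" "transverse ?w ?D"
        using nonsingular_strict[OF exc_nonzero nonsingular_exc q] True \<epsilon> by auto
      have "strict q fP = (strict q u * ?A) * ?w" by (simp add: fPq \<epsilon> mult_ac)
      moreover have "at0 (strict q u * ?A) \<noteq> 0" using u A by simp
      ultimately show ?thesis
        unfolding resolved_at_iff[OF fP]
        using nonsingular_unit_mult transverse_unit_mult_left ns nz(5) True \<epsilon> by metis
    next
      case False
      thus ?thesis unfolding resolved_at_iff[OF fP] fPq using A u by simp
    qed
  qed
qed

text \<open>
  A resolution of \<open>fP\<close> takes care of the exceptional divisor of the first blow-up if this is part of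
  \<open>fP\<close>. If it is not, it must be assumed absent at the point in question, since it belongs to
  the exceptional divisor that \<open>f\<close> has to be transverse to.
\<close>

lemma resolved_at_tail_converse:
  assumes f: "f \<noteq> 0" "squarefree f" and fP: "fP \<noteq> 0" "squarefree fP"
    and eq: "fP = u * (\<epsilon> * strict1 P f)" "at0 u \<noteq> 0" "\<epsilon> = exc P \<or> \<epsilon> = 1"
    and q: "q \<noteq> []" and R: "resolved_at fP q" and sep: "\<epsilon> = exc P \<or> at0 (strict q (exc P)) \<noteq> 0"
  shows "resolved_at f (P # q)"
proof -
  let ?A = "strict q (strict1 P f)" and ?w = "strict q (exc P)" and ?D = "exc_divisor q"
  have nz: "u \<noteq> 0" "\<epsilon> \<noteq> 0" "strict1 P f \<noteq> 0" "?A \<noteq> 0" "?w \<noteq> 0" "strict q \<epsilon> \<noteq> 0"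
    using fP(1) eq by (auto simp: strict_nonzero)
  have u: "at0 (strict q u) \<noteq> 0" by (rule at0_strict_unit[OF eq(2)])
  have fPq: "strict q fP = (strict q u * strict q \<epsilon>) * ?A" by (simp add: eq(1) strict_mult nz mult.assoc)
  show ?thesis
  proof (cases "at0 ?A = 0")
    case A: True
    hence ns: "nonsingular (strict q fP)" "nonsingular ?D" "transverse (strict q fP) ?D"
      using R resolved_at_iff[OF fP] fPq by auto
    have *: "at0 (strict q u * strict q \<epsilon>) \<noteq> 0"
      using ns(1) not_nonsingular_mult[of "strict q u * strict q \<epsilon>" ?A] A nz u
      unfolding fPq by (auto simp: strict_nonzero)
    hence w: "at0 ?w \<noteq> 0" using sep by auto
    have "nonsingular ?A" "transverse ?A ?D"
      using ns(1,3) * A nz unfolding fPq by (simp_all add: nonsingular_unit_mult transverse_unit_mult_left)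
    thus ?thesis
      using ns(2) w unfolding resolved_at_iff[OF f]
      by (simp add: exc_divisor_Cons mult.commute[of ?D] nonsingular_unit_mult transverse_unit_mult_right at0_exc_divisor[OF q])
  next
    case False
    thus ?thesis by (simp add: resolved_at_iff[OF f])
  qed
qed

text \<open>
  A node is its own normal-crossings part, so that no condition on \<open>\<kappa>\<close> is left. One blow-up
  desingularizes it.
\<close>

lemma weakly_isolated_node:
  assumes f: "reduced_germ f" "singular f" "invariant X f"
    and uv: "f = u * v" "nonsingular u" "nonsingular v" "transverse u v"
  shows "weakly_isolated X f"
proof -
  have nz: "f \<noteq> 0" "squarefree f" "u \<noteq> 0" "v \<noteq> 0" using f(1) uv(1) by (auto simp: reduced_germ_def)
  have res: "resolved_at f [t]" for t
  proof -
    have s: "strict [t] f = strict1 t u * strict1 t v" by (simp add: uv(1) strict1_mult nz)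
    have one: "nonsingular (strict1 t w * strict1 t z) \<and> transverse (strict1 t w * strict1 t z) (exc t)"
      if "w \<noteq> 0" "nonsingular w" "z \<noteq> 0" "at0 (strict1 t w) \<noteq> 0 \<and> at0 (strict1 t z) = 0" "nonsingular z" for w z
      using nonsingular_strict1(1,2)[OF that(3,5)] that
      by (simp add: nonsingular_unit_mult strict1_nonzero transverse_unit_mult_left)
    have "at0 (strict1 t u) \<noteq> 0 \<or> at0 (strict1 t v) \<noteq> 0"
      using transverse_separated[OF nz(3) uv(2) _ nz(4) uv(3)] uv(4) by blast
    hence "at0 (strict [t] f) \<noteq> 0 \<or> nonsingular (strict [t] f) \<and> transverse (strict [t] f) (exc t)"
      unfolding s using one[OF nz(3) uv(2) nz(4) _ uv(3)] one[OF nz(4) uv(3) nz(3) _ uv(2)]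
      by (auto simp: mult.commute)
    thus ?thesis
      unfolding resolved_at_iff[OF nz(1,2)] by (auto simp: exc_divisor_Cons nonsingular_exc)
  qed
  have "desingularization f {[]}"
    unfolding desingularization_def centres_def points_over_def using res by auto
  then obtain T where T: "minimal_desingularization f T"
    by (rule minimal_desingularization_exists)
  have "normal_crossings f" unfolding uv(1) using normal_crossings_mult uv nz by blast
  moreover have no: "\<not> component \<gamma> 1" for \<gamma>
    using irreducible_not_unit by (auto simp: component_def)
  hence "meet_in_origin 1 f"
    by (intro coprime_imp_meet_in_origin) (auto simp: coprime_germs_def component_def)
  ultimately show ?thesis
    unfolding weakly_isolated_def using f T no
    by (intro conjI exI[of _ T] exI[of _ 1] exI[of _ f]) auto
qed

theorem proposition4p1:
  fixes X Y :: vfield and f fP :: hgerm and P :: direction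
  assumes "foliation X"
    and "weakly_isolated X f"
    and "pullback1 P X Y"
    and "reduced_germ fP"
    and "\<And>g. component g fP \<longleftrightarrow> component g (total_transform P f) \<and> invariant Y g"
    and "singular fP"
  shows "weakly_isolated Y fP"
proof -
  define e where "e = exc P"
  define \<epsilon> where "\<epsilon> = (if invariant Y e then e else 1)"
  define \<sigma> where "\<sigma> = strict1 P f"
  have f: "f \<noteq> 0" "squarefree f" "singular f" "invariant X f"
    using assms(2) by (auto simp: weakly_isolated_def reduced_germ_def)
  have fP: "fP \<noteq> 0" "squarefree fP" using assms(4) by (auto simp: reduced_germ_def)
  have "at0 f = 0"
    using f(3) le_mult_iff[OF f(1), of "Suc 0"] by (auto simp: singular_def vanishes_Suc_0)
  then obtain u where u: "at0 u \<noteq> 0" "fP = u * (\<epsilon> * strict1 P f)"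
    using reduced_invariant_germ_eq[OF assms(1) f(1,2,4) _ assms(3) fP assms(5)]
    unfolding \<epsilon>_def e_def by blast
  have \<epsilon>: "\<epsilon> = exc P \<or> \<epsilon> = 1" by (simp add: \<epsilon>_def e_def)
  have e: "e \<noteq> 0" "nonsingular e" by (simp_all add: e_def nonsingular_exc)
  have nz: "u \<noteq> 0" "\<epsilon> \<noteq> 0" "\<sigma> \<noteq> 0" using fP(1) u(2) by (auto simp: \<sigma>_def)
  have invP: "invariant Y fP"
    using invariant_of_components[OF fP(1)] assms(5) by blast
  obtain T g h where T: "minimal_desingularization f T" and gh: "f = g * h" "normal_crossings h"
    and kap: "\<And>\<gamma> q Y'. component \<gamma> g \<Longrightarrow> q \<in> points_over T \<Longrightarrow> passes_through \<gamma> q \<Longrightarrow>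
      pullback q X Y' \<Longrightarrow> kappa Y' (exc_divisor q) \<ge> 1"
    using assms(2) unfolding weakly_isolated_def by blast
  have cT: "centres T" and rT: "\<And>q. q \<in> points_over T \<Longrightarrow> resolved_at f q"
    using T by (auto simp: minimal_desingularization_def desingularization_def)
  show ?thesis
  proof (cases "[P] \<in> T")
    case False
    \<comment> \<open>The curve \<open>f\<close> is resolved at \<open>P\<close>; two branches are possible only if one of them is \<open>e\<close>.\<close>
    have "[P] \<in> points_over T" using cT False by (force simp: points_over_def centres_def)
    hence "resolved_at f [P]" by (rule rT)
    hence res: "at0 \<sigma> \<noteq> 0 \<or> nonsingular \<sigma> \<and> transverse \<sigma> e"
      using resolved_at_iff[OF f(1,2), of "[P]"] by (simp add: \<sigma>_def e_def exc_divisor_Cons)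
    have not_ns: "\<not> nonsingular fP" using assms(6) by (auto simp: singular_def nonsingular_def)
    have at0_fP: "at0 fP = 0"
      using assms(6) le_mult_iff[OF fP(1), of "Suc 0"] by (auto simp: singular_def vanishes_Suc_0)
    have "\<epsilon> = e \<and> at0 \<sigma> = 0"
    proof (rule ccontr)
      assume *: "\<not> (\<epsilon> = e \<and> at0 \<sigma> = 0)"
      consider "\<epsilon> = 1" | "\<epsilon> = e" "at0 \<sigma> \<noteq> 0" using * \<epsilon> by (auto simp: e_def)
      thus False
      proof cases
        case 1
        thus ?thesis using not_ns at0_fP u res nz by (auto simp: \<sigma>_def[symmetric] nonsingular_unit_mult)
      next
        case 2
        have "fP = (u * \<sigma>) * e" using u 2 by (simp add: \<sigma>_def mult_ac)
        moreover have "at0 (u * \<sigma>) \<noteq> 0" using u(1) 2(2) by simp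
        ultimately show ?thesis using not_ns nonsingular_unit_mult[of "u * \<sigma>" e] e by metis
      qed
    qed
    hence "fP = (u * e) * \<sigma>" "nonsingular \<sigma>" "transverse e \<sigma>"
      using u res transverse_sym by (auto simp: \<sigma>_def mult_ac)
    thus ?thesis
      using weakly_isolated_node[OF assms(4,6) invP, of "u * e" \<sigma>] u(1) e
      by (simp add: nonsingular_unit_mult transverse_unit_mult_left e_def)
  next
    case True
    define TP where "TP = {q. P # q \<in> T}"
    have over_TP: "P # q \<in> points_over T" if "q \<in> points_over TP" for q
      using that by (fastforce simp: points_over_def TP_def)
    have "desingularization fP TP"
      unfolding desingularization_def
    proof (intro conjI ballI)
      show "centres TP" unfolding TP_def by (rule centres_tail[OF cT True])
      show "resolved_at fP q" if "q \<in> points_over TP" for q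
        using resolved_at_tail[OF f(1,2) fP u(2,1) \<epsilon> points_over_nonempty[OF that]] rT over_TP[OF that] by blast
    qed
    then obtain T' where T': "minimal_desingularization fP T'" "T' \<subseteq> TP"
      by (rule minimal_desingularization_exists)
    have cT': "centres T'" and rT': "\<And>q. q \<in> points_over T' \<Longrightarrow> resolved_at fP q"
      using T'(1) by (auto simp: minimal_desingularization_def desingularization_def)
    define G where "G = strict1 P g"
    define H where "H = strict1 P h"
    have nz_gh: "g \<noteq> 0" "h \<noteq> 0" using f gh by auto
    have \<sigma>: "\<sigma> = G * H" by (simp add: \<sigma>_def G_def H_def gh(1) strict1_mult nz_gh)
    have nz_GH: "G \<noteq> 0" "H \<noteq> 0" using nz(3) \<sigma> by auto
    have fP_GH: "fP = u * (\<epsilon> * (G * H))" using u(2) \<sigma> by (simp add: \<sigma>_def)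
    have H: "at0 H \<noteq> 0 \<or> (nonsingular H \<and> transverse H e)"
      unfolding H_def e_def by (rule normal_crossings_strict1[OF gh(2)])
    \<comment> \<open>Final points of both desingularizations: the condition on \<open>\<kappa>\<close> is inherited.\<close>
    have good: "kappa Y' (exc_divisor q) \<ge> 1"
      if q: "q \<in> points_over T'" "P # q \<in> points_over T" and s: "component s G" "passes_through s q"
        and Y': "pullback q Y Y'" for q s Y'
    proof -
      obtain \<gamma> where \<gamma>: "component \<gamma> g" "s dvd strict1 P \<gamma>"
        using irreducible_dvd_strict1[OF nz_gh(1), of s P] s(1) by (auto simp: component_def G_def)
      have \<gamma>0: "\<gamma> \<noteq> 0" using \<gamma>(1) by (auto simp: component_def)
      have pass: "at0 (strict (P # q) \<gamma>) = 0"
        using at0_strict_dvd[OF \<gamma>(2) strict1_nonzero[OF \<gamma>0]] s(2) by (simp add: passes_through_def)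
      have "\<gamma> dvd f" using \<gamma>(1) by (auto simp: component_def gh(1))
      hence "at0 (strict (P # q) f) = 0" using at0_strict_dvd[OF _ f(1) pass] by blast
      hence "at0 (strict q (exc P)) \<noteq> 0"
        using resolved_imp_exc_separated[OF f(1,2) points_over_nonempty[OF q(1)] rT[OF q(2)]] by blast
      moreover have "kappa Y' (exc_divisor (P # q)) \<ge> 1"
      proof (rule kap[OF \<gamma>(1) q(2)])
        show "passes_through \<gamma> (P # q)" using pass by (simp add: passes_through_def)
        show "pullback (P # q) X Y'" unfolding pullback.simps using assms(3) Y' by blast
      qed
      ultimately show ?thesis
        by (simp add: exc_divisor_Cons mult.commute[of "exc_divisor q"] kappa_unit_mult)
    qed
    \<comment> \<open>The other points are centres for \<open>f\<close>, and only the presence of \<open>e\<close> explains why.\<close>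
    have bad: "\<epsilon> = 1 \<and> at0 (strict q e) = 0" if q: "q \<in> points_over T'" "P # q \<notin> points_over T" for q
    proof -
      obtain p t where p: "q = p @ [t]" "p \<in> T'" using q(1) by (auto simp: points_over_def)
      have "P # p \<in> T" using p(2) T'(2) by (auto simp: TP_def)
      hence "P # q \<in> T" using q(2) p(1) by (auto simp: points_over_def)
      hence "\<not> resolved_at f (P # q)" using minimal_centre_not_resolved[OF T] by blast
      thus ?thesis
        using resolved_at_tail_converse[OF f(1,2) fP u(2,1) \<epsilon> points_over_nonempty[OF q(1)] rT'[OF q(1)]] \<epsilon>
        by (auto simp: e_def)
    qed
    have finish: "weakly_isolated Y fP"
      if "fP = g' * h'" "normal_crossings h'"
        "\<And>s q Y'. component s g' \<Longrightarrow> q \<in> points_over T' \<Longrightarrow> passes_through s q \<Longrightarrow>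
          pullback q Y Y' \<Longrightarrow> kappa Y' (exc_divisor q) \<ge> 1" for g' h'
    proof -
      have "meet_in_origin g' h'"
        using squarefree_mult_imp_coprime[of g' h'] fP(2) that(1) by (intro coprime_imp_meet_in_origin) simp
      thus ?thesis unfolding weakly_isolated_def using assms(4,6) invP T'(1) that by blast
    qed
    have comp_unit: "component s (u * k) \<Longrightarrow> component s k" for s k
      using unit_mult_dvd_iff[of u k] u(1) irreducible_dvd_mult[of s u k] irreducible_not_unit[of s]
      by (auto simp: component_def dvd_1_iff_at0[symmetric] intro: dvd_trans)
    show ?thesis
    proof (cases "\<exists>q\<in>points_over T'. P # q \<notin> points_over T \<and> at0 (strict q G) = 0")
      case False
      show ?thesis
      proof (rule finish[of "u * G" "\<epsilon> * H"])
        show "fP = u * G * (\<epsilon> * H)" by (simp add: fP_GH mult_ac)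
        show "normal_crossings (\<epsilon> * H)"
        proof (cases "\<epsilon> = 1")
          case True
          thus ?thesis using H normal_crossings_nonsingular nz_GH
            by (auto simp: normal_crossings_def dvd_1_iff_at0)
        next
          case False
          hence "\<epsilon> = e" using \<epsilon> by (simp add: e_def)
          thus ?thesis using normal_crossings_mult[OF e nz_GH(2)] H transverse_sym by blast
        qed
        fix s q Y' assume s: "component s (u * G)" "q \<in> points_over T'" "passes_through s q" "pullback q Y Y'"
        have sG: "component s G" using comp_unit s(1) by blast
        have "at0 (strict q G) = 0"
          using at0_strict_dvd[OF _ nz_GH(1)] sG s(3) by (auto simp: component_def passes_through_def)
        hence "P # q \<in> points_over T" using False s(2) by blast
        thus "kappa Y' (exc_divisor q) \<ge> 1" using good s sG by blast
      qed
    next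
      case True
      then obtain q0 where q0: "q0 \<in> points_over T'" "P # q0 \<notin> points_over T" "at0 (strict q0 G) = 0" by blast
      \<comment> \<open>The branch \<open>\<gamma>\<close> through \<open>q0\<close>, where \<open>\<kappa>\<close> is not under control, moves to the normal-crossings part.\<close>
      have \<epsilon>1: "\<epsilon> = 1" and e0: "at0 (strict q0 e) = 0" using bad[OF q0(1,2)] by auto
      obtain \<gamma> where \<gamma>: "component \<gamma> G" "at0 (strict q0 \<gamma>) = 0"
        using component_through_point[OF nz_GH(1) q0(3)] by blast
      then obtain G' where G': "G = \<gamma> * G'" by (auto simp: component_def elim: dvdE)
      have irr: "irreducible \<gamma>" using \<gamma>(1) by (simp add: component_def)
      have nz': "\<gamma> \<noteq> 0" "G' \<noteq> 0" using nz_GH G' by auto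
      have fP_eq: "fP = u * G' * (\<gamma> * H)" by (simp add: fP_GH \<epsilon>1 G' mult_ac)
      have \<gamma>P: "component \<gamma> fP" using irr by (simp add: component_def fP_eq)
      have at_q0: "nonsingular (strict q0 \<gamma>)" "nonsingular (exc_divisor q0)"
        "transverse (strict q0 \<gamma>) (exc_divisor q0)"
        and uniq: "\<And>s. component s fP \<Longrightarrow> at0 (strict q0 s) = 0 \<Longrightarrow> same_germ \<gamma> s"
        using rT'[OF q0(1)] \<gamma>P \<gamma>(2) by (auto simp: resolved_at_def passes_through_def)
      have ns: "nonsingular \<gamma>"
        by (rule blow_down_along_nonsingular[OF e irr points_over_nonempty[OF q0(1)] e0 at_q0])
      obtain t r where tr: "q0 = t # r" using points_over_nonempty[OF q0(1)] by (cases q0) auto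
      have "at0 (strict1 t \<gamma>) = 0" "at0 (strict1 t e) = 0"
        using \<gamma>(2) e0 at0_strict_unit[of "strict1 t \<gamma>" r] at0_strict_unit[of "strict1 t e" r]
        unfolding tr by auto
      hence H\<gamma>: "at0 H \<noteq> 0 \<or> (nonsingular H \<and> transverse \<gamma> H)"
        using H transverse_same_direction[OF nz'(1) ns _ e] transverse_sym by blast
      show ?thesis
      proof (rule finish[OF fP_eq normal_crossings_mult[OF nz'(1) ns nz_GH(2) H\<gamma>]])
        fix s q Y' assume s: "component s (u * G')" "q \<in> points_over T'" "passes_through s q" "pullback q Y Y'"
        have sG': "component s G'" using comp_unit s(1) by blast
        have sG: "component s G" using sG' by (simp add: component_def G')
        show "kappa Y' (exc_divisor q) \<ge> 1"
        proof (cases "P # q \<in> points_over T")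
          case False
          have "at0 (strict q e) = 0" using bad[OF s(2) False] by blast
          hence "(\<exists>r. q = q0 @ r) \<or> (\<exists>r. q0 = q @ r)"
            using nonsingular_through_comparable_points[OF e e0] by blast
          hence "q = q0" using points_over_comparable_imp_eq[OF cT'] s(2) q0(1) by fastforce
          moreover have "component s fP" using sG' by (auto simp: component_def fP_eq intro: dvd_mult2)
          ultimately have "\<gamma> dvd s" using uniq s(3) by (auto simp: passes_through_def same_germ_def)
          hence "\<gamma> dvd G'" using sG' dvd_trans by (auto simp: component_def)
          hence "\<gamma> dvd u * G'" by (rule dvd_mult)
          hence "\<gamma>\<^sup>2 dvd fP"
            unfolding fP_eq power2_eq_square by (intro mult_dvd_mono) simp_all
          hence False using squarefreeD[OF fP(2)] irreducible_not_unit[OF irr] by blast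
          thus ?thesis ..
        qed (use good s sG in blast)
      qed
    qed
  qed
qed

end
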